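(* Consider the quasilinear wave equation $$\partial_t^2u=\partial_x^2u-u+\kappa a(u)\partial_x^2u+\kappa g(u,\partial_xu),\quad x\in\mathbb{T},\ t\in[0,T],\qquad u(\cdot,0)=u_0,\ \ \partial_tu(\cdot,0)=\dot u_0,$$ with smooth real-valued functions $a,g$ satisfying $a(0)=0$, $g(0,0)=0$. Assume that the coefficient functions $b_1,\bar b_1$ of the one-stage explicit trigonometric integrator (context) satisfy the coefficient assumption (context) with constant $c$. Assume that the exact solution satisfies $(u(\cdot,t),\partial_tu(\cdot,t))\in H^5\times H^4$ with $$|||(u(\cdot,t),\partial_tu(\cdot,t))|||_4\le M\quad\text{for }0\le t\le T,$$ where $M>0$, and that there are $0<\delta<1$ and $A_0\ge0$ such that $1+\kappa a(u(\cdot,t))\ge\delta>0$ and $\kappa a(u(\cdot,t))\le A_0$ for $0\le t\le T$. Then there is a constant $h_0>0$ such that for $0<\kappa\ll1$ and for all $h$ with $\kappa\lesssim h<h_0$, the numerical solution $(u_n,\dot u_n)$ of the time-discrete trigonometric integrator satisfies $$|||(u_n,\dot u_n)-(u(\cdot,t_n),\partial_tu(\cdot,t_n))|||_1\le Ch^2\qquad\text{for }0\le t_n=nh\le T,$$ where the constant $C$ depends on the functions $a$ and $g$, the constant $c$ and the constant $M$, but is independent of the time step-size $h$ and the final time $T$.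
   Context: $\mathbb{T}=\mathbb{R}/(2\pi\mathbb{Z})$; solutions are real-valued. For $v(x)=\sum_{j\in\mathbb{Z}}\hat v_je^{\mathrm{i}jx}$ put $\langle j\rangle=\sqrt{j^2+1}$ and $\|v\|_s^2=\sum_j\langle j\rangle^{2s}|\hat v_j|^2$, the norm of $H^s=H^s(\mathbb{T})$; $|||(u,\dot u)|||_s=(\|u\|_{s+1}^2+\|\dot u\|_s^2)^{1/2}$ is the norm of $H^{s+1}\times H^s$. $0<\kappa\ll1$ means that $\kappa>0$ is small; $\kappa\lesssim h$ means $\kappa\le\mathrm{const}\cdot h$. $\Omega=\sqrt{-\partial_x^2+1}$; functions of $h\Omega$ act as Fourier multipliers ($\Omega e^{\mathrm{i}jx}=\langle j\rangle e^{\mathrm{i}jx}$); $V=h^2\Omega^2$; $\mathrm{sinc}(\xi)=\sin(\xi)/\xi$. Put $f(u)=a(u)\partial_x^2u+g(u,\partial_xu)$, so that the equation reads $\partial_t^2u=-\Omega^2u+\kappa f(u)$. One-stage explicit trigonometric integrator with step size $h$, with $c_1=1/2$ (part of the coefficient assumption), started from $(u_0,\dot u_0)$: $u_{n+1/2}=\cos(\tfrac12h\Omega)u_n+\tfrac12h\,\mathrm{sinc}(\tfrac12h\Omega)\dot u_n$, $u_{n+1}=\cos(h\Omega)u_n+h\,\mathrm{sinc}(h\Omega)\dot u_n+\kappa h^2\bar b_1(V)f(u_{n+1/2})$, $\dot u_{n+1}=-\Omega\sin(h\Omega)u_n+\cos(h\Omega)\dot u_n+\kappa h\,b_1(V)f(u_{n+1/2})$.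 Coefficient assumption: the symmetry condition $c_1=1/2$, $\mathrm{sinc}(h\Omega)b_1(V)=(I+\cos(h\Omega))\bar b_1(V)$ holds, and there is a constant $c$ such that for all $\xi\ge0$: $|\xi\bar b_1(\xi^2)|\le c$, $|\xi^2\bar b_1(\xi^2)|\le c$, $|\bar b_1(\xi^2)-\tfrac12\mathrm{sinc}(\tfrac12\xi)|\le c\,\xi$, $|\xi b_1(\xi^2)|\le c$, $|b_1(\xi^2)-\cos(\tfrac12\xi)|\le c\,\xi^2$, $|\xi\,\mathrm{sinc}(\xi)^{-1}b_1(\xi^2)|\le c$. *)

theory Defs
  imports "HOL-Analysis.Analysis" "HOL-Probability.Sinc_Integral"
begin

text \<open>Functions on the torus are \<open>2\<pi>\<close>-periodic functions on the reals.
  \<open>C_k k f\<close> says that \<open>f\<close> is \<open>k\<close> times continuously differentiable on a whole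
  (finite-dimensional) space; it is used on \<open>\<real>\<close> and on \<open>\<real> \<times> \<real>\<close>.\<close>

primrec C_k :: "nat \<Rightarrow> ('a::real_normed_vector \<Rightarrow> real) \<Rightarrow> bool" where
  "C_k 0 f \<longleftrightarrow> continuous_on UNIV f"
| "C_k (Suc k) f \<longleftrightarrow>
     (\<forall>x. f differentiable (at x)) \<and> (\<forall>v. C_k k (\<lambda>x. frechet_derivative f (at x) v))"

definition smooth :: "('a::real_normed_vector \<Rightarrow> real) \<Rightarrow> bool" where
  "smooth f \<longleftrightarrow> (\<forall>k. C_k k f)"


definition japanese :: "int \<Rightarrow> real" where
  "japanese j = sqrt ((real_of_int j)\<^sup>2 + 1)"

definition fourier_coeff :: "(real \<Rightarrow> real) \<Rightarrow> int \<Rightarrow> complex" where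
  "fourier_coeff v j =
     (1 / (2 * pi)) *\<^sub>R integral {0..2 * pi} (\<lambda>x. complex_of_real (v x) * cis (- (real_of_int j * x)))"

definition periodic_L2 :: "(real \<Rightarrow> real) \<Rightarrow> bool" where
  "periodic_L2 v \<longleftrightarrow> (\<forall>x. v (x + 2 * pi) = v x) \<and>
     v \<in> borel_measurable (lebesgue_on {0..2 * pi}) \<and>
     integrable (lebesgue_on {0..2 * pi}) (\<lambda>x. (v x)\<^sup>2)"

text \<open>A member of \<open>in_sobolev s\<close> is an arbitrary representative of its almost-everywhere class.
  \<open>sobolev_norm s\<close> is the \<open>H\<^sup>s\<close>-norm on members of \<open>in_sobolev s\<close> only: the
  infinite sum is \<open>0\<close> by convention when it diverges, so bounds on the norm
  have to be accompanied by membership.\<close>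

definition in_sobolev :: "real \<Rightarrow> (real \<Rightarrow> real) \<Rightarrow> bool" where
  "in_sobolev s v \<longleftrightarrow> periodic_L2 v \<and>
     (\<lambda>j. japanese j powr (2 * s) * (cmod (fourier_coeff v j))\<^sup>2) summable_on UNIV"

definition sobolev_norm :: "real \<Rightarrow> (real \<Rightarrow> real) \<Rightarrow> real" where
  "sobolev_norm s v =
     sqrt (\<Sum>\<^sub>\<infinity>j. japanese j powr (2 * s) * (cmod (fourier_coeff v j))\<^sup>2)"

definition in_energy_space :: "real \<Rightarrow> (real \<Rightarrow> real) \<Rightarrow> (real \<Rightarrow> real) \<Rightarrow> bool" where
  "in_energy_space s u v \<longleftrightarrow> in_sobolev (s + 1) u \<and> in_sobolev s v"

definition energy_norm :: "real \<Rightarrow> (real \<Rightarrow> real) \<Rightarrow> (real \<Rightarrow> real) \<Rightarrow> real" where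
  "energy_norm s u v = sqrt ((sobolev_norm (s + 1) u)\<^sup>2 + (sobolev_norm s v)\<^sup>2)"


text \<open>\<open>fun_Omega \<phi> v\<close> is \<open>\<phi>(\<Omega>) v\<close>, the Fourier multiplier with symbol \<open>\<phi>(\<langle>j\<rangle>)\<close>, as a pointwise sum.
  For real \<open>v\<close> the sum is real, because \<open>\<phi>(\<langle>j\<rangle>)\<close> is real and even in \<open>j\<close>; \<open>Re\<close> only
  adjusts the type. In the integrator below, started from data in \<open>H\<^sup>5 \<times> H\<^sup>4\<close> with coefficient
  functions as in \<open>coeff_assumption\<close>, all iterates stay in \<open>H\<^sup>5 \<times> H\<^sup>4\<close> and the nonlinearity
  is evaluated at functions in \<open>H\<^sup>5\<close>, so that these sums converge absolutely and the
  \<open>x\<close>-derivatives in \<open>nonlin\<close> are classical.\<close>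

definition fun_Omega :: "(real \<Rightarrow> real) \<Rightarrow> (real \<Rightarrow> real) \<Rightarrow> real \<Rightarrow> real" where
  "fun_Omega \<phi> v x =
     Re (\<Sum>\<^sub>\<infinity>j. complex_of_real (\<phi> (japanese j)) * fourier_coeff v j * cis (real_of_int j * x))"

definition nonlin :: "(real \<Rightarrow> real) \<Rightarrow> (real \<times> real \<Rightarrow> real) \<Rightarrow> (real \<Rightarrow> real) \<Rightarrow> real \<Rightarrow> real" where
  "nonlin a g u x = a (u x) * deriv (deriv u) x + g (u x, deriv u x)"

text \<open>\<open>u\<close> (time argument first) solves the Cauchy problem on \<open>[0, T]\<close> in the classical sense,
  with \<open>ut\<close> its time derivative; the time derivatives are one-sided at \<open>0\<close> and \<open>T\<close>.\<close>

definition wave_solution ::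
  "real \<Rightarrow> (real \<Rightarrow> real) \<Rightarrow> (real \<times> real \<Rightarrow> real) \<Rightarrow> real \<Rightarrow> (real \<Rightarrow> real) \<Rightarrow> (real \<Rightarrow> real)
    \<Rightarrow> (real \<Rightarrow> real \<Rightarrow> real) \<Rightarrow> (real \<Rightarrow> real \<Rightarrow> real) \<Rightarrow> bool" where
  "wave_solution \<kappa> a g T u0 v0 u ut \<longleftrightarrow>
     u 0 = u0 \<and> ut 0 = v0 \<and>
     (\<forall>t\<in>{0..T}. \<forall>x.
        u t (x + 2 * pi) = u t x \<and>
        u t differentiable (at x) \<and> deriv (u t) differentiable (at x) \<and>
        ((\<lambda>s. u s x) has_real_derivative ut t x) (at t within {0..T}) \<and>
        ((\<lambda>s. ut s x) has_real_derivative
           deriv (deriv (u t)) x - u t x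
             + \<kappa> * a (u t x) * deriv (deriv (u t)) x + \<kappa> * g (u t x, deriv (u t) x))
          (at t within {0..T}))"


definition midpoint_value :: "real \<Rightarrow> (real \<Rightarrow> real) \<Rightarrow> (real \<Rightarrow> real) \<Rightarrow> real \<Rightarrow> real" where
  "midpoint_value h u v x =
     fun_Omega (\<lambda>\<omega>. cos (h / 2 * \<omega>)) u x + h / 2 * fun_Omega (\<lambda>\<omega>. sinc (h / 2 * \<omega>)) v x"

definition trig_step ::
  "(real \<Rightarrow> real) \<Rightarrow> (real \<Rightarrow> real) \<Rightarrow> (real \<Rightarrow> real) \<Rightarrow> (real \<times> real \<Rightarrow> real) \<Rightarrow> real \<Rightarrow> real
    \<Rightarrow> (real \<Rightarrow> real) \<times> (real \<Rightarrow> real) \<Rightarrow> (real \<Rightarrow> real) \<times> (real \<Rightarrow> real)" where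
  "trig_step b1 bbar1 a g \<kappa> h = (\<lambda>(u, v).
     let F = nonlin a g (midpoint_value h u v) in
     (\<lambda>x. fun_Omega (\<lambda>\<omega>. cos (h * \<omega>)) u x + h * fun_Omega (\<lambda>\<omega>. sinc (h * \<omega>)) v x
            + \<kappa> * h\<^sup>2 * fun_Omega (\<lambda>\<omega>. bbar1 (h\<^sup>2 * \<omega>\<^sup>2)) F x,
      \<lambda>x. - fun_Omega (\<lambda>\<omega>. \<omega> * sin (h * \<omega>)) u x + fun_Omega (\<lambda>\<omega>. cos (h * \<omega>)) v x
            + \<kappa> * h * fun_Omega (\<lambda>\<omega>. b1 (h\<^sup>2 * \<omega>\<^sup>2)) F x))"

definition trig_integrator ::
  "(real \<Rightarrow> real) \<Rightarrow> (real \<Rightarrow> real) \<Rightarrow> (real \<Rightarrow> real) \<Rightarrow> (real \<times> real \<Rightarrow> real) \<Rightarrow> real \<Rightarrow> real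
    \<Rightarrow> (real \<Rightarrow> real) \<Rightarrow> (real \<Rightarrow> real) \<Rightarrow> nat \<Rightarrow> (real \<Rightarrow> real) \<times> (real \<Rightarrow> real)" where
  "trig_integrator b1 bbar1 a g \<kappa> h u0 v0 n = (trig_step b1 bbar1 a g \<kappa> h ^^ n) (u0, v0)"

text \<open>The first conjunct is the operator identity
  \<open>sinc(h\<Omega>) b\<^sub>1(V) = (I + cos(h\<Omega>)) bbar\<^sub>1(V)\<close> for all step sizes, read off on the symbols
  (\<open>c\<^sub>1 = 1/2\<close> is built into \<open>midpoint_value\<close>).
  The last bound, on \<open>\<xi> sinc(\<xi>)\<^sup>-\<^sup>1 b\<^sub>1(\<xi>\<^sup>2)\<close>, is multiplied out: at the zeros of \<open>sinc\<close> the
  quotient can only be bounded if \<open>b\<^sub>1(\<xi>\<^sup>2)\<close> vanishes, whereas division by zero would make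
  the bound void there.\<close>

definition coeff_assumption :: "real \<Rightarrow> (real \<Rightarrow> real) \<Rightarrow> (real \<Rightarrow> real) \<Rightarrow> bool" where
  "coeff_assumption c b1 bbar1 \<longleftrightarrow>
     (\<forall>h>0. \<forall>j. sinc (h * japanese j) * b1 (h\<^sup>2 * (japanese j)\<^sup>2)
                 = (1 + cos (h * japanese j)) * bbar1 (h\<^sup>2 * (japanese j)\<^sup>2)) \<and>
     (\<forall>\<xi>\<ge>0. \<bar>\<xi> * bbar1 (\<xi>\<^sup>2)\<bar> \<le> c \<and>
             \<bar>\<xi>\<^sup>2 * bbar1 (\<xi>\<^sup>2)\<bar> \<le> c \<and>
             \<bar>bbar1 (\<xi>\<^sup>2) - 1 / 2 * sinc (1 / 2 * \<xi>)\<bar> \<le> c * \<xi> \<and>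
             \<bar>\<xi> * b1 (\<xi>\<^sup>2)\<bar> \<le> c \<and>
             \<bar>b1 (\<xi>\<^sup>2) - cos (1 / 2 * \<xi>)\<bar> \<le> c * \<xi>\<^sup>2 \<and>
             \<bar>\<xi> * b1 (\<xi>\<^sup>2)\<bar> \<le> c * \<bar>sinc \<xi>\<bar>)"

end

theory Submission
  imports Defs
begin

text \<open>In Fourier space the linear part of the integrator is a rotation that preserves the energy norm,
  and the coefficient bounds make one step Lipschitz in this norm with constant \<open>1 + O(\<kappa>)\<close>, without
  loss of derivatives: \<open>\<xi>\<^sup>2 bbar1(\<xi>\<^sup>2)\<close> and \<open>\<xi> b1(\<xi>\<^sup>2)\<close> are bounded, and the nonlinearity is
  Lipschitz from \<open>H\<^sup>2\<close> to \<open>L\<^sup>2\<close> on bounded sets. Over \<open>[0, T]\<close> the errors are thus amplified by at most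
  \<open>exp (O(\<kappa> T / h)) \<le> exp (O(K T))\<close>. All local errors carry a factor \<open>\<kappa>\<close>, and in the frame rotated to the
  midpoint of the step the symmetry condition reduces them to first and second time differences of
  the nonlinearity. Interpolating these between \<open>L\<^sup>2\<close>, where they are \<open>O(h)\<close> and \<open>O(h\<^sup>2)\<close>, and \<open>H\<^sup>3\<close>,
  where they are bounded, gives a local error \<open>O(\<kappa> h\<^sup>7\<^sup>/\<^sup>3 + \<kappa>\<^sup>2 h\<^sup>2)\<close> in the energy norm. The accumulated
  error \<open>O(\<kappa> h\<^sup>4\<^sup>/\<^sup>3 + \<kappa>\<^sup>2 h)\<close> is below \<open>h\<^sup>2\<close>, because \<open>\<kappa> \<le> K h\<close> and \<open>\<kappa>\<close> may be chosen small
  depending on \<open>K\<close> and \<open>T\<close>.\<close>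

section \<open>The sequence space\<close>

text \<open>The obstacle is that the numerical solution is uniformly controlled only in H^2 x H^1,
  through its distance to the exact one, so its second derivative is bounded only in L2. Differences
  of \<open>a\<close> must therefore never multiply that derivative: the Lipschitz estimate of the
  nonlinearity is made asymmetric, the undifferenced second derivative always belonging to the
  smoother argument. The H^3 x H^2 bounds on the iterates only make the series classical and enter
  no constant. The distance stays below 1 by a bootstrap along the steps, since it is bounded by h^2
  with h < 1. The exponent 4/3 comes from U in H^5: the nonlinearity costs two derivatives, so H^3
  is the upper end of the interpolation. A first difference in H^2, multiplied by h, and a second
  difference in H^1 then both have size h^(4/3). The exact solution is given pointwise and
  classically; Fourier inversion identifies it with its series before anything can be said about
  coefficients, and Taylor estimates in time that are uniform in x replace differentiation under the
  integral.\<close>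

definition ell2 :: "real \<Rightarrow> ('i \<Rightarrow> 'a::real_normed_vector) \<Rightarrow> bool" where
  "ell2 B x \<longleftrightarrow> (\<forall>J. finite J \<longrightarrow> L2_set (\<lambda>j. norm (x j)) J \<le> B)"

lemma ell2_nonneg: "ell2 B x \<Longrightarrow> 0 \<le> B"
  unfolding ell2_def by (drule spec[of _ "{}"]) simp

text \<open>The value types of \<open>x\<close> and \<open>y\<close> differ because complex
  coefficients, pairs of them and real majorants are compared with each other.\<close>

lemma ell2_cmul:
  fixes x :: "'i \<Rightarrow> 'a::real_normed_vector" and y :: "'i \<Rightarrow> 'b::real_normed_vector"
  assumes "ell2 B y" "0 \<le> K" "\<And>j. norm (x j) \<le> K * norm (y j)"
  shows "ell2 (K * B) x"
  unfolding ell2_def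
proof (intro allI impI)
  fix J :: "'i set" assume "finite J"
  have "L2_set (\<lambda>j. norm (x j)) J \<le> L2_set (\<lambda>j. K * norm (y j)) J"
    by (rule L2_set_mono) (use assms in auto)
  also have "\<dots> = K * L2_set (\<lambda>j. norm (y j)) J"
    using L2_set_right_distrib[OF assms(2), of "\<lambda>j. norm (y j)" J] by simp
  also have "\<dots> \<le> K * B"
    using assms \<open>finite J\<close> by (intro mult_left_mono) (auto simp: ell2_def)
  finally show "L2_set (\<lambda>j. norm (x j)) J \<le> K * B" .
qed

lemma ell2_mono:
  assumes "ell2 B y" "B \<le> B'" "\<And>j. norm (x j) \<le> norm (y j)"
  shows "ell2 B' x"
  using ell2_cmul[of B y 1 x] assms unfolding ell2_def by fastforce

lemma ell2_add:
  fixes x y :: "'i \<Rightarrow> 'a::real_normed_vector"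
  assumes "ell2 A x" "ell2 B y"
  shows "ell2 (A + B) (\<lambda>j. x j + y j)"
  unfolding ell2_def
proof (intro allI impI)
  fix J :: "'i set" assume "finite J"
  have "L2_set (\<lambda>j. norm (x j + y j)) J \<le> L2_set (\<lambda>j. norm (x j) + norm (y j)) J"
    by (rule L2_set_mono) (auto simp: norm_triangle_ineq)
  also have "\<dots> \<le> L2_set (\<lambda>j. norm (x j)) J + L2_set (\<lambda>j. norm (y j)) J"
    by (rule L2_set_triangle_ineq)
  also have "\<dots> \<le> A + B" using assms \<open>finite J\<close> by (auto simp: ell2_def intro: add_mono)
  finally show "L2_set (\<lambda>j. norm (x j + y j)) J \<le> A + B" .
qed

lemma ell2_diff:
  assumes "ell2 A x" "ell2 B y"
  shows "ell2 (A + B) (\<lambda>j. x j - y j)"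
  using ell2_add[OF assms(1), of B "\<lambda>j. - y j"] ell2_mono[OF assms(2), of B "\<lambda>j. - y j"]
  by simp

lemma ell2_iff_sum:
  "ell2 B x \<longleftrightarrow> 0 \<le> B \<and> (\<forall>J. finite J \<longrightarrow> (\<Sum>j\<in>J. (norm (x j))\<^sup>2) \<le> B\<^sup>2)"
proof
  assume H: "ell2 B x"
  then have "0 \<le> B" by (rule ell2_nonneg)
  with H show "0 \<le> B \<and> (\<forall>J. finite J \<longrightarrow> (\<Sum>j\<in>J. (norm (x j))\<^sup>2) \<le> B\<^sup>2)"
    unfolding ell2_def L2_set_def using sqrt_le_D by blast
next
  assume "0 \<le> B \<and> (\<forall>J. finite J \<longrightarrow> (\<Sum>j\<in>J. (norm (x j))\<^sup>2) \<le> B\<^sup>2)"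
  then show "ell2 B x" unfolding ell2_def L2_set_def
    by (auto intro: real_le_lsqrt sum_nonneg)
qed

text \<open>Bridge to the infinite sums in \<open>sobolev_norm\<close>, which carry information only
  together with summability. Bounds on finite sections, as in \<open>ell2\<close>, have no such side
  condition.\<close>

lemma ell2_iff_summable:
  "ell2 B x \<longleftrightarrow> 0 \<le> B \<and> (\<lambda>j. (norm (x j))\<^sup>2) summable_on UNIV \<and> (\<Sum>\<^sub>\<infinity>j. (norm (x j))\<^sup>2) \<le> B\<^sup>2"
proof
  assume H: "ell2 B x"
  then have *: "0 \<le> B" "\<And>J. finite J \<Longrightarrow> (\<Sum>j\<in>J. (norm (x j))\<^sup>2) \<le> B\<^sup>2"
    by (auto simp: ell2_iff_sum)
  have "(\<lambda>j. (norm (x j))\<^sup>2) summable_on UNIV"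
    by (rule nonneg_bdd_above_summable_on) (use * in \<open>auto intro!: bdd_aboveI2\<close>)
  then show "0 \<le> B \<and> (\<lambda>j. (norm (x j))\<^sup>2) summable_on UNIV \<and> (\<Sum>\<^sub>\<infinity>j. (norm (x j))\<^sup>2) \<le> B\<^sup>2"
    using * by (auto intro: infsum_le_finite_sums)
next
  assume H: "0 \<le> B \<and> (\<lambda>j. (norm (x j))\<^sup>2) summable_on UNIV \<and> (\<Sum>\<^sub>\<infinity>j. (norm (x j))\<^sup>2) \<le> B\<^sup>2"
  then show "ell2 B x" unfolding ell2_iff_sum
    by (meson dual_order.trans finite_sum_le_infsum subset_UNIV zero_le_power2)
qed

text \<open>Fatou property: a bound on finite sections survives merely coordinatewise convergence.
  It later turns difference quotients of translations into a derivative bound.\<close>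

lemma ell2_limit:
  assumes "F \<noteq> bot" "\<And>j. ((\<lambda>s. x s j) \<longlongrightarrow> y j) F" "\<forall>\<^sub>F s in F. ell2 B (x s)"
  shows "ell2 B y"
proof -
  have "0 \<le> B" using eventually_happens[OF assms(3)] assms(1) ell2_nonneg by auto
  moreover have "(\<Sum>j\<in>J. (norm (y j))\<^sup>2) \<le> B\<^sup>2" if "finite J" for J
  proof (rule tendsto_upperbound[OF _ _ assms(1)])
    show "((\<lambda>s. \<Sum>j\<in>J. (norm (x s j))\<^sup>2) \<longlongrightarrow> (\<Sum>j\<in>J. (norm (y j))\<^sup>2)) F"
      by (intro tendsto_intros assms)
    show "\<forall>\<^sub>F s in F. (\<Sum>j\<in>J. (norm (x s j))\<^sup>2) \<le> B\<^sup>2"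
      using assms(3) by (rule eventually_mono) (use that in \<open>auto simp: ell2_iff_sum\<close>)
  qed
  ultimately show ?thesis by (auto simp: ell2_iff_sum)
qed

text \<open>Testing with the increment itself reduces this to the scalar mean value theorem.\<close>

lemma ell2_mvt:
  fixes x x' :: "real \<Rightarrow> 'i \<Rightarrow> 'a::real_inner"
  assumes ab: "a \<le> b"
    and der: "\<And>j s. s \<in> {a..b} \<Longrightarrow> ((\<lambda>s. x s j) has_vector_derivative x' s j) (at s within {a..b})"
    and B: "\<And>s. s \<in> {a..b} \<Longrightarrow> ell2 B (x' s)"
  shows "ell2 (B * (b - a)) (\<lambda>j. x b j - x a j)"
  unfolding ell2_def
proof (intro allI impI)
  fix J :: "'i set" assume J: "finite J"
  define e where "e j = x b j - x a j" for j
  define \<phi> where "\<phi> s = (\<Sum>j\<in>J. e j \<bullet> x s j)" for s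
  define E where "E = L2_set (\<lambda>j. norm (e j)) J"
  have E2: "(\<Sum>j\<in>J. e j \<bullet> e j) = E\<^sup>2"
    unfolding E_def L2_set_def by (simp add: sum_nonneg power2_norm_eq_inner)
  have "E \<le> B * (b - a)"
  proof (cases "a < b")
    case True
    have D: "(\<phi> has_real_derivative (\<Sum>j\<in>J. e j \<bullet> x' s j)) (at s within {a..b})" if "s \<in> {a..b}" for s
      unfolding \<phi>_def has_real_derivative_iff_has_vector_derivative
      by (intro has_vector_derivative_sum
          bounded_linear.has_vector_derivative[OF bounded_linear_inner_right] der that)
    obtain s where s: "a < s" "s < b" and eq: "\<phi> b - \<phi> a = (b - a) * (\<Sum>j\<in>J. e j \<bullet> x' s j)"
    proof -
      have "\<exists>s\<in>{a<..<b}. \<phi> b - \<phi> a = (\<lambda>h. h * (\<Sum>j\<in>J. e j \<bullet> x' s j)) (b - a)"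
      proof (rule mvt_simple[OF True])
        show "(\<phi> has_derivative (\<lambda>h. h * (\<Sum>j\<in>J. e j \<bullet> x' s j))) (at s within {a..b})"
          if "a \<le> s" "s \<le> b" for s
          using D[of s] that unfolding has_field_derivative_def by (simp add: mult_commute_abs)
      qed
      then show ?thesis using that by (auto simp: mult.commute)
    qed
    have "E\<^sup>2 = \<phi> b - \<phi> a"
      unfolding \<phi>_def E2[symmetric] by (simp add: e_def inner_diff_right sum_subtractf)
    also have "\<dots> = (b - a) * (\<Sum>j\<in>J. e j \<bullet> x' s j)" by (rule eq)
    also have "\<dots> \<le> (b - a) * (\<Sum>j\<in>J. \<bar>norm (e j)\<bar> * \<bar>norm (x' s j)\<bar>)"
      using ab by (intro mult_left_mono sum_mono) (auto simp: norm_cauchy_schwarz)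
    also have "\<dots> \<le> (b - a) * (E * L2_set (\<lambda>j. norm (x' s j)) J)"
      unfolding E_def using ab by (intro mult_left_mono L2_set_mult_ineq) auto
    also have "\<dots> \<le> (b - a) * (E * B)"
      using B[of s] s J ab by (intro mult_left_mono) (auto simp: ell2_def E_def)
    finally have "E * E \<le> E * (B * (b - a))" by (simp add: power2_eq_square mult_ac)
    then have "E \<le> B * (b - a) \<or> E \<le> 0" by (metis linorder_not_le mult_le_cancel_left_pos)
    moreover have "ell2 B (x' s)" using s by (intro B) simp
    then have "0 \<le> B" by (rule ell2_nonneg)
    then have "0 \<le> B * (b - a)" using ab by simp
    ultimately show ?thesis by linarith
  next
    case False
    then have "a = b" using ab by simp
    then show ?thesis by (simp add: E_def e_def L2_set_def)
  qed
  then show "L2_set (\<lambda>j. norm (x b j - x a j)) J \<le> B * (b - a)" by (simp add: E_def e_def)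
qed

section \<open>Sobolev weights and absolutely summable coefficients\<close>

lemma japanese_ge_1: "1 \<le> japanese j"
  by (simp add: japanese_def)

lemma japanese_pos [simp]: "0 < japanese j"
  using japanese_ge_1[of j] by linarith

lemma japanese_nonneg [simp]: "0 \<le> japanese j"
  using japanese_pos[of j] by linarith

lemma japanese_nz [simp]: "japanese j \<noteq> 0"
  using japanese_pos[of j] by linarith

lemma japanese_minus [simp]: "japanese (- j) = japanese j"
  by (simp add: japanese_def)

lemma japanese_sq: "(japanese j)\<^sup>2 = (real_of_int j)\<^sup>2 + 1"
  by (simp add: japanese_def add_nonneg_nonneg)

lemma abs_le_japanese: "\<bar>real_of_int j\<bar> \<le> japanese j"
  unfolding japanese_def by (rule real_le_rsqrt) simp

text \<open>The correction \<open>2 / real (Suc N)\<close> makes the induction close: the two new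
  terms at distance n are at most 2/((n-1)n) = 2/(n-1) - 2/n together, which telescopes.\<close>

lemma sum_inverse_japanese_sq: "(\<Sum>j\<in>{- int (Suc N)..int (Suc N)}. 1 / (japanese j)\<^sup>2) \<le> 4 - 2 / real (Suc N)"
proof (induction N)
  case 0
  have "{- int (Suc 0)..int (Suc 0)} = {-1, 0, 1}" by auto
  then show ?case by (simp add: japanese_sq)
next
  case (Suc N)
  let ?n = "int (Suc (Suc N))"
  have pf: "2 / (x * (x + 1)) = 2 / x - 2 / (x + 1)" if "x > 0" for x :: real
    using that by (simp add: field_simps)
  have sq: "(- 2 - real N)\<^sup>2 = (2 + real N)\<^sup>2" by (simp add: power2_eq_square algebra_simps)
  have "{- ?n..?n} = insert ?n (insert (- ?n) {- int (Suc N)..int (Suc N)})" by auto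
  then have "(\<Sum>j\<in>{- ?n..?n}. 1 / (japanese j)\<^sup>2)
      = (\<Sum>j\<in>{- int (Suc N)..int (Suc N)}. 1 / (japanese j)\<^sup>2) + 2 / ((real (Suc (Suc N)))\<^sup>2 + 1)"
    by (simp add: japanese_sq sq)
  also have "\<dots> \<le> 4 - 2 / real (Suc N) + 2 / (real (Suc N) * real (Suc (Suc N)))"
    by (intro add_mono Suc divide_left_mono mult_pos_pos)
       (simp_all add: power2_eq_square algebra_simps add_pos_nonneg)
  also have "\<dots> = 4 - 2 / real (Suc (Suc N))"
    using pf[of "real (Suc N)"] by (simp add: add.commute)
  finally show ?case .
qed

lemma ell2_inverse_japanese: "ell2 2 (\<lambda>j. 1 / japanese j)"
  unfolding ell2_iff_sum
proof (intro conjI allI impI)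
  fix J :: "int set" assume J: "finite J"
  obtain N where N: "J \<subseteq> {- int (Suc N)..int (Suc N)}"
  proof -
    have "bdd_above (abs ` J)" using J by (intro bdd_above_finite) simp
    then obtain b where "\<forall>j\<in>J. \<bar>j\<bar> \<le> b" unfolding bdd_above_def by auto
    then have "J \<subseteq> {- int (Suc (nat b))..int (Suc (nat b))}" by force
    then show ?thesis by (rule that)
  qed
  have "(\<Sum>j\<in>J. (norm (1 / japanese j))\<^sup>2) = (\<Sum>j\<in>J. 1 / (japanese j)\<^sup>2)"
    by (simp add: power_divide)
  also have "\<dots> \<le> (\<Sum>j\<in>{- int (Suc N)..int (Suc N)}. 1 / (japanese j)\<^sup>2)"
    by (rule sum_mono2) (use N in auto)
  also have "\<dots> \<le> 2\<^sup>2" using order_trans[OF sum_inverse_japanese_sq[of N], of 4] by simp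
  finally show "(\<Sum>j\<in>J. (norm (1 / japanese j))\<^sup>2) \<le> 2\<^sup>2" .
qed simp

abbreviation sob :: "nat \<Rightarrow> real \<Rightarrow> (int \<Rightarrow> complex) \<Rightarrow> bool" where
  "sob k B c \<equiv> ell2 B (\<lambda>j. japanese j ^ k *\<^sub>R c j)"

text \<open>Cauchy-Schwarz against 1/<j>, whose ell2 bound 2 is the factor in all later sup bounds.
  This is the embedding of H^1 into absolutely convergent Fourier series.\<close>

lemma ell2_imp_abs_summable:
  fixes c :: "int \<Rightarrow> complex"
  assumes "ell2 B (\<lambda>j. japanese j *\<^sub>R c j)"
  shows "(\<lambda>j. norm (c j)) summable_on UNIV" "(\<Sum>\<^sub>\<infinity>j. norm (c j)) \<le> 2 * B"
proof -
  have *: "(\<Sum>j\<in>J. norm (c j)) \<le> 2 * B" if "finite J" for J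
  proof -
    have "(\<Sum>j\<in>J. norm (c j)) = (\<Sum>j\<in>J. \<bar>norm (1 / japanese j)\<bar> * \<bar>norm (japanese j *\<^sub>R c j)\<bar>)"
      by (rule sum.cong) auto
    also have "\<dots> \<le> L2_set (\<lambda>j. norm (1 / japanese j)) J * L2_set (\<lambda>j. norm (japanese j *\<^sub>R c j)) J"
      by (rule L2_set_mult_ineq)
    also have "\<dots> \<le> 2 * B"
      using ell2_inverse_japanese assms that unfolding ell2_def by (intro mult_mono) auto
    finally show ?thesis .
  qed
  show "(\<lambda>j. norm (c j)) summable_on UNIV"
    by (rule nonneg_bdd_above_summable_on) (use * in \<open>auto intro!: bdd_aboveI2\<close>)
  then show "(\<Sum>\<^sub>\<infinity>j. norm (c j)) \<le> 2 * B"
    by (rule infsum_le_finite_sums) (use * in auto)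
qed

section \<open>Trigonometric series\<close>

text \<open>Complex-valued companion of \<open>fourier_coeff\<close>; trigonometric polynomials and
  the quotient in the inversion argument are not real.\<close>

definition cfc :: "(real \<Rightarrow> complex) \<Rightarrow> int \<Rightarrow> complex" where
  "cfc w j = (1 / (2 * pi)) *\<^sub>R integral {0..2 * pi} (\<lambda>x. w x * cis (- (real_of_int j * x)))"

lemma fourier_coeff_eq_cfc: "fourier_coeff v j = cfc (\<lambda>x. complex_of_real (v x)) j"
  by (simp add: fourier_coeff_def cfc_def)

abbreviation asum :: "(int \<Rightarrow> complex) \<Rightarrow> bool" where
  "asum c \<equiv> (\<lambda>j. norm (c j)) summable_on UNIV"

text \<open>The real part mirrors \<open>fun_Omega\<close>. For \<open>hermitian\<close>
  coefficients the sum is already real, and exactly then the coefficients can be recovered from the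
  function.\<close>

definition trig :: "(int \<Rightarrow> complex) \<Rightarrow> real \<Rightarrow> real" where
  "trig c x = Re (\<Sum>\<^sub>\<infinity>j. c j * cis (real_of_int j * x))"

definition hermitian :: "(int \<Rightarrow> complex) \<Rightarrow> bool" where
  "hermitian c \<longleftrightarrow> (\<forall>j. c (- j) = cnj (c j))"

lemma has_vector_derivative_cis_mult:
  "((\<lambda>x. cis (r * x)) has_vector_derivative (\<i> * of_real r * cis (r * x))) (at x within S)"
  unfolding has_vector_derivative_def
  by (rule has_derivative_eq_rhs, (rule derivative_intros)+)
     (auto simp: fun_eq_iff scaleR_conv_of_real)

lemma continuous_on_cis_mult [continuous_intros]: "continuous_on S (\<lambda>x. cis (r * x))"
  by (auto intro!: continuous_at_imp_continuous_on has_vector_derivative_continuous[OF has_vector_derivative_cis_mult])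

lemma continuous_on_cis_mult' [continuous_intros]: "continuous_on S (\<lambda>x. cis (- (r * x)))"
  using continuous_on_cis_mult[of S "- r"] by simp

lemma cis_int_period: "cis (real_of_int k * (2 * pi)) = 1"
  using cis_multiple_2pi[of "real_of_int k"] by (simp add: mult.commute)

lemma has_integral_cis:
  "((\<lambda>x. cis (real_of_int k * x)) has_integral (if k = 0 then of_real (2 * pi) else 0)) {0..2 * pi}"
proof (cases "k = 0")
  case True
  then show ?thesis using has_integral_const_real[of "1::complex" 0 "2 * pi"]
    by (simp add: scaleR_conv_of_real)
next
  case False
  let ?F = "\<lambda>x. cis (real_of_int k * x) / (\<i> * of_int k)"
  have "((\<lambda>x. cis (real_of_int k * x)) has_integral (?F (2 * pi) - ?F 0)) {0..2 * pi}"
  proof (rule fundamental_theorem_of_calculus)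
    fix x
    have "(?F has_vector_derivative (\<i> * of_real (real_of_int k) * cis (real_of_int k * x)) / (\<i> * of_int k))
        (at x within {0..2 * pi})"
      by (intro has_vector_derivative_divide has_vector_derivative_cis_mult)
    then show "(?F has_vector_derivative cis (real_of_int k * x)) (at x within {0..2 * pi})"
      using False by simp
  qed simp
  then show ?thesis using False by (simp add: cis_int_period)
qed

lemma has_integral_cfc:
  assumes "continuous_on {0..2 * pi} w"
  shows "((\<lambda>x. w x * cis (- (real_of_int j * x))) has_integral (of_real (2 * pi) * cfc w j)) {0..2 * pi}"
proof -
  have "(\<lambda>x. w x * cis (- (real_of_int j * x))) integrable_on {0..2 * pi}"
    by (intro integrable_continuous_real continuous_intros assms)
  then have "((\<lambda>x. w x * cis (- (real_of_int j * x))) has_integral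
      integral {0..2 * pi} (\<lambda>x. w x * cis (- (real_of_int j * x)))) {0..2 * pi}"
    by (rule integrable_integral)
  then show ?thesis by (simp add: cfc_def scaleR_conv_of_real)
qed

lemma cfc_eqI:
  "((\<lambda>x. w x * cis (- (real_of_int j * x))) has_integral (of_real (2 * pi) * z)) {0..2 * pi} \<Longrightarrow> cfc w j = z"
  by (auto simp: cfc_def scaleR_conv_of_real dest!: integral_unique)

lemma has_integral_mult_cnj_trig_poly:
  assumes "continuous_on {0..2 * pi} w" "finite J"
  shows "((\<lambda>x. w x * cnj (\<Sum>j\<in>J. d j * cis (real_of_int j * x))) has_integral
     (of_real (2 * pi) * (\<Sum>j\<in>J. cfc w j * cnj (d j)))) {0..2 * pi}"
proof -
  have "((\<lambda>x. \<Sum>j\<in>J. cnj (d j) * (w x * cis (- (real_of_int j * x)))) has_integral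
     (\<Sum>j\<in>J. cnj (d j) * (of_real (2 * pi) * cfc w j))) {0..2 * pi}"
    by (intro has_integral_sum assms has_integral_mult_right has_integral_cfc)
  then show ?thesis
    by (simp add: cis_cnj sum_distrib_left sum_distrib_right mult_ac)
qed

lemma cfc_trig_poly:
  assumes "finite J"
  shows "cfc (\<lambda>x. \<Sum>j\<in>J. d j * cis (real_of_int j * x)) k = (if k \<in> J then d k else 0)"
proof (rule cfc_eqI)
  have *: "d j * (cis (real_of_int j * x) * cis (- (real_of_int k * x))) = d j * cis (real_of_int (j - k) * x)" for j x
    by (simp add: cis_mult algebra_simps)
  have "((\<lambda>x. \<Sum>j\<in>J. d j * cis (real_of_int (j - k) * x)) has_integral
     (\<Sum>j\<in>J. d j * (if j - k = 0 then of_real (2 * pi) else 0))) {0..2 * pi}"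
    by (intro has_integral_sum assms has_integral_mult_right has_integral_cis)
  also have "(\<Sum>j\<in>J. d j * (if j - k = 0 then of_real (2 * pi) else 0)) = (\<Sum>j\<in>J. if j = k then d k * of_real (2 * pi) else 0)"
    by (rule sum.cong) auto
  also have "\<dots> = of_real (2 * pi) * (if k \<in> J then d k else 0)"
    using assms by (simp add: sum.delta)
  finally show "((\<lambda>x. (\<Sum>j\<in>J. d j * cis (real_of_int j * x)) * cis (- (real_of_int k * x))) has_integral
      (of_real (2 * pi) * (if k \<in> J then d k else 0))) {0..2 * pi}"
    by (simp only: sum_distrib_right mult.assoc *)
qed

lemma continuous_on_trig_poly [continuous_intros]:
  "continuous_on S (\<lambda>x. \<Sum>j\<in>J. d j * cis (real_of_int j * x))"
  by (intro continuous_intros)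

lemma has_integral_norm_trig_poly:
  assumes "finite J"
  shows "((\<lambda>x. (norm (\<Sum>j\<in>J. d j * cis (real_of_int j * x)))\<^sup>2) has_integral
     (2 * pi * (\<Sum>j\<in>J. (norm (d j))\<^sup>2))) {0..2 * pi}"
proof -
  let ?S = "\<lambda>x. \<Sum>j\<in>J. d j * cis (real_of_int j * x)"
  have "((\<lambda>x. Re (?S x * cnj (?S x))) has_integral
     Re (of_real (2 * pi) * (\<Sum>j\<in>J. cfc ?S j * cnj (d j)))) {0..2 * pi}"
    by (intro has_integral_linear[OF has_integral_mult_cnj_trig_poly bounded_linear_Re, unfolded o_def]
        assms continuous_intros)
  moreover have "(\<Sum>j\<in>J. cfc ?S j * cnj (d j)) = (\<Sum>j\<in>J. d j * cnj (d j))"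
    by (intro sum.cong) (simp_all add: cfc_trig_poly assms)
  then have "(\<Sum>j\<in>J. cfc ?S j * cnj (d j)) = of_real (\<Sum>j\<in>J. (norm (d j))\<^sup>2)"
    by (simp only: of_real_sum complex_norm_square)
  ultimately show ?thesis
    by (simp only: complex_norm_square[symmetric] Re_complex_of_real of_real_mult[symmetric])
qed

text \<open>Integrate |w - S|^2 >= 0 for the partial sum S over \<open>J\<close>: the cross term and
  the norm of S are both 2 pi times the sum of the squared coefficients.\<close>

lemma bessel:
  assumes w: "continuous_on {0..2 * pi} w"
    and B: "0 \<le> B" "integral {0..2 * pi} (\<lambda>x. (norm (w x))\<^sup>2) \<le> 2 * pi * B\<^sup>2"
  shows "ell2 B (cfc w)"
  unfolding ell2_iff_sum
proof (intro conjI allI impI B)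
  fix J :: "int set" assume J: "finite J"
  let ?S = "\<lambda>x. \<Sum>j\<in>J. cfc w j * cis (real_of_int j * x)"
  let ?s = "\<Sum>j\<in>J. (norm (cfc w j))\<^sup>2"
  have 1: "((\<lambda>x. (norm (w x))\<^sup>2) has_integral integral {0..2 * pi} (\<lambda>x. (norm (w x))\<^sup>2)) {0..2 * pi}"
    by (intro integrable_integral integrable_continuous_real continuous_intros w)
  have "((\<lambda>x. Re (w x * cnj (?S x))) has_integral
     Re (of_real (2 * pi) * (\<Sum>j\<in>J. cfc w j * cnj (cfc w j)))) {0..2 * pi}"
    by (intro has_integral_linear[OF has_integral_mult_cnj_trig_poly bounded_linear_Re, unfolded o_def] J w)
  moreover have "(\<Sum>j\<in>J. cfc w j * cnj (cfc w j)) = of_real ?s"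
    by (simp only: of_real_sum complex_norm_square)
  ultimately have 2: "((\<lambda>x. Re (w x * cnj (?S x))) has_integral (2 * pi * ?s)) {0..2 * pi}"
    by (simp only: Re_complex_of_real of_real_mult[symmetric])
  have 3: "((\<lambda>x. (norm (?S x))\<^sup>2) has_integral (2 * pi * ?s)) {0..2 * pi}"
    by (rule has_integral_norm_trig_poly[OF J])
  have "((\<lambda>x. (norm (w x))\<^sup>2 - 2 * Re (w x * cnj (?S x)) + (norm (?S x))\<^sup>2) has_integral
      (integral {0..2 * pi} (\<lambda>x. (norm (w x))\<^sup>2) - 2 * (2 * pi * ?s) + 2 * pi * ?s)) {0..2 * pi}"
    by (intro has_integral_add has_integral_diff has_integral_mult_right 1 2 3)
  note 4 = this
  have nn: "0 \<le> (norm a)\<^sup>2 - 2 * Re (a * cnj b) + (norm b)\<^sup>2" for a b :: complex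
  proof -
    have "(norm a)\<^sup>2 - 2 * Re (a * cnj b) + (norm b)\<^sup>2 = (norm (a - b))\<^sup>2"
      unfolding cmod_power2 by (simp add: power2_eq_square algebra_simps)
    then show ?thesis by simp
  qed
  have "0 \<le> integral {0..2 * pi} (\<lambda>x. (norm (w x))\<^sup>2) - 2 * (2 * pi * ?s) + 2 * pi * ?s"
    by (rule has_integral_nonneg[OF 4]) (rule nn)
  with B have "2 * pi * ?s \<le> 2 * pi * B\<^sup>2" by linarith
  then show "?s \<le> B\<^sup>2" by simp
qed

lemma trig_has_sum:
  assumes "asum c"
  shows "((\<lambda>j. Re (c j * cis (real_of_int j * x))) has_sum trig c x) UNIV"
  unfolding trig_def
proof (intro has_sum_Re has_sum_infsum)
  have "(\<lambda>j. norm (c j * cis (real_of_int j * x))) summable_on UNIV"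
    using assms by (simp add: norm_mult)
  then show "(\<lambda>j. c j * cis (real_of_int j * x)) summable_on UNIV"
    by (rule abs_summable_summable)
qed

text \<open>Weierstrass M-test along the net of finite index sets, the net that defines
  \<open>infsum\<close>. Continuity, termwise integration and termwise differentiation all rest on
  it.\<close>

lemma trig_uniform_limit:
  assumes "asum c"
  shows "uniform_limit X (\<lambda>J x. \<Sum>j\<in>J. Re (c j * cis (real_of_int j * x))) (trig c) (finite_subsets_at_top UNIV)"
proof (rule Weierstrass_m_test_general'[OF _ trig_has_sum[OF assms] assms])
  show "norm (Re (c j * cis (real_of_int j * x))) \<le> cmod (c j)" for j x
    using abs_Re_le_cmod[of "c j * cis (real_of_int j * x)"] by (simp add: norm_mult)
qed

lemma trig_bound:
  assumes "asum c"
  shows "\<bar>trig c x\<bar> \<le> (\<Sum>\<^sub>\<infinity>j. norm (c j))"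
proof -
  have "\<bar>trig c x\<bar> \<le> norm (\<Sum>\<^sub>\<infinity>j. c j * cis (real_of_int j * x))"
    unfolding trig_def by (rule abs_Re_le_cmod)
  also have "\<dots> \<le> (\<Sum>\<^sub>\<infinity>j. norm (c j * cis (real_of_int j * x)))"
    by (rule norm_infsum_bound) (use assms in \<open>simp add: norm_mult\<close>)
  finally show ?thesis by (simp add: norm_mult)
qed

lemma trig_continuous: "asum c \<Longrightarrow> continuous_on S (trig c)"
  by (rule uniform_limit_theorem[OF _ trig_uniform_limit])
     (auto intro!: always_eventually continuous_intros)

lemma trig_periodic: "trig c (x + 2 * pi) = trig c x"
proof -
  have "cis (real_of_int j * (x + 2 * pi)) = cis (real_of_int j * x)" for j
    using cis_int_period[of j] by (simp add: distrib_left cis_mult[symmetric])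
  then show ?thesis by (simp add: trig_def)
qed

lemma asum_add: "asum c \<Longrightarrow> asum d \<Longrightarrow> asum (\<lambda>j. c j + d j)"
  by (rule summable_on_comparison_test[OF summable_on_add[of "\<lambda>j. norm (c j)" _ "\<lambda>j. norm (d j)"]])
     (auto simp: norm_triangle_ineq)

lemma asum_cmul:
  assumes "asum c" "\<And>j. norm (d j) \<le> K * norm (c j)"
  shows "asum d"
  by (rule summable_on_comparison_test[OF summable_on_cmult_right[OF assms(1), of K]]) (use assms in auto)

lemma trig_add: "asum c \<Longrightarrow> asum d \<Longrightarrow> trig (\<lambda>j. c j + d j) x = trig c x + trig d x"
  using has_sum_add[OF trig_has_sum[of c x] trig_has_sum[of d x]] trig_has_sum[OF asum_add, of c d x]
  by (simp add: algebra_simps has_sum_unique)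

lemma trig_scale: "asum c \<Longrightarrow> trig (\<lambda>j. of_real r * c j) x = r * trig c x"
  using has_sum_cmult_right[OF trig_has_sum[of c x], of r]
    trig_has_sum[OF asum_cmul[of c "\<lambda>j. of_real r * c j" "\<bar>r\<bar>"], of x]
  by (simp add: mult.assoc norm_mult has_sum_unique)

lemma trig_diff:
  assumes "asum c" "asum d"
  shows "trig (\<lambda>j. c j - d j) x = trig c x - trig d x"
  using trig_add[of c "\<lambda>j. of_real (-1) * d j" x] trig_scale[of d "-1" x] assms
  by simp

lemma trig_shift: "trig c (x + \<tau>) = trig (\<lambda>j. c j * cis (real_of_int j * \<tau>)) x"
  by (simp add: trig_def distrib_left cis_mult[symmetric] mult_ac)

text \<open>The differentiated series converges uniformly, so it may be integrated term by term from
  \<open>a\<close> = x - 1; this gives the increment of \<open>trig c\<close>, and differentiating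
  the integral at the interior point x finishes.\<close>

lemma trig_deriv:
  assumes c: "asum c" and c': "asum (\<lambda>j. \<i> * of_int j * c j)"
  shows "(trig c has_real_derivative trig (\<lambda>j. \<i> * of_int j * c j) x) (at x)"
proof -
  define d where "d j = \<i> * of_int j * c j" for j
  define a b where "a = x - 1" and "b = x + 1"
  have FTC: "integral {a..y} (trig d) = trig c y - trig c a" if "a \<le> y" for y
  proof -
    let ?f = "\<lambda>J x. \<Sum>j\<in>J. Re (d j * cis (real_of_int j * x))"
    let ?g = "\<lambda>J x. \<Sum>j\<in>J. Re (c j * cis (real_of_int j * x))"
    have I: "(?f J has_integral (?g J y - ?g J a)) {a..y}" for J
    proof (rule fundamental_theorem_of_calculus[OF that])
      fix s
      show "(?g J has_vector_derivative ?f J s) (at s within {a..y})"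
      proof (intro has_vector_derivative_sum)
        fix j
        have "((\<lambda>x. Re (c j * cis (real_of_int j * x))) has_vector_derivative
            Re (c j * (\<i> * of_real (real_of_int j) * cis (real_of_int j * s)))) (at s within {a..y})"
          by (intro bounded_linear.has_vector_derivative[OF bounded_linear_Re]
                has_vector_derivative_mult_right has_vector_derivative_cis_mult)
        then show "((\<lambda>x. Re (c j * cis (real_of_int j * x))) has_vector_derivative
            Re (d j * cis (real_of_int j * s))) (at s within {a..y})"
          by (simp only: d_def of_real_of_int_eq mult_ac)
      qed
    qed
    have "uniform_limit {a..y} ?f (trig d) (finite_subsets_at_top UNIV)"
      by (rule trig_uniform_limit) (use c' in \<open>simp add: d_def\<close>)
    then obtain I J where IJ: "\<And>n. (?f n has_integral I n) {a..y}" "(trig d has_integral J) {a..y}"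
       "(I \<longlongrightarrow> J) (finite_subsets_at_top UNIV)"
      by (rule uniform_limit_integral) (auto intro!: continuous_intros)
    have "I = (\<lambda>n. ?g n y - ?g n a)"
      using IJ(1) I has_integral_unique by blast
    then have "((\<lambda>n. ?g n y - ?g n a) \<longlongrightarrow> J) (finite_subsets_at_top UNIV)"
      using IJ(3) by (simp only:)
    moreover have "((\<lambda>n. ?g n y - ?g n a) \<longlongrightarrow> trig c y - trig c a) (finite_subsets_at_top UNIV)"
      using trig_has_sum[OF c] by (intro tendsto_diff) (auto simp: has_sum_def)
    ultimately have "J = trig c y - trig c a"
      using tendsto_unique finite_subsets_at_top_neq_bot by blast
    then show ?thesis using IJ(2) by (simp add: integral_unique)
  qed
  have cont: "continuous_on {a..b} (trig d)"
    by (rule trig_continuous) (use c' in \<open>simp add: d_def\<close>)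
  have "((\<lambda>y. integral {a..y} (trig d)) has_real_derivative trig d x) (at x within {a..b})"
    by (rule integral_has_real_derivative[OF cont]) (simp add: a_def b_def)
  then have "((\<lambda>y. integral {a..y} (trig d)) has_real_derivative trig d x) (at x)"
    using at_within_Icc_at[of a x b] by (simp add: a_def b_def)
  then have "((\<lambda>y. integral {a..y} (trig d) + trig c a) has_real_derivative trig d x) (at x)"
    by (auto intro!: derivative_eq_intros)
  then show ?thesis unfolding d_def[symmetric]
  proof (rule has_field_derivative_transform_within_open[of _ _ _ "{a<..}"])
    show "integral {a..y} (trig d) + trig c a = trig c y" if "y \<in> {a<..}" for y
      using FTC[of y] that by simp
  qed (auto simp: a_def)
qed

text \<open>Taking real parts splits a partial sum into half its terms on \<open>J\<close> and half
  their conjugates on the reflected set. Once \<open>J\<close> contains k and -k, both halves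
  contribute to the coefficient at k, and hermitian symmetry makes them add up to
  \<open>c k\<close>; uniform convergence carries this to the limit.\<close>

lemma fourier_coeff_trig:
  assumes "asum c" "hermitian c"
  shows "fourier_coeff (trig c) k = c k"
proof -
  let ?T = "\<lambda>J x. \<Sum>j\<in>J. Re (c j * cis (real_of_int j * x))"
  let ?w = "\<lambda>J x. complex_of_real (?T J x) * cis (- (real_of_int k * x))"
  let ?F = "finite_subsets_at_top (UNIV :: int set)"
  have ulT: "uniform_limit {0..2 * pi} (\<lambda>J x. complex_of_real (?T J x)) (\<lambda>x. complex_of_real (trig c x)) ?F"
    using trig_uniform_limit[OF assms(1)] by (rule bounded_linear.uniform_limit[OF bounded_linear_of_real])
  have "uniform_limit {0..2 * pi} ?w (\<lambda>x. complex_of_real (trig c x) * cis (- (real_of_int k * x))) ?F"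
  proof (rule uniform_lim_mult[OF ulT uniform_limit_const])
    show "bounded ((\<lambda>x. complex_of_real (trig c x)) ` {0..2 * pi})"
      by (rule boundedI[where B = "\<Sum>\<^sub>\<infinity>j. norm (c j)"]) (auto simp: trig_bound assms)
    show "bounded ((\<lambda>x. cis (- (real_of_int k * x))) ` {0..2 * pi})"
      by (rule boundedI[where B = 1]) auto
  qed
  then obtain I L where IJ: "\<And>n. (?w n has_integral I n) {0..2 * pi}"
     "((\<lambda>x. complex_of_real (trig c x) * cis (- (real_of_int k * x))) has_integral L) {0..2 * pi}"
     "(I \<longlongrightarrow> L) ?F"
    by (rule uniform_limit_integral) (auto intro!: continuous_intros)
  have I: "I J = of_real (2 * pi) * c k" if J: "finite J" "{k, - k} \<subseteq> J" for J
  proof -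
    define d1 d2 where "d1 j = c j / 2" and "d2 j = cnj (c (- j)) / 2" for j
    have inj: "inj_on uminus J" by (auto intro: inj_onI)
    have cis_neg: "cnj (cis (real_of_int j * x)) = cis (real_of_int (- j) * x)" for j x
      by (simp add: cis_cnj)
    have eq: "complex_of_real (?T J x) = (\<Sum>j\<in>J. d1 j * cis (real_of_int j * x))
        + (\<Sum>j\<in>uminus ` J. d2 j * cis (real_of_int j * x))" for x
    proof -
      have "complex_of_real (Re z) = z / 2 + cnj z / 2" for z
        using complex_add_cnj[of z] by (simp add: field_simps)
      then have "complex_of_real (?T J x) = (\<Sum>j\<in>J. c j * cis (real_of_int j * x) / 2
         + cnj (c j) * cis (real_of_int (- j) * x) / 2)"
        by (simp only: of_real_sum complex_cnj_mult cis_neg)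
      also have "\<dots> = (\<Sum>j\<in>J. d1 j * cis (real_of_int j * x))
        + (\<Sum>j\<in>uminus ` J. d2 j * cis (real_of_int j * x))"
        by (simp add: sum.reindex[OF inj] sum.distrib d1_def d2_def)
      finally show ?thesis .
    qed
    have fin: "finite (uminus ` J)" using J by simp
    have "((\<lambda>x. (\<Sum>j\<in>J. d1 j * cis (real_of_int j * x)) * cis (- (real_of_int k * x))
        + (\<Sum>j\<in>uminus ` J. d2 j * cis (real_of_int j * x)) * cis (- (real_of_int k * x))) has_integral
        (of_real (2 * pi) * d1 k + of_real (2 * pi) * d2 k)) {0..2 * pi}"
    proof (rule has_integral_add)
      have k: "k \<in> J" "k \<in> uminus ` J" using J by (auto simp: image_iff intro!: bexI[of _ "- k"])
      show "((\<lambda>x. (\<Sum>j\<in>J. d1 j * cis (real_of_int j * x)) * cis (- (real_of_int k * x))) has_integral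
          of_real (2 * pi) * d1 k) {0..2 * pi}"
        using has_integral_cfc[of "\<lambda>x. \<Sum>j\<in>J. d1 j * cis (real_of_int j * x)" k] k J
        by (simp add: cfc_trig_poly continuous_on_trig_poly)
      show "((\<lambda>x. (\<Sum>j\<in>uminus ` J. d2 j * cis (real_of_int j * x)) * cis (- (real_of_int k * x))) has_integral
          of_real (2 * pi) * d2 k) {0..2 * pi}"
        using has_integral_cfc[of "\<lambda>x. \<Sum>j\<in>uminus ` J. d2 j * cis (real_of_int j * x)" k] k
        unfolding cfc_trig_poly[OF fin] by (simp add: continuous_on_trig_poly del: sum.reindex)
    qed
    moreover have "d1 k + d2 k = c k" using assms(2) by (simp add: d1_def d2_def hermitian_def)
    ultimately have "(?w J has_integral of_real (2 * pi) * c k) {0..2 * pi}"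
      unfolding eq by (simp only: distrib_right[symmetric] distrib_left[symmetric])
    then show ?thesis using IJ(1)[of J] has_integral_unique by blast
  qed
  have "\<forall>\<^sub>F J in ?F. I J = of_real (2 * pi) * c k"
    unfolding eventually_finite_subsets_at_top
    by (rule exI[of _ "{k, - k}"]) (use I in auto)
  then have "(I \<longlongrightarrow> of_real (2 * pi) * c k) ?F"
    by (rule tendsto_eventually)
  then have "L = of_real (2 * pi) * c k"
    using IJ(3) tendsto_unique finite_subsets_at_top_neq_bot by blast
  then show ?thesis unfolding fourier_coeff_eq_cfc using IJ(2) by (intro cfc_eqI) simp
qed

text \<open>Half of Parseval: the finite identity and (Re z)^2 <= |z|^2 bound the partial sums, and
  the bound passes to the uniform limit.\<close>

lemma integral_trig_sq:
  assumes c: "asum c" and B: "ell2 B c"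
  shows "integral {0..2 * pi} (\<lambda>x. (trig c x)\<^sup>2) \<le> 2 * pi * B\<^sup>2"
proof -
  let ?T = "\<lambda>J x. \<Sum>j\<in>J. Re (c j * cis (real_of_int j * x))"
  let ?F = "finite_subsets_at_top (UNIV :: int set)"
  have bd: "bounded (trig c ` {0..2 * pi})"
    by (rule boundedI[where B = "\<Sum>\<^sub>\<infinity>j. norm (c j)"]) (auto simp: trig_bound assms)
  have "uniform_limit {0..2 * pi} (\<lambda>J x. ?T J x * ?T J x) (\<lambda>x. trig c x * trig c x) ?F"
    by (intro uniform_lim_mult trig_uniform_limit c bd)
  then obtain I L where IJ: "\<And>n. ((\<lambda>x. ?T n x * ?T n x) has_integral I n) {0..2 * pi}"
     "((\<lambda>x. trig c x * trig c x) has_integral L) {0..2 * pi}"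
     "(I \<longlongrightarrow> L) ?F"
    by (rule uniform_limit_integral) (auto intro!: continuous_intros)
  have "I J \<le> 2 * pi * B\<^sup>2" if J: "finite J" for J
  proof -
    have "I J \<le> 2 * pi * (\<Sum>j\<in>J. (norm (c j))\<^sup>2)"
    proof (rule has_integral_le[OF IJ(1)[of J] has_integral_norm_trig_poly[OF J]])
      fix x
      have "?T J x * ?T J x = (Re (\<Sum>j\<in>J. c j * cis (real_of_int j * x)))\<^sup>2"
        by (simp add: power2_eq_square)
      also have "\<dots> \<le> (norm (\<Sum>j\<in>J. c j * cis (real_of_int j * x)))\<^sup>2"
        unfolding cmod_power2 by simp
      finally show "?T J x * ?T J x \<le> (norm (\<Sum>j\<in>J. c j * cis (real_of_int j * x)))\<^sup>2" .
    qed
    also have "\<dots> \<le> 2 * pi * B\<^sup>2" using B J by (auto simp: ell2_iff_sum)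
    finally show ?thesis .
  qed
  then have "\<forall>\<^sub>F J in ?F. I J \<le> 2 * pi * B\<^sup>2"
    unfolding eventually_finite_subsets_at_top by (intro exI[of _ "{}"]) auto
  then have "L \<le> 2 * pi * B\<^sup>2"
    using IJ(3) tendsto_upperbound finite_subsets_at_top_neq_bot by blast
  then show ?thesis using IJ(2) by (simp add: integral_unique power2_eq_square)
qed

section \<open>Fourier inversion and shifts\<close>

lemma fourier_coeff_bessel:
  assumes "continuous_on {0..2 * pi} v" "0 \<le> B" "integral {0..2 * pi} (\<lambda>x. (v x)\<^sup>2) \<le> 2 * pi * B\<^sup>2"
  shows "ell2 B (fourier_coeff v)"
proof -
  have "ell2 B (cfc (\<lambda>x. complex_of_real (v x)))"
    by (rule bessel) (use assms in \<open>auto intro!: continuous_intros\<close>)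
  then show ?thesis by (simp add: fourier_coeff_eq_cfc[abs_def])
qed

text \<open>Combined with Bessel this is the Riemann-Lebesgue lemma along an injective sequence of
  frequencies.\<close>

lemma ell2_tendsto_zero:
  fixes f :: "nat \<Rightarrow> 'i"
  assumes x: "ell2 B x" and f: "inj f"
  shows "(\<lambda>n. x (f n)) \<longlonglongrightarrow> 0"
proof -
  have "summable (\<lambda>n. (norm (x (f n)))\<^sup>2)"
  proof (rule bounded_imp_summable)
    show "(\<Sum>k\<le>n. (norm (x (f k)))\<^sup>2) \<le> B\<^sup>2" for n
    proof -
      have "(\<Sum>k\<le>n. (norm (x (f k)))\<^sup>2) = (\<Sum>j\<in>f ` {..n}. (norm (x j))\<^sup>2)"
        using f by (subst sum.reindex) (auto intro: inj_on_subset)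
      also have "\<dots> \<le> B\<^sup>2" using x by (auto simp: ell2_iff_sum)
      finally show ?thesis .
    qed
  qed simp
  then have "(\<lambda>n. (norm (x (f n)))\<^sup>2) \<longlonglongrightarrow> 0" by (rule summable_LIMSEQ_zero)
  then have "(\<lambda>n. sqrt ((norm (x (f n)))\<^sup>2)) \<longlonglongrightarrow> sqrt 0" by (rule tendsto_real_sqrt)
  then show ?thesis by (simp add: tendsto_norm_zero_iff)
qed

text \<open>Connects the unordered sums of \<open>trig\<close> with the symmetric partial sums for
  which telescoping is possible.\<close>

lemma filterlim_symmetric_intervals:
  "filterlim (\<lambda>N. {- int N..int N}) (finite_subsets_at_top UNIV) sequentially"
  unfolding filterlim_iff
proof (intro allI impI)
  fix P assume "eventually P (finite_subsets_at_top (UNIV :: int set))"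
  then obtain X where X: "finite X" "\<And>Y. finite Y \<Longrightarrow> X \<subseteq> Y \<Longrightarrow> P Y"
    unfolding eventually_finite_subsets_at_top by auto
  have "bdd_above (abs ` X)" using X by (intro bdd_above_finite) simp
  then obtain b where "\<forall>j\<in>X. \<bar>j\<bar> \<le> b" unfolding bdd_above_def by auto
  then have "X \<subseteq> {- int N..int N}" if "N \<ge> nat b" for N using that by force
  then show "\<forall>\<^sub>F N in sequentially. P {- int N..int N}"
    unfolding eventually_sequentially using X by (intro exI[of _ "nat b"]) auto
qed

text \<open>This confines the inversion argument to interior points: for \<open>x\<close> in the
  closed period and \<open>x0\<close> in the open one, |x - x0| stays strictly below 2 pi, so the
  denominator vanishes only at \<open>x0\<close>.\<close>

lemma cis_neq_1:
  assumes "0 < \<bar>y\<bar>" "\<bar>y\<bar> < 2 * pi"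
  shows "cis y \<noteq> 1"
proof
  assume "cis y = 1"
  then have "cos y = 1" by (simp add: complex_eq_iff)
  then have "(sin (y / 2))\<^sup>2 = 0" using cos_double_sin[of "y / 2"] by simp
  moreover have "sin \<bar>y / 2\<bar> > 0" using assms by (intro sin_gt_zero) auto
  ultimately show False by (cases "y \<ge> 0") auto
qed

text \<open>Serves twice: for the removable singularity in Fourier inversion, and for passing from
  translations to derivatives in \<open>reg_0_fourier\<close>.\<close>

lemma cis_difference_quotient:
  "((\<lambda>y. (cis (r * (y - x)) - 1) / of_real (y - x)) \<longlongrightarrow> \<i> * of_real r) (at x within S)"
proof -
  have "((\<lambda>y. cos (r * (y - x))) has_real_derivative 0) (at x within S)"
    "((\<lambda>y. sin (r * (y - x))) has_real_derivative r) (at x within S)"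
    by (auto intro!: derivative_eq_intros)
  then have "((\<lambda>y. (cos (r * (y - x)) - 1) / (y - x)) \<longlongrightarrow> 0) (at x within S)"
    "((\<lambda>y. sin (r * (y - x)) / (y - x)) \<longlongrightarrow> r) (at x within S)"
    by (simp_all add: has_field_derivative_iff)
  then have "((\<lambda>y. Complex ((cos (r * (y - x)) - 1) / (y - x)) (sin (r * (y - x)) / (y - x))) \<longlongrightarrow> Complex 0 r) (at x within S)"
    by (rule tendsto_Complex)
  moreover have "Complex ((cos (r * (y - x)) - 1) / (y - x)) (sin (r * (y - x)) / (y - x))
      = (cis (r * (y - x)) - 1) / of_real (y - x)" for y
    by (simp add: complex_eq_iff Re_divide_of_real Im_divide_of_real)
  ultimately show ?thesis by (simp add: Complex_eq)
qed

text \<open>Dividing \<open>v - v x0\<close> by \<open>cis (x - x0) - 1\<close> leaves a continuous function, so that the partial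
  sums of the Fourier series at \<open>x0\<close> telescope up to coefficients that tend to zero by Bessel.\<close>

lemma fourier_inversion_interior:
  assumes v: "\<And>x. v differentiable (at x)" and as: "asum (fourier_coeff v)"
    and x0: "0 < x0" "x0 < 2 * pi"
  shows "v x0 = trig (fourier_coeff v) x0"
proof -
  let ?S = "{0..2 * pi}"
  define e where "e x = complex_of_real (v x - v x0) / (cis (x - x0) - 1)" for x
  \<comment> \<open>The value at \<open>x0\<close> is the limit of \<open>e\<close>: numerator and
    denominator divided by x - x0 tend to the derivative of \<open>v\<close> and to the imaginary
    unit.\<close>
  define q where "q x = (if x = x0 then of_real (deriv v x0) / \<i> else e x)" for x
  have contv: "continuous_on T v" for T
    using v by (intro continuous_at_imp_continuous_on ballI differentiable_imp_continuous_within)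
  have ne: "cis (x - x0) \<noteq> 1" if "x \<in> ?S" "x \<noteq> x0" for x
    using that x0 by (intro cis_neq_1) auto
  have q: "continuous_on ?S q"
    unfolding continuous_on
  proof
    fix x assume x: "x \<in> ?S"
    show "(q \<longlongrightarrow> q x) (at x within ?S)"
    proof (cases "x = x0")
      case True
      have "(v has_real_derivative deriv v x0) (at x0 within ?S)"
        using v[of x0] DERIV_deriv_iff_real_differentiable has_field_derivative_at_within by blast
      then have 1: "((\<lambda>x. (v x - v x0) / (x - x0)) \<longlongrightarrow> deriv v x0) (at x0 within ?S)"
        by (simp add: has_field_derivative_iff)
      have "((\<lambda>x. complex_of_real ((v x - v x0) / (x - x0)) / ((cis (x - x0) - 1) / of_real (x - x0)))
          \<longlongrightarrow> of_real (deriv v x0) / \<i>) (at x0 within ?S)"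
        by (intro tendsto_divide tendsto_of_real 1 cis_difference_quotient[of 1, unfolded mult_1 of_real_1 mult_1_right]) simp
      then have "(q \<longlongrightarrow> of_real (deriv v x0) / \<i>) (at x0 within ?S)"
        by (rule Lim_transform_within_open[where s = UNIV]) (auto simp: q_def e_def)
      then show ?thesis by (simp add: True q_def)
    next
      case False
      have "continuous_on (?S - {x0}) e"
        unfolding e_def using ne
        by (intro continuous_intros continuous_on_of_real continuous_on_diff contv) 
           (auto intro!: continuous_intros continuous_on_cis)
      then have "(e \<longlongrightarrow> e x) (at x within ?S - {x0})" using x False by (auto simp: continuous_on)
      then have "(e \<longlongrightarrow> e x) (at x within ?S)"
        by (subst at_within_nhd[of x "- {x0}" _ "?S - {x0}"]) (use False in auto)
      then have "(q \<longlongrightarrow> e x) (at x within ?S)"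
        by (rule Lim_transform_within_open[where s = "- {x0}"]) (use False in \<open>auto simp: q_def\<close>)
      then show ?thesis using False by (simp add: q_def)
    qed
  qed
  have vq: "complex_of_real (v x) - of_real (v x0) = (cis (x - x0) - 1) * q x" if "x \<in> ?S" for x
    using ne[OF that] by (auto simp: q_def e_def)
  define V Q where "V = fourier_coeff v" and "Q j = cis (real_of_int j * x0) * cfc q j" for j
  \<comment> \<open>Integrating \<open>vq\<close> against exp(-ijx) turns the factor exp(i(x - x0))
    into a shift of the index of \<open>cfc q\<close>; the phase in \<open>Q\<close> absorbs the
    remaining constant factors.\<close>
  have key: "V j * cis (real_of_int j * x0) - (if j = 0 then of_real (v x0) else 0) = Q (j - 1) - Q j" for j
  proof -
    have cv: "continuous_on ?S (\<lambda>x. complex_of_real (v x))" by (intro continuous_intros contv)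
    have 1: "((\<lambda>x. complex_of_real (v x) * cis (- (real_of_int j * x)) - of_real (v x0) * cis (real_of_int (- j) * x))
        has_integral (of_real (2 * pi) * V j - of_real (v x0) * (if - j = 0 then of_real (2 * pi) else 0))) ?S"
      unfolding V_def fourier_coeff_eq_cfc
      by (intro has_integral_diff has_integral_cfc cv has_integral_mult_right has_integral_cis)
    have 2: "((\<lambda>x. cis (- x0) * (q x * cis (- (real_of_int (j - 1) * x))) - q x * cis (- (real_of_int j * x)))
        has_integral (cis (- x0) * (of_real (2 * pi) * cfc q (j - 1)) - of_real (2 * pi) * cfc q j)) ?S"
      by (intro has_integral_diff has_integral_cfc q has_integral_mult_right)
    have 3: "complex_of_real (v x) * cis (- (real_of_int j * x)) - of_real (v x0) * cis (real_of_int (- j) * x)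
       = cis (- x0) * (q x * cis (- (real_of_int (j - 1) * x))) - q x * cis (- (real_of_int j * x))"
      if "x \<in> ?S" for x
    proof -
      have c: "cis (x - x0) * cis (- (real_of_int j * x)) = cis (- x0) * cis (- (real_of_int (j - 1) * x))"
        by (simp add: cis_mult algebra_simps)
      have "complex_of_real (v x) * cis (- (real_of_int j * x)) - of_real (v x0) * cis (real_of_int (- j) * x)
        = (complex_of_real (v x) - of_real (v x0)) * cis (- (real_of_int j * x))"
        by (simp add: algebra_simps)
      also have "\<dots> = (cis (x - x0) * cis (- (real_of_int j * x))) * q x - q x * cis (- (real_of_int j * x))"
        unfolding vq[OF that] by (simp add: algebra_simps)
      finally show ?thesis unfolding c by (simp add: algebra_simps)
    qed
    have "((\<lambda>x. cis (- x0) * (q x * cis (- (real_of_int (j - 1) * x))) - q x * cis (- (real_of_int j * x)))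
        has_integral (of_real (2 * pi) * V j - of_real (v x0) * (if - j = 0 then of_real (2 * pi) else 0))) ?S"
      using 3 1 by (rule has_integral_eq)
    from has_integral_unique[OF this 2]
    have "of_real (2 * pi) * V j - of_real (v x0) * (if - j = 0 then of_real (2 * pi) else 0)
       = cis (- x0) * (of_real (2 * pi) * cfc q (j - 1)) - of_real (2 * pi) * cfc q j"
      .
    then have "of_real (2 * pi) * (V j - (if j = 0 then of_real (v x0) else 0))
        = of_real (2 * pi) * (cis (- x0) * cfc q (j - 1) - cfc q j)"
      by (cases "j = 0") (simp_all add: algebra_simps)
    then have eq: "V j - (if j = 0 then of_real (v x0) else 0) = cis (- x0) * cfc q (j - 1) - cfc q j"
      unfolding mult_cancel_left by simp
    have c: "cis (real_of_int j * x0) * cis (- x0) = cis (real_of_int (j - 1) * x0)"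
      by (simp add: cis_mult algebra_simps)
    have "V j * cis (real_of_int j * x0) - (if j = 0 then of_real (v x0) else 0)
        = cis (real_of_int j * x0) * (V j - (if j = 0 then of_real (v x0) else 0))"
      by (auto simp: algebra_simps)
    also have "\<dots> = (cis (real_of_int j * x0) * cis (- x0)) * cfc q (j - 1) - Q j"
      unfolding eq by (simp add: Q_def algebra_simps)
    finally show ?thesis unfolding c by (simp add: Q_def)
  qed
  have tel: "(\<Sum>j\<in>{- int N..int N}. V j * cis (real_of_int j * x0)) = of_real (v x0) + (Q (- int N - 1) - Q (int N))" for N
  proof (induction N)
    case 0
    show ?case using key[of 0] by (simp add: algebra_simps)
  next
    case (Suc N)
    let ?n = "int (Suc N)"
    have "{- ?n..?n} = insert ?n (insert (- ?n) {- int N..int N})" by auto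
    then have "(\<Sum>j\<in>{- ?n..?n}. V j * cis (real_of_int j * x0))
        = V ?n * cis (real_of_int ?n * x0) + (V (- ?n) * cis (real_of_int (- ?n) * x0)
          + (\<Sum>j\<in>{- int N..int N}. V j * cis (real_of_int j * x0)))"
      by simp
    also have "V ?n * cis (real_of_int ?n * x0) = Q (?n - 1) - Q ?n" using key[of ?n] by simp
    also have "V (- ?n) * cis (real_of_int (- ?n) * x0) = Q (- ?n - 1) - Q (- ?n)" using key[of "- ?n"] by simp
    finally have eq: "(\<Sum>j\<in>{- ?n..?n}. V j * cis (real_of_int j * x0)) = Q (?n - 1) - Q ?n + (Q (- ?n - 1) - Q (- ?n)
      + (of_real (v x0) + (Q (- int N - 1) - Q (int N))))" unfolding Suc .
    have "Q (?n - 1) = Q (int N)" "Q (- ?n) = Q (- int N - 1)"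
      by (rule arg_cong[of _ _ Q], simp)+
    then show ?case unfolding eq by (simp del: of_nat_Suc add: algebra_simps)
  qed
  obtain B where B: "ell2 B (cfc q)"
  proof
    let ?I = "integral {0..2 * pi} (\<lambda>x. (norm (q x))\<^sup>2)"
    have "0 \<le> ?I" by (rule integral_nonneg) (auto intro!: integrable_continuous_real continuous_intros q)
    then show "ell2 (sqrt (?I / (2 * pi))) (cfc q)" by (intro bessel q) auto
  qed
  have "ell2 B Q" using ell2_mono[OF B, of B Q] by (simp add: Q_def norm_mult)
  then have Q0: "(\<lambda>N. Q (- int N - 1)) \<longlonglongrightarrow> 0" "(\<lambda>N. Q (int N)) \<longlonglongrightarrow> 0"
    using ell2_tendsto_zero[of B Q "\<lambda>N. - int N - 1"] ell2_tendsto_zero[of B Q int]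
    by (auto simp: inj_def)
  have "(\<lambda>N. of_real (v x0) + (Q (- int N - 1) - Q (int N))) \<longlonglongrightarrow> of_real (v x0) + (0 - 0)"
    by (intro tendsto_intros Q0)
  then have L1: "(\<lambda>N. \<Sum>j\<in>{- int N..int N}. V j * cis (real_of_int j * x0)) \<longlonglongrightarrow> of_real (v x0)"
    by (simp add: tel)
  have "(\<lambda>j. norm (V j * cis (real_of_int j * x0))) summable_on UNIV"
    using as by (simp add: V_def norm_mult)
  then have "((\<lambda>j. V j * cis (real_of_int j * x0)) has_sum (\<Sum>\<^sub>\<infinity>j. V j * cis (real_of_int j * x0))) UNIV"
    by (rule has_sum_infsum[OF abs_summable_summable])
  then have "(\<lambda>N. \<Sum>j\<in>{- int N..int N}. V j * cis (real_of_int j * x0)) \<longlonglongrightarrow> (\<Sum>\<^sub>\<infinity>j. V j * cis (real_of_int j * x0))"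
    unfolding has_sum_def by (rule filterlim_compose[OF _ filterlim_symmetric_intervals])
  then have "(\<Sum>\<^sub>\<infinity>j. V j * cis (real_of_int j * x0)) = of_real (v x0)"
    by (rule LIMSEQ_unique[OF _ L1])
  then show ?thesis by (simp add: trig_def V_def)
qed

lemma periodic_plus_int:
  assumes "\<And>x::real. f (x + 2 * pi) = f x"
  shows "f (x + of_int n * (2 * pi)) = f x"
proof -
  interpret periodic_fun_simple f "2 * pi" by standard (rule assms)
  show ?thesis by (rule plus_of_int)
qed

lemma periodic_reduce:
  obtains y n where "x = y + of_int n * (2 * pi)" "0 \<le> y" "y < 2 * pi"
proof
  let ?n = "\<lfloor>x / (2 * pi)\<rfloor>"
  show "x = (x - of_int ?n * (2 * pi)) + of_int ?n * (2 * pi)" by simp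
  have "of_int ?n \<le> x / (2 * pi)" "x / (2 * pi) < of_int ?n + 1" by linarith+
  then have "of_int ?n * (2 * pi) \<le> x" "x < (of_int ?n + 1) * (2 * pi)"
    by (simp_all only: pos_le_divide_eq pos_divide_less_eq pi_gt_zero mult_pos_pos zero_less_numeral)
  then show "0 \<le> x - of_int ?n * (2 * pi)" "x - of_int ?n * (2 * pi) < 2 * pi"
    by (simp_all add: distrib_right)
qed

text \<open>Equality on the open period extends to its closure by continuity and to the whole line
  by periodicity.\<close>

lemma fourier_inversion:
  assumes v: "\<And>x. v differentiable (at x)" and as: "asum (fourier_coeff v)"
    and per: "\<And>x. v (x + 2 * pi) = v x"
  shows "v = trig (fourier_coeff v)"
proof
  fix x
  let ?g = "\<lambda>x. v x - trig (fourier_coeff v) x"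
  have "continuous_on UNIV v"
    using v by (intro continuous_at_imp_continuous_on ballI differentiable_imp_continuous_within)
  then have cont: "continuous_on (closure {0<..<2 * pi}) ?g"
    by (auto intro!: continuous_on_diff trig_continuous as intro: continuous_on_subset)
  have 0: "?g y = 0" if "0 \<le> y" "y < 2 * pi" for y
    by (rule continuous_constant_on_closure[OF cont])
       (use that fourier_inversion_interior[OF v as] in auto)
  obtain y n where "x = y + of_int n * (2 * pi)" "0 \<le> y" "y < 2 * pi" by (rule periodic_reduce)
  then show "v x = trig (fourier_coeff v) x"
    using periodic_plus_int[of ?g y n] 0[of y] by (simp add: per trig_periodic)
qed

text \<open>Integration by parts over one period, carried out as the fundamental theorem for the
  product with exp(-ijx); periodicity cancels the boundary terms.\<close>

lemma fourier_coeff_deriv: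
  assumes v: "\<And>x. (v has_real_derivative v' x) (at x)" and v': "continuous_on UNIV v'"
    and per: "\<And>x. v (x + 2 * pi) = v x"
  shows "fourier_coeff v' j = \<i> * of_int j * fourier_coeff v j"
proof -
  let ?S = "{0..2 * pi}"
  let ?e = "\<lambda>x. cis (- (real_of_int j * x))"
  have vc: "continuous_on ?S (\<lambda>x. complex_of_real (v x))"
    using v by (intro continuous_intros continuous_at_imp_continuous_on ballI DERIV_isCont)
  have v'c: "continuous_on ?S (\<lambda>x. complex_of_real (v' x))"
    using v' by (intro continuous_intros) (auto intro: continuous_on_subset)
  have "((\<lambda>x. of_real (v x) * (- \<i> * of_int j * ?e x) + of_real (v' x) * ?e x) has_integral
     (of_real (v (2 * pi)) * ?e (2 * pi) - of_real (v 0) * ?e 0)) ?S"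
  proof (rule fundamental_theorem_of_calculus)
    fix x
    have 1: "(?e has_vector_derivative (- \<i> * of_int j * ?e x)) (at x within ?S)"
      using has_vector_derivative_cis_mult[of "- real_of_int j" x] by simp
    have 2: "((\<lambda>x. complex_of_real (v x)) has_vector_derivative of_real (v' x)) (at x within ?S)"
      using v[of x] by (intro has_vector_derivative_of_real)
         (auto simp: has_real_derivative_iff_has_vector_derivative[symmetric] intro: has_field_derivative_at_within)
    show "((\<lambda>x. of_real (v x) * ?e x) has_vector_derivative
       (of_real (v x) * (- \<i> * of_int j * ?e x) + of_real (v' x) * ?e x)) (at x within ?S)"
      by (rule has_vector_derivative_mult[OF 2 1])
  qed simp
  moreover have "?e (2 * pi) = 1" using cis_int_period[of "- j"] by (simp add: mult.commute)
  moreover have "v (2 * pi) = v 0" using per[of 0] by simp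
  ultimately have "((\<lambda>x. of_real (v x) * (- \<i> * of_int j * ?e x) + of_real (v' x) * ?e x) has_integral 0) ?S"
    by simp
  moreover have "((\<lambda>x. (- \<i> * of_int j) * (of_real (v x) * ?e x) + of_real (v' x) * ?e x) has_integral
      ((- \<i> * of_int j) * (of_real (2 * pi) * fourier_coeff v j) + of_real (2 * pi) * fourier_coeff v' j)) ?S"
    unfolding fourier_coeff_eq_cfc by (intro has_integral_add has_integral_mult_right has_integral_cfc vc v'c)
  then have "((\<lambda>x. of_real (v x) * (- \<i> * of_int j * ?e x) + of_real (v' x) * ?e x) has_integral
      ((- \<i> * of_int j) * (of_real (2 * pi) * fourier_coeff v j) + of_real (2 * pi) * fourier_coeff v' j)) ?S"
    by (simp add: mult_ac)
  ultimately have "(- \<i> * of_int j) * (of_real (2 * pi) * fourier_coeff v j) + of_real (2 * pi) * fourier_coeff v' j = 0"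
    using has_integral_unique by blast
  then have "of_real (2 * pi) * (fourier_coeff v' j - \<i> * of_int j * fourier_coeff v j) = 0"
    by (simp add: algebra_simps)
  then show ?thesis by simp
qed

lemma integral_periodic_shift:
  fixes w :: "real \<Rightarrow> 'a::euclidean_space"
  assumes w: "continuous_on UNIV w" and per: "\<And>x. w (x + 2 * pi) = w x" and \<tau>: "0 \<le> \<tau>" "\<tau> \<le> 2 * pi"
  shows "integral {0..2 * pi} (\<lambda>x. w (x + \<tau>)) = integral {0..2 * pi} w"
proof -
  have I: "w integrable_on {a..b}" for a b
    by (intro integrable_continuous_real continuous_on_subset[OF w]) simp
  have "integral {0..2 * pi} (\<lambda>x. w (x + \<tau>)) = integral {\<tau>..2 * pi + \<tau>} w"
    using integral_shift_real_ivl[of \<tau> \<tau> "2 * pi + \<tau>" w] by simp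
  also have "\<dots> = integral {\<tau>..2 * pi} w + integral {2 * pi..2 * pi + \<tau>} w"
    by (rule Henstock_Kurzweil_Integration.integral_combine[symmetric]) (use \<tau> I in auto)
  also have "integral {2 * pi..2 * pi + \<tau>} w = integral {0..\<tau>} w"
    using integral_shift_real_ivl[of "2 * pi" "2 * pi" "2 * pi + \<tau>" w] per by simp
  also have "integral {\<tau>..2 * pi} w + integral {0..\<tau>} w = integral {0..2 * pi} w"
    using Henstock_Kurzweil_Integration.integral_combine[of 0 \<tau> "2 * pi" w] \<tau> I by (simp add: add.commute)
  finally show ?thesis .
qed

lemma fourier_coeff_shift:
  assumes v: "continuous_on UNIV v" and per: "\<And>x. v (x + 2 * pi) = v x" and \<tau>: "0 \<le> \<tau>" "\<tau> \<le> 2 * pi"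
  shows "fourier_coeff (\<lambda>x. v (x + \<tau>)) j = cis (real_of_int j * \<tau>) * fourier_coeff v j"
proof -
  let ?w = "\<lambda>x. complex_of_real (v x) * cis (- (real_of_int j * x))"
  have 1: "continuous_on UNIV ?w" by (intro continuous_intros v)
  have 2: "?w (x + 2 * pi) = ?w x" for x
  proof -
    have "cis (- (real_of_int j * (x + 2 * pi))) = cis (- (real_of_int j * x)) * cis (real_of_int (- j) * (2 * pi))"
      by (simp add: cis_mult algebra_simps)
    then show ?thesis by (simp only: cis_int_period per) simp
  qed
  have 3: "complex_of_real (v (x + \<tau>)) * cis (- (real_of_int j * x)) = cis (real_of_int j * \<tau>) * ?w (x + \<tau>)" for x
    by (simp add: cis_mult algebra_simps)
  have "integral {0..2 * pi} (\<lambda>x. complex_of_real (v (x + \<tau>)) * cis (- (real_of_int j * x)))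
     = cis (real_of_int j * \<tau>) * integral {0..2 * pi} (\<lambda>x. ?w (x + \<tau>))"
    unfolding 3 by (rule integral_mult_right)
  also have "\<dots> = cis (real_of_int j * \<tau>) * integral {0..2 * pi} ?w"
    using integral_periodic_shift[OF 1 2 \<tau>] by simp
  finally show ?thesis by (simp add: fourier_coeff_def)
qed

lemma hermitian_fourier_coeff: "hermitian (fourier_coeff v)"
  unfolding hermitian_def
proof
  fix j
  have "integral {0..2 * pi} (\<lambda>x. complex_of_real (v x) * cis (- (real_of_int (- j) * x)))
     = integral {0..2 * pi} (\<lambda>x. cnj (complex_of_real (v x) * cis (- (real_of_int j * x))))"
    by (simp add: cis_cnj)
  also have "\<dots> = cnj (integral {0..2 * pi} (\<lambda>x. complex_of_real (v x) * cis (- (real_of_int j * x))))"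
    by (simp add: integral_cnj)
  finally show "fourier_coeff v (- j) = cnj (fourier_coeff v j)" by (simp add: fourier_coeff_def)
qed

definition coeff_integrable :: "(real \<Rightarrow> real) \<Rightarrow> bool" where
  "coeff_integrable v \<longleftrightarrow> (\<forall>j. (\<lambda>x. complex_of_real (v x) * cis (- (real_of_int j * x))) integrable_on {0..2 * pi})"

lemma coeff_integrable_continuous: "continuous_on {0..2 * pi} v \<Longrightarrow> coeff_integrable v"
  unfolding coeff_integrable_def by (intro allI integrable_continuous_real continuous_intros)

text \<open>On a bounded interval |v| <= v^2 + 1 is an integrable majorant; the rest is the passage
  from Lebesgue to gauge integrals.\<close>

lemma coeff_integrable_L2:
  assumes "periodic_L2 v"
  shows "coeff_integrable v"
  unfolding coeff_integrable_def
proof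
  fix j
  let ?M = "lebesgue_on {0..2 * pi}"
  have meas: "v \<in> borel_measurable ?M" and sq: "integrable ?M (\<lambda>x. (v x)\<^sup>2)"
    using assms by (auto simp: periodic_L2_def)
  have "(\<lambda>x. (v x)\<^sup>2) integrable_on {0..2 * pi}"
    using sq by (rule integrable_on_lebesgue_on) simp
  then have g: "(\<lambda>x. (v x)\<^sup>2 + 1) integrable_on {0..2 * pi}"
    by (intro integrable_add integrable_const_ivl)
  have "(\<lambda>x. cis (- (real_of_int j * x))) \<in> borel_measurable ?M"
    by (intro continuous_imp_measurable_on_sets_lebesgue continuous_intros) simp
  then have "(\<lambda>x. complex_of_real (v x) * cis (- (real_of_int j * x))) \<in> borel_measurable ?M"
    using meas by measurable
  moreover have "norm (complex_of_real (v x) * cis (- (real_of_int j * x))) \<le> (v x)\<^sup>2 + 1" for x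
  proof -
    have "\<bar>v x\<bar> \<le> (v x)\<^sup>2 + 1"
      using zero_le_power2[of "\<bar>v x\<bar> - 1"] by (simp add: power2_diff)
    then show ?thesis by (simp add: norm_mult)
  qed
  ultimately have "(\<lambda>x. complex_of_real (v x) * cis (- (real_of_int j * x))) absolutely_integrable_on {0..2 * pi}"
    by (intro measurable_bounded_by_integrable_imp_absolutely_integrable[OF _ _ g]) auto
  then show "(\<lambda>x. complex_of_real (v x) * cis (- (real_of_int j * x))) integrable_on {0..2 * pi}"
    by (rule set_lebesgue_integral_eq_integral(1))
qed

lemma fourier_coeff_diff:
  assumes "coeff_integrable v" "coeff_integrable w"
  shows "fourier_coeff (\<lambda>x. v x - w x) j = fourier_coeff v j - fourier_coeff w j"
proof -
  have "integral {0..2 * pi} (\<lambda>x. complex_of_real (v x) * cis (- (real_of_int j * x))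
        - complex_of_real (w x) * cis (- (real_of_int j * x)))
     = integral {0..2 * pi} (\<lambda>x. complex_of_real (v x) * cis (- (real_of_int j * x)))
        - integral {0..2 * pi} (\<lambda>x. complex_of_real (w x) * cis (- (real_of_int j * x)))"
    using assms by (intro Henstock_Kurzweil_Integration.integral_diff) (auto simp: coeff_integrable_def)
  then show ?thesis by (simp add: fourier_coeff_def left_diff_distrib scaleR_diff_right)
qed

lemma fourier_coeff_scale: "fourier_coeff (\<lambda>x. r * v x) j = of_real r * fourier_coeff v j"
  by (simp add: fourier_coeff_def mult.assoc scaleR_conv_of_real)

lemma periodic_L2_continuous:
  assumes "continuous_on UNIV v" and per: "\<And>x. v (x + 2 * pi) = v x"
  shows "periodic_L2 v"
proof -
  have c: "continuous_on {0..2 * pi} v" "continuous_on {0..2 * pi} (\<lambda>x. (v x)\<^sup>2)"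
    by (auto intro!: continuous_intros continuous_on_subset[OF assms(1)])
  have "(\<lambda>x. (v x)\<^sup>2) absolutely_integrable_on {0..2 * pi}"
    by (intro absolutely_integrable_continuous_real c)
  then have "integrable (lebesgue_on {0..2 * pi}) (\<lambda>x. (v x)\<^sup>2)"
    by (simp add: absolutely_integrable_imp_integrable)
  moreover have "v \<in> borel_measurable (lebesgue_on {0..2 * pi})"
    by (intro continuous_imp_measurable_on_sets_lebesgue c) simp
  ultimately show ?thesis using per by (simp add: periodic_L2_def)
qed

section \<open>Sobolev-type regularity of compositions\<close>

lemma smooth_differentiable: "smooth f \<Longrightarrow> f differentiable (at x)"
  unfolding smooth_def by (metis C_k.simps(2))

lemma smooth_frechet: "smooth f \<Longrightarrow> smooth (\<lambda>x. frechet_derivative f (at x) v)"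
  unfolding smooth_def by (metis C_k.simps(2))

lemma smooth_has_derivative: "smooth f \<Longrightarrow> (f has_derivative frechet_derivative f (at x)) (at x within S)"
  using smooth_differentiable frechet_derivative_works has_derivative_at_withinI by blast

lemma smooth_continuous: "smooth f \<Longrightarrow> continuous_on S f"
  by (meson smooth_differentiable continuous_at_imp_continuous_on differentiable_imp_continuous_within)

lemma frechet_derivative_fst:
  fixes b :: "'a::real_normed_vector \<Rightarrow> real" and z :: "'a \<times> 'b::real_normed_vector"
  assumes "b differentiable (at (fst z))"
  shows "(\<lambda>z. b (fst z)) differentiable (at z)"
    "frechet_derivative (\<lambda>z. b (fst z)) (at z) v = frechet_derivative b (at (fst z)) (fst v)"
proof -
  have "(b has_derivative frechet_derivative b (at (fst z))) (at (fst z))"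
    using assms frechet_derivative_works by blast
  then have *: "((\<lambda>z. b (fst z)) has_derivative (\<lambda>v. frechet_derivative b (at (fst z)) (fst v))) (at z)"
    by (rule has_derivative_compose[OF has_derivative_fst[OF has_derivative_ident]])
  then show "(\<lambda>z. b (fst z)) differentiable (at z)" by (auto simp: differentiable_def)
  show "frechet_derivative (\<lambda>z. b (fst z)) (at z) v = frechet_derivative b (at (fst z)) (fst v)"
    using frechet_derivative_at[OF *] by (metis)
qed

lemma C_k_fst: "C_k k b \<Longrightarrow> C_k k (\<lambda>z::'a::real_normed_vector \<times> 'b::real_normed_vector. b (fst z))"
proof (induction k arbitrary: b)
  case 0
  then show ?case by (auto intro!: continuous_intros continuous_on_compose2[of UNIV b])
next
  case (Suc k)
  then show ?case by (auto simp: frechet_derivative_fst)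
qed

text \<open>Lets \<open>a\<close> be treated as a function of the pair (u, u_x), so that one
  composition lemma for two arguments covers both \<open>a\<close> and \<open>g\<close>.\<close>

lemma smooth_fst: "smooth b \<Longrightarrow> smooth (\<lambda>z::'a::real_normed_vector \<times> 'b::real_normed_vector. b (fst z))"
  unfolding smooth_def using C_k_fst by blast

lemma smooth_bounded:
  fixes f :: "'a::euclidean_space \<Rightarrow> real"
  assumes "smooth f"
  obtains D where "D \<ge> 0" "\<And>x. norm x \<le> B \<Longrightarrow> \<bar>f x\<bar> \<le> D"
proof -
  have "compact (f ` cball 0 B)"
    by (intro compact_continuous_image smooth_continuous assms) simp
  then have "bounded (f ` cball 0 B)" by (rule compact_imp_bounded)
  then obtain D where "\<forall>x\<in>cball 0 B. \<bar>f x\<bar> \<le> D" unfolding bounded_iff by auto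
  then show ?thesis using that[of "\<bar>D\<bar>"] by (force simp: dist_norm)
qed

text \<open>\<open>C_k\<close> controls derivatives only in fixed directions. Expanding in the basis
  recovers an operator bound from finitely many of them.\<close>

lemma abs_linear_le_Basis:
  fixes h :: "'a::euclidean_space" and T :: "'a \<Rightarrow> real"
  assumes "linear T"
  shows "\<bar>T h\<bar> \<le> (\<Sum>b\<in>Basis. \<bar>T b\<bar>) * norm h"
proof -
  have "T h = T (\<Sum>b\<in>Basis. (h \<bullet> b) *\<^sub>R b)" by (simp add: euclidean_representation)
  also have "\<dots> = (\<Sum>b\<in>Basis. (h \<bullet> b) * T b)"
    using assms by (simp add: linear_sum linear_cmul)
  also have "\<bar>\<dots>\<bar> \<le> (\<Sum>b\<in>Basis. \<bar>(h \<bullet> b) * T b\<bar>)" by (rule sum_abs)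
  also have "\<dots> \<le> (\<Sum>b\<in>Basis. \<bar>T b\<bar> * norm h)"
    unfolding abs_mult by (subst mult.commute) (intro sum_mono mult_left_mono Basis_le_norm abs_ge_zero)
  finally show ?thesis by (simp add: sum_distrib_right)
qed

lemma linear_frechet: "smooth f \<Longrightarrow> linear (frechet_derivative f (at x))"
  using smooth_differentiable linear_frechet_derivative by blast

lemma smooth_lipschitz:
  fixes f :: "'a::euclidean_space \<Rightarrow> real"
  assumes f: "smooth f"
  obtains L where "L \<ge> 0" "\<And>x y. norm x \<le> B \<Longrightarrow> norm y \<le> B \<Longrightarrow> \<bar>f x - f y\<bar> \<le> L * norm (x - y)"
proof -
  have "\<exists>D. \<forall>b. D b \<ge> 0 \<and> (\<forall>x. norm x \<le> B \<longrightarrow> \<bar>frechet_derivative f (at x) b\<bar> \<le> D b)"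
  proof (rule choice, rule allI)
    fix b
    show "\<exists>D. D \<ge> 0 \<and> (\<forall>x. norm x \<le> B \<longrightarrow> \<bar>frechet_derivative f (at x) b\<bar> \<le> D)"
      using smooth_bounded[OF smooth_frechet[OF f]] by metis
  qed
  then obtain D where D: "\<And>b. D b \<ge> 0" "\<And>b x. norm x \<le> B \<Longrightarrow> \<bar>frechet_derivative f (at x) b\<bar> \<le> D b" by blast
  have "norm (f x - f y) \<le> (\<Sum>b\<in>Basis. D b) * norm (x - y)" if "norm x \<le> B" "norm y \<le> B" for x y
  proof (rule differentiable_bound[of "cball 0 B" f "\<lambda>x. frechet_derivative f (at x)"])
    fix z :: 'a assume z: "z \<in> cball 0 B"
    show "onorm (frechet_derivative f (at z)) \<le> (\<Sum>b\<in>Basis. D b)"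
    proof (rule onorm_le)
      fix h
      have "\<bar>frechet_derivative f (at z) h\<bar> \<le> (\<Sum>b\<in>Basis. \<bar>frechet_derivative f (at z) b\<bar>) * norm h"
        by (rule abs_linear_le_Basis[OF linear_frechet[OF f]])
      also have "\<dots> \<le> (\<Sum>b\<in>Basis. D b) * norm h"
        using D z by (intro mult_right_mono sum_mono) auto
      finally show "norm (frechet_derivative f (at z) h) \<le> (\<Sum>b\<in>Basis. D b) * norm h" by simp
    qed
  qed (use that smooth_has_derivative[OF f] in auto)
  then show ?thesis using that[of "\<Sum>b\<in>Basis. D b"] D by (simp add: sum_nonneg)
qed

text \<open>Subtracting the linear map Df(x) leaves a function with derivative Df(z) - Df(x), which
  is O(|z - x|) because each directional derivative is locally Lipschitz; the mean value inequality
  on the segment gives the square.\<close>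

lemma smooth_taylor:
  fixes f :: "'a::euclidean_space \<Rightarrow> real"
  assumes f: "smooth f"
  obtains L where "L \<ge> 0" "\<And>x y. norm x \<le> B \<Longrightarrow> norm y \<le> B \<Longrightarrow>
    \<bar>f y - f x - frechet_derivative f (at x) (y - x)\<bar> \<le> L * (norm (y - x))\<^sup>2"
proof -
  have "\<exists>D. \<forall>b. D b \<ge> 0 \<and> (\<forall>x y. norm x \<le> B \<longrightarrow> norm y \<le> B \<longrightarrow>
      \<bar>frechet_derivative f (at x) b - frechet_derivative f (at y) b\<bar> \<le> D b * norm (x - y))"
  proof (rule choice, rule allI)
    fix b
    show "\<exists>D. D \<ge> 0 \<and> (\<forall>x y. norm x \<le> B \<longrightarrow> norm y \<le> B \<longrightarrow>
      \<bar>frechet_derivative f (at x) b - frechet_derivative f (at y) b\<bar> \<le> D * norm (x - y))"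
      using smooth_lipschitz[OF smooth_frechet[OF f]] by metis
  qed
  then obtain D where D: "\<And>b. D b \<ge> 0" "\<And>b x y. norm x \<le> B \<Longrightarrow> norm y \<le> B \<Longrightarrow>
      \<bar>frechet_derivative f (at x) b - frechet_derivative f (at y) b\<bar> \<le> D b * norm (x - y)" by blast
  let ?L = "\<Sum>b\<in>Basis. D b"
  have "\<bar>f y - f x - frechet_derivative f (at x) (y - x)\<bar> \<le> ?L * (norm (y - x))\<^sup>2"
    if xy: "norm x \<le> B" "norm y \<le> B" for x y
  proof -
    let ?T = "frechet_derivative f (at x)"
    have lT: "linear ?T" by (rule linear_frechet[OF f])
    define \<psi> where "\<psi> z = f z - ?T z" for z
    have "norm (\<psi> y - \<psi> x) \<le> (?L * norm (y - x)) * norm (y - x)"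
    proof (rule differentiable_bound[of "closed_segment x y" \<psi> "\<lambda>z h. frechet_derivative f (at z) h - ?T h"])
      fix z assume z: "z \<in> closed_segment x y"
      have "closed_segment x y \<subseteq> cball 0 B" using xy by (intro closed_segment_subset) auto
      then have zB: "norm z \<le> B" using z by auto
      have zx: "norm (z - x) \<le> norm (y - x)"
        using segment_bound1[OF z] by (simp add: norm_minus_commute)
      show "(\<psi> has_derivative (\<lambda>h. frechet_derivative f (at z) h - ?T h)) (at z within closed_segment x y)"
        unfolding \<psi>_def using lT
        by (intro has_derivative_diff smooth_has_derivative[OF f] linear_imp_has_derivative)
      show "onorm (\<lambda>h. frechet_derivative f (at z) h - ?T h) \<le> ?L * norm (y - x)"
      proof (rule onorm_le)
        fix h
        have "\<bar>frechet_derivative f (at z) h - ?T h\<bar>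
            \<le> (\<Sum>b\<in>Basis. \<bar>frechet_derivative f (at z) b - ?T b\<bar>) * norm h"
          by (rule abs_linear_le_Basis[of "\<lambda>h. frechet_derivative f (at z) h - ?T h"])
             (intro linear_compose_sub linear_frechet[OF f])
        also have "\<dots> \<le> (\<Sum>b\<in>Basis. D b * norm (y - x)) * norm h"
        proof (intro mult_right_mono sum_mono)
          fix b
          have "\<bar>frechet_derivative f (at z) b - ?T b\<bar> \<le> D b * norm (z - x)"
            using D(2)[OF zB xy(1)] .
          also have "\<dots> \<le> D b * norm (y - x)" using D(1) zx by (intro mult_left_mono)
          finally show "\<bar>frechet_derivative f (at z) b - ?T b\<bar> \<le> D b * norm (y - x)" .
        qed simp
        finally show "norm (frechet_derivative f (at z) h - ?T h) \<le> ?L * norm (y - x) * norm h"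
          by (simp add: sum_distrib_right)
      qed
    qed auto
    moreover have "?T (y - x) = ?T y - ?T x" using lT by (simp add: linear_diff)
    ultimately show ?thesis by (simp add: \<psi>_def power2_eq_square mult.assoc algebra_simps)
  qed
  then show ?thesis using that[of ?L] D by (simp add: sum_nonneg)
qed

text \<open>\<open>reg k\<close> encodes \<open>H\<^bsup>k+1\<^esup>\<close> without weak derivatives: the last classical derivative has to be
  Lipschitz with respect to translations in \<open>L\<^sup>2\<close>. In this form products and compositions are elementary.\<close>

primrec reg :: "nat \<Rightarrow> real \<Rightarrow> (real \<Rightarrow> real) \<Rightarrow> bool" where
  "reg 0 B w \<longleftrightarrow> continuous_on UNIV w \<and> (\<forall>x. w (x + 2 * pi) = w x) \<and> (\<forall>x. \<bar>w x\<bar> \<le> B) \<and>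
     (\<forall>\<tau>\<in>{0..1}. integral {0..2 * pi} (\<lambda>x. (w (x + \<tau>) - w x)\<^sup>2) \<le> (B * \<tau>)\<^sup>2)"
| "reg (Suc k) B w \<longleftrightarrow> (\<forall>x. w (x + 2 * pi) = w x) \<and> (\<forall>x. \<bar>w x\<bar> \<le> B) \<and>
     (\<exists>w'. (\<forall>x. (w has_real_derivative w' x) (at x)) \<and> reg k B w')"

lemma reg_periodic: "reg k B w \<Longrightarrow> w (x + 2 * pi) = w x"
  by (cases k) auto

lemma reg_bound: "reg k B w \<Longrightarrow> \<bar>w x\<bar> \<le> B"
  by (cases k) auto

lemma reg_nonneg: "reg k B w \<Longrightarrow> 0 \<le> B"
  using reg_bound[of k B w 0] by linarith

lemma reg_continuous: "reg k B w \<Longrightarrow> continuous_on S w"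
  by (cases k) (auto intro: continuous_on_subset, meson DERIV_isCont continuous_at_imp_continuous_on)

lemma reg_SucI:
  assumes "\<And>x. (w has_real_derivative w' x) (at x)" "reg k B w'"
    "\<And>x. w (x + 2 * pi) = w x" "\<And>x. \<bar>w x\<bar> \<le> B"
  shows "reg (Suc k) B w"
  using assms by auto

lemma reg_mono: "reg k A w \<Longrightarrow> A \<le> B \<Longrightarrow> reg k B w"
proof (induction k arbitrary: w)
  case 0
  have "0 \<le> A" using reg_nonneg[OF 0(1)] .
  then have "(A * \<tau>)\<^sup>2 \<le> (B * \<tau>)\<^sup>2" if "\<tau> \<in> {0..1}" for \<tau>
    using that 0(2) by (intro power_mono mult_right_mono) auto
  then show ?case using 0 by (auto intro: order_trans)
next
  case (Suc k)
  then show ?case by (auto intro: order_trans)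
qed

lemma reg_integrable_shift_sq:
  assumes "reg k B w"
  shows "(\<lambda>x. (w (x + \<tau>) - w x)\<^sup>2) integrable_on {0..2 * pi}"
  by (intro integrable_continuous_real continuous_intros continuous_on_compose2[OF reg_continuous[OF assms, of UNIV]]) auto

text \<open>Origin of the factor 3 in \<open>reg_Suc\<close> and \<open>trig_reg\<close>: a
  pointwise or Parseval bound over one period costs sqrt(2 pi) <= 3.\<close>

lemma pi_sq_bound: "2 * pi \<le> 3\<^sup>2"
  using pi_less_4 by simp

lemma reg_Suc: "reg (Suc k) B w \<Longrightarrow> reg k (3 * B) w"
proof (induction k arbitrary: w)
  case 0
  then obtain w' where w': "\<And>x. (w has_real_derivative w' x) (at x)" "reg 0 B w'" by auto
  have B: "0 \<le> B" using reg_nonneg[OF 0] .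
  have "integral {0..2 * pi} (\<lambda>x. (w (x + \<tau>) - w x)\<^sup>2) \<le> (3 * B * \<tau>)\<^sup>2" if \<tau>: "\<tau> \<in> {0..1}" for \<tau>
  proof -
    have "\<bar>w (x + \<tau>) - w x\<bar> \<le> B * \<bar>x + \<tau> - x\<bar>" for x
      using field_differentiable_bound[of UNIV w w' B "x + \<tau>" x] w' reg_bound[OF w'(2)] by simp
    then have "\<bar>w (x + \<tau>) - w x\<bar>\<^sup>2 \<le> (B * \<tau>)\<^sup>2" for x
      using \<tau> by (intro power_mono) auto
    then have "integral {0..2 * pi} (\<lambda>x. (w (x + \<tau>) - w x)\<^sup>2) \<le> integral {0..2 * pi} (\<lambda>x. (B * \<tau>)\<^sup>2)"
      by (intro integral_le reg_integrable_shift_sq[OF 0] integrable_const_ivl) auto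
    also have "\<dots> = 2 * pi * (B * \<tau>)\<^sup>2" by simp
    also have "\<dots> \<le> 3\<^sup>2 * (B * \<tau>)\<^sup>2" by (intro mult_right_mono pi_sq_bound) simp
    finally show ?thesis by (simp add: power_mult_distrib)
  qed
  moreover have "\<bar>w x\<bar> \<le> 3 * B" for x using reg_bound[OF 0, of x] B by linarith
  ultimately show ?case using reg_continuous[OF 0] reg_periodic[OF 0] by simp
next
  case (Suc k)
  then obtain w' where w': "\<And>x. (w has_real_derivative w' x) (at x)" "reg (Suc k) B w'" by auto
  have "reg k (3 * B) w'" using Suc.IH w'(2) by blast
  moreover have "\<bar>w x\<bar> \<le> 3 * B" for x
    using reg_bound[OF Suc.prems, of x] reg_nonneg[OF Suc.prems] by linarith
  ultimately show ?case using w'(1) reg_periodic[OF Suc.prems] by auto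
qed

text \<open>The L2 modulus of translation is monotone under pointwise domination of increments, by
  (s + t)^2 <= 2s^2 + 2t^2. Sums, products and compositions at level 0 are all instances.\<close>

lemma reg_0_dominated:
  assumes v: "reg 0 A v" and w: "reg 0 B w" and L: "0 \<le> L"
    and u: "continuous_on UNIV u" "\<And>x. u (x + 2 * pi) = u x" "\<And>x. \<bar>u x\<bar> \<le> D"
    and d: "\<And>x y. \<bar>u y - u x\<bar> \<le> L * (\<bar>v y - v x\<bar> + \<bar>w y - w x\<bar>)"
  shows "reg 0 (max D (2 * L * (A + B))) u"
proof -
  have A: "0 \<le> A" and B: "0 \<le> B" using v w by (auto dest: reg_nonneg)
  let ?C = "max D (2 * L * (A + B))"
  have "integral {0..2 * pi} (\<lambda>x. (u (x + \<tau>) - u x)\<^sup>2) \<le> (?C * \<tau>)\<^sup>2" if \<tau>: "\<tau> \<in> {0..1}" for \<tau>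
  proof -
    have le: "(u (x + \<tau>) - u x)\<^sup>2 \<le> (2 * L\<^sup>2) * (v (x + \<tau>) - v x)\<^sup>2 + (2 * L\<^sup>2) * (w (x + \<tau>) - w x)\<^sup>2" for x
    proof -
      let ?a = "\<bar>v (x + \<tau>) - v x\<bar>" and ?b = "\<bar>w (x + \<tau>) - w x\<bar>"
      have "\<bar>u (x + \<tau>) - u x\<bar>\<^sup>2 \<le> (L * (?a + ?b))\<^sup>2"
        using d[of "x + \<tau>" x] by (intro power_mono) auto
      also have "\<dots> = L\<^sup>2 * (?a + ?b)\<^sup>2" by (simp add: power_mult_distrib)
      also have "\<dots> \<le> L\<^sup>2 * (2 * ?a\<^sup>2 + 2 * ?b\<^sup>2)"
      proof (intro mult_left_mono)
        show "(?a + ?b)\<^sup>2 \<le> 2 * ?a\<^sup>2 + 2 * ?b\<^sup>2"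
          using zero_le_power2[of "?a - ?b"] unfolding power2_sum power2_diff by linarith
      qed simp
      finally show ?thesis by (simp add: algebra_simps)
    qed
    have "integral {0..2 * pi} (\<lambda>x. (u (x + \<tau>) - u x)\<^sup>2)
      \<le> integral {0..2 * pi} (\<lambda>x. (2 * L\<^sup>2) * (v (x + \<tau>) - v x)\<^sup>2 + (2 * L\<^sup>2) * (w (x + \<tau>) - w x)\<^sup>2)"
      by (intro integral_le le integrable_add integrable_on_mult_right reg_integrable_shift_sq[OF v]
          reg_integrable_shift_sq[OF w] integrable_continuous_real continuous_intros
          continuous_on_compose2[OF u(1)]) auto
    also have "\<dots> = (2 * L\<^sup>2) * integral {0..2 * pi} (\<lambda>x. (v (x + \<tau>) - v x)\<^sup>2)
       + (2 * L\<^sup>2) * integral {0..2 * pi} (\<lambda>x. (w (x + \<tau>) - w x)\<^sup>2)"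
      by (subst Henstock_Kurzweil_Integration.integral_add)
         (auto intro!: integrable_on_mult_right reg_integrable_shift_sq[OF v] reg_integrable_shift_sq[OF w])
    also have "\<dots> \<le> (2 * L\<^sup>2) * (A * \<tau>)\<^sup>2 + (2 * L\<^sup>2) * (B * \<tau>)\<^sup>2"
      using v w \<tau> by (intro add_mono mult_left_mono) auto
    also have "\<dots> = 2 * L\<^sup>2 * \<tau>\<^sup>2 * (A\<^sup>2 + B\<^sup>2)" by (simp add: power_mult_distrib algebra_simps)
    also have "\<dots> \<le> 2 * L\<^sup>2 * \<tau>\<^sup>2 * (2 * (A + B)\<^sup>2)"
      using A B by (intro mult_left_mono) (auto simp: power2_sum)
    also have "\<dots> = (2 * L * (A + B) * \<tau>)\<^sup>2" by (simp add: power_mult_distrib)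
    also have "\<dots> \<le> (?C * \<tau>)\<^sup>2"
      using \<tau> L A B by (intro power_mono mult_right_mono) auto
    finally show ?thesis .
  qed
  moreover have "\<bar>u x\<bar> \<le> ?C" for x using u(3)[of x] by linarith
  ultimately show ?thesis using u by simp
qed

lemma reg_add:
  "reg k A v \<Longrightarrow> reg k B w \<Longrightarrow> reg k (2 * (A + B)) (\<lambda>x. v x + w x)"
proof (induction k arbitrary: v w)
  case 0
  note AB = reg_nonneg[OF 0(1)] reg_nonneg[OF 0(2)]
  have "reg 0 (max (A + B) (2 * 1 * (A + B))) (\<lambda>x. v x + w x)"
  proof (rule reg_0_dominated[OF 0])
    show "continuous_on UNIV (\<lambda>x. v x + w x)"
      by (intro continuous_intros reg_continuous[OF 0(1)] reg_continuous[OF 0(2)])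
    show "\<bar>v x + w x\<bar> \<le> A + B" for x
      using reg_bound[OF 0(1), of x] reg_bound[OF 0(2), of x] by linarith
    show "\<bar>v y + w y - (v x + w x)\<bar> \<le> 1 * (\<bar>v y - v x\<bar> + \<bar>w y - w x\<bar>)" for x y
      unfolding mult_1 by linarith
  qed (simp_all add: reg_periodic[OF 0(1)] reg_periodic[OF 0(2)])
  then show ?case using AB by (auto simp: max_def elim: reg_mono)
next
  case (Suc k)
  then obtain v' w' where *: "\<And>x. (v has_real_derivative v' x) (at x)" "reg k A v'"
     "\<And>x. (w has_real_derivative w' x) (at x)" "reg k B w'" by auto
  have "reg k (2 * (A + B)) (\<lambda>x. v' x + w' x)" using Suc.IH * by blast
  moreover have "((\<lambda>x. v x + w x) has_real_derivative v' x + w' x) (at x)" for x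
    by (intro DERIV_add *)
  moreover have "\<bar>v x + w x\<bar> \<le> 2 * (A + B)" for x
    unfolding distrib_left using abs_triangle_ineq[of "v x" "w x"] reg_bound[OF Suc.prems(1), of x] reg_bound[OF Suc.prems(2), of x]
      reg_nonneg[OF Suc.prems(1)] reg_nonneg[OF Suc.prems(2)] by linarith
  ultimately show ?case using reg_periodic[OF Suc.prems(1)] reg_periodic[OF Suc.prems(2)]
    by (auto intro!: exI[of _ "\<lambda>x. v' x + w' x"])
qed

text \<open>Leibniz rule and induction. The undifferentiated factor is moved one level down by
  \<open>reg_Suc\<close> at the price of a factor 3, so the bounds must vary in the induction;
  \<open>C\<close> is uniform over all factors with these bounds.\<close>

lemma reg_mult:
  "\<exists>C. \<forall>v w. reg k A v \<longrightarrow> reg k B w \<longrightarrow> reg k C (\<lambda>x. v x * w x)"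
proof (induction k arbitrary: A B)
  case 0
  have "reg 0 (max (A * B) (2 * max A B * (A + B))) (\<lambda>x. v x * w x)" if v: "reg 0 A v" and w: "reg 0 B w" for v w
  proof (rule reg_0_dominated[OF v w])
    have A: "0 \<le> A" using reg_nonneg[OF v] .
    then show "0 \<le> max A B" by simp
    show "continuous_on UNIV (\<lambda>x. v x * w x)"
      by (intro continuous_intros reg_continuous[OF v] reg_continuous[OF w])
    show "\<bar>v x * w x\<bar> \<le> A * B" for x
      unfolding abs_mult using reg_bound[OF v, of x] reg_bound[OF w, of x] A by (intro mult_mono) auto
    show "\<bar>v y * w y - v x * w x\<bar> \<le> max A B * (\<bar>v y - v x\<bar> + \<bar>w y - w x\<bar>)" for x y
    proof -
      have "\<bar>v y * w y - v x * w x\<bar> = \<bar>v y * (w y - w x) + w x * (v y - v x)\<bar>"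
        by (simp add: algebra_simps)
      also have "\<dots> \<le> \<bar>v y\<bar> * \<bar>w y - w x\<bar> + \<bar>w x\<bar> * \<bar>v y - v x\<bar>"
        by (metis abs_mult abs_triangle_ineq)
      also have "\<dots> \<le> max A B * \<bar>w y - w x\<bar> + max A B * \<bar>v y - v x\<bar>"
        using reg_bound[OF v, of y] reg_bound[OF w, of x] by (intro add_mono mult_right_mono) auto
      finally show ?thesis by (simp add: algebra_simps)
    qed
  qed (simp_all add: reg_periodic[OF v] reg_periodic[OF w])
  then show ?case by blast
next
  case (Suc k)
  obtain C1 where C1: "\<And>v w. reg k A v \<Longrightarrow> reg k (3 * B) w \<Longrightarrow> reg k C1 (\<lambda>x. v x * w x)"
    using Suc.IH[of A "3 * B"] by blast
  obtain C2 where C2: "\<And>v w. reg k (3 * A) v \<Longrightarrow> reg k B w \<Longrightarrow> reg k C2 (\<lambda>x. v x * w x)"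
    using Suc.IH[of "3 * A" B] by blast
  define C where "C = max (2 * (C1 + C2)) (A * B)"
  have "reg (Suc k) C (\<lambda>x. v x * w x)" if v: "reg (Suc k) A v" and w: "reg (Suc k) B w" for v w
  proof -
    obtain v' w' where *: "\<And>x. (v has_real_derivative v' x) (at x)" "reg k A v'"
      "\<And>x. (w has_real_derivative w' x) (at x)" "reg k B w'" using v w by auto
    have "reg k C1 (\<lambda>x. v' x * w x)" "reg k C2 (\<lambda>x. v x * w' x)"
      by (intro C1 C2 * reg_Suc v w)+
    then have "reg k (2 * (C1 + C2)) (\<lambda>x. v' x * w x + v x * w' x)" by (rule reg_add)
    then have 1: "reg k C (\<lambda>x. v' x * w x + v x * w' x)" by (rule reg_mono) (simp add: C_def)
    have 2: "((\<lambda>x. v x * w x) has_real_derivative v' x * w x + v x * w' x) (at x)" for x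
      using DERIV_mult[OF *(1) *(3), of x] by (simp add: add.commute mult.commute)
    have "\<bar>v x * w x\<bar> \<le> A * B" for x
      unfolding abs_mult using reg_bound[OF v, of x] reg_bound[OF w, of x] reg_nonneg[OF v] by (intro mult_mono) auto
    then have 3: "\<bar>v x * w x\<bar> \<le> C" for x by (simp add: C_def max.coboundedI2)
    show ?thesis by (rule reg_SucI[OF 2 1 _ 3]) (simp add: reg_periodic[OF v] reg_periodic[OF w])
  qed
  then show ?case by blast
qed

lemma norm_pair_le: "norm (x :: real, y :: real) \<le> \<bar>x\<bar> + \<bar>y\<bar>"
  by (simp add: norm_Pair sqrt_sum_squares_le_sum_abs)

text \<open>Chain rule and induction. The partial derivatives of \<open>\<Phi>\<close> are smooth
  again, hence the induction runs over all smooth \<open>\<Phi>\<close> and all \<open>B\<close> at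
  once.\<close>

lemma reg_compose:
  fixes \<Phi> :: "real \<times> real \<Rightarrow> real"
  shows "smooth \<Phi> \<Longrightarrow> \<exists>C. \<forall>v w. reg k B v \<longrightarrow> reg k B w \<longrightarrow> reg k C (\<lambda>x. \<Phi> (v x, w x))"
proof (induction k arbitrary: \<Phi> B)
  case 0
  obtain D where D: "\<And>z. norm z \<le> B + B \<Longrightarrow> \<bar>\<Phi> z\<bar> \<le> D" using smooth_bounded[OF 0] by metis
  obtain L where L: "L \<ge> 0" "\<And>x y. norm x \<le> B + B \<Longrightarrow> norm y \<le> B + B \<Longrightarrow> \<bar>\<Phi> x - \<Phi> y\<bar> \<le> L * norm (x - y)"
    using smooth_lipschitz[OF 0] by metis
  have "reg 0 (max D (2 * L * (B + B))) (\<lambda>x. \<Phi> (v x, w x))" if v: "reg 0 B v" and w: "reg 0 B w" for v w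
  proof (rule reg_0_dominated[OF v w L(1)])
    have n: "norm (v x, w x) \<le> B + B" for x
      using norm_pair_le[of "v x" "w x"] reg_bound[OF v, of x] reg_bound[OF w, of x] by linarith
    show "continuous_on UNIV (\<lambda>x. \<Phi> (v x, w x))"
      by (intro continuous_on_compose2[OF smooth_continuous[OF 0, of UNIV]] continuous_intros
          reg_continuous[OF v] reg_continuous[OF w]) auto
    show "\<bar>\<Phi> (v x, w x)\<bar> \<le> D" for x by (rule D[OF n])
    show "\<bar>\<Phi> (v y, w y) - \<Phi> (v x, w x)\<bar> \<le> L * (\<bar>v y - v x\<bar> + \<bar>w y - w x\<bar>)" for x y
      using L(2)[OF n n, of y x] mult_left_mono[OF norm_pair_le[of "v y - v x" "w y - w x"] L(1)] by simp
  qed (simp_all add: reg_periodic[OF v] reg_periodic[OF w])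
  then show ?case by blast
next
  case (Suc k)
  let ?\<Phi>1 = "\<lambda>z. frechet_derivative \<Phi> (at z) (1, 0)" and ?\<Phi>2 = "\<lambda>z. frechet_derivative \<Phi> (at z) (0, 1)"
  obtain D where D: "\<And>z. norm z \<le> B + B \<Longrightarrow> \<bar>\<Phi> z\<bar> \<le> D" using smooth_bounded[OF Suc.prems] by metis
  obtain C1 where C1: "\<And>v w. reg k (3 * B) v \<Longrightarrow> reg k (3 * B) w \<Longrightarrow> reg k C1 (\<lambda>x. ?\<Phi>1 (v x, w x))"
    using Suc.IH[OF smooth_frechet[OF Suc.prems], of "3 * B"] by blast
  obtain C2 where C2: "\<And>v w. reg k (3 * B) v \<Longrightarrow> reg k (3 * B) w \<Longrightarrow> reg k C2 (\<lambda>x. ?\<Phi>2 (v x, w x))"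
    using Suc.IH[OF smooth_frechet[OF Suc.prems], of "3 * B"] by blast
  obtain C3 where C3: "\<And>v w. reg k C1 v \<Longrightarrow> reg k B w \<Longrightarrow> reg k C3 (\<lambda>x. v x * w x)"
    using reg_mult[of k C1 B] by blast
  obtain C4 where C4: "\<And>v w. reg k C2 v \<Longrightarrow> reg k B w \<Longrightarrow> reg k C4 (\<lambda>x. v x * w x)"
    using reg_mult[of k C2 B] by blast
  define C where "C = max (2 * (C3 + C4)) D"
  have "reg (Suc k) C (\<lambda>x. \<Phi> (v x, w x))" if v: "reg (Suc k) B v" and w: "reg (Suc k) B w" for v w
  proof -
    obtain v' w' where *: "\<And>x. (v has_real_derivative v' x) (at x)" "reg k B v'"
      "\<And>x. (w has_real_derivative w' x) (at x)" "reg k B w'" using v w by auto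
    have "reg k (2 * (C3 + C4)) (\<lambda>x. ?\<Phi>1 (v x, w x) * v' x + ?\<Phi>2 (v x, w x) * w' x)"
      by (intro reg_add C3 C4 C1 C2 * reg_Suc v w)
    then have 1: "reg k C (\<lambda>x. ?\<Phi>1 (v x, w x) * v' x + ?\<Phi>2 (v x, w x) * w' x)"
      by (rule reg_mono) (simp add: C_def)
    have 2: "((\<lambda>x. \<Phi> (v x, w x)) has_real_derivative ?\<Phi>1 (v x, w x) * v' x + ?\<Phi>2 (v x, w x) * w' x) (at x)" for x
    proof -
      let ?T = "frechet_derivative \<Phi> (at (v x, w x))"
      have "((\<lambda>x. (v x, w x)) has_derivative (\<lambda>h. (v' x * h, w' x * h))) (at x)"
        using *(1,3)[of x] unfolding has_field_derivative_def by (rule has_derivative_Pair)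
      then have "((\<lambda>x. \<Phi> (v x, w x)) has_derivative (\<lambda>h. ?T (v' x * h, w' x * h))) (at x)"
        by (rule has_derivative_compose[OF _ smooth_has_derivative[OF Suc.prems]])
      moreover have "?T (v' x * h, w' x * h) = (?\<Phi>1 (v x, w x) * v' x + ?\<Phi>2 (v x, w x) * w' x) * h" for h
      proof -
        have l: "linear ?T" by (rule linear_frechet[OF Suc.prems])
        have "(v' x * h, w' x * h) = (v' x * h) *\<^sub>R (1, 0) + (w' x * h) *\<^sub>R (0, 1)" by simp
        then have "?T (v' x * h, w' x * h) = (v' x * h) * ?T (1, 0) + (w' x * h) * ?T (0, 1)"
          by (simp only: linear_add[OF l] linear_cmul[OF l] real_scaleR_def)
        then show ?thesis by (simp add: algebra_simps)
      qed
      ultimately show ?thesis unfolding has_field_derivative_def by (simp add: fun_eq_iff)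
    qed
    have "norm (v x, w x) \<le> B + B" for x
      using norm_pair_le[of "v x" "w x"] reg_bound[OF v, of x] reg_bound[OF w, of x] by linarith
    then have 3: "\<bar>\<Phi> (v x, w x)\<bar> \<le> C" for x using D[of "(v x, w x)"] by (simp add: C_def max.coboundedI2)
    show ?thesis by (rule reg_SucI[OF 2 1 _ 3]) (simp add: reg_periodic[OF v] reg_periodic[OF w])
  qed
  then show ?case by blast
qed

text \<open>Translation by \<open>\<tau>\<close> multiplies the coefficients by
  exp(ij\<open>\<tau>\<close>). Bessel bounds (exp(ij\<open>\<tau>\<close>) -
  1)/\<open>\<tau>\<close> times the coefficients by \<open>B\<close> uniformly in
  \<open>\<tau>\<close>, and letting \<open>\<tau>\<close> tend to 0 leaves the weight |j|; finally
  <j> <= |j| + 1.\<close>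

lemma reg_0_fourier:
  assumes w: "reg 0 B w"
  shows "ell2 (2 * B) (\<lambda>j. japanese j *\<^sub>R fourier_coeff w j)"
proof -
  have B: "0 \<le> B" using reg_nonneg[OF w] .
  have cont: "continuous_on S w" for S using reg_continuous[OF w] .
  have a: "ell2 B (fourier_coeff w)"
  proof (rule fourier_coeff_bessel[OF cont B])
    have "(w x)\<^sup>2 \<le> B\<^sup>2" for x using power_mono[OF reg_bound[OF w, of x], of 2] by simp
    then have "integral {0..2 * pi} (\<lambda>x. (w x)\<^sup>2) \<le> integral {0..2 * pi} (\<lambda>x. B\<^sup>2)"
      by (intro integral_le integrable_continuous_real continuous_intros cont) auto
    then show "integral {0..2 * pi} (\<lambda>x. (w x)\<^sup>2) \<le> 2 * pi * B\<^sup>2" by simp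
  qed
  have b: "ell2 B (\<lambda>j. (\<i> * of_real (real_of_int j)) * fourier_coeff w j)"
  proof (rule ell2_limit[of "at 0 within {0<..<1}"])
    show "at (0::real) within {0<..<1} \<noteq> bot"
      by (simp add: at_within_eq_bot_iff)
    show "((\<lambda>\<tau>. (cis (real_of_int j * (\<tau> - 0)) - 1) / of_real (\<tau> - 0) * fourier_coeff w j) \<longlongrightarrow>
        \<i> * of_real (real_of_int j) * fourier_coeff w j) (at 0 within {0<..<1})" for j
      by (intro tendsto_mult_right cis_difference_quotient)
    show "\<forall>\<^sub>F \<tau> in at 0 within {0<..<1}.
        ell2 B (\<lambda>j. (cis (real_of_int j * (\<tau> - 0)) - 1) / of_real (\<tau> - 0) * fourier_coeff w j)"
      unfolding eventually_at_filter
    proof (rule always_eventually, intro allI impI)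
      fix \<tau> :: real assume "\<tau> \<in> {0<..<1}"
      then have \<tau>: "0 < \<tau>" "\<tau> < 1" by auto
      have cs: "continuous_on S (\<lambda>x. w (x + \<tau>))" for S
        by (intro continuous_on_compose2[OF cont[of UNIV]] continuous_intros) auto
      have "ell2 (B * \<tau>) (fourier_coeff (\<lambda>x. w (x + \<tau>) - w x))"
      proof (rule fourier_coeff_bessel)
        have "integral {0..2 * pi} (\<lambda>x. (w (x + \<tau>) - w x)\<^sup>2) \<le> (B * \<tau>)\<^sup>2"
          using w \<tau> by auto
        also have "\<dots> \<le> 2 * pi * (B * \<tau>)\<^sup>2"
          using mult_right_mono[of 1 "2 * pi" "(B * \<tau>)\<^sup>2"] pi_ge_two by simp
        finally show "integral {0..2 * pi} (\<lambda>x. (w (x + \<tau>) - w x)\<^sup>2) \<le> 2 * pi * (B * \<tau>)\<^sup>2" .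
      qed (use B \<tau> in \<open>auto intro!: continuous_intros cs cont\<close>)
      moreover have "fourier_coeff (\<lambda>x. w (x + \<tau>) - w x) j = (cis (real_of_int j * \<tau>) - 1) * fourier_coeff w j" for j
        using fourier_coeff_shift[OF cont reg_periodic[OF w], of \<tau> j] \<tau> pi_ge_two
        by (simp add: fourier_coeff_diff coeff_integrable_continuous cs cont algebra_simps)
      ultimately have "ell2 (B * \<tau>) (\<lambda>j. (cis (real_of_int j * \<tau>) - 1) * fourier_coeff w j)"
        by (simp add: ell2_def)
      then have "ell2 (1 / \<tau> * (B * \<tau>)) (\<lambda>j. (cis (real_of_int j * (\<tau> - 0)) - 1) / of_real (\<tau> - 0) * fourier_coeff w j)"
        by (rule ell2_cmul) (use \<tau> in \<open>simp_all add: norm_mult norm_divide\<close>)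
      then show "ell2 B (\<lambda>j. (cis (real_of_int j * (\<tau> - 0)) - 1) / of_real (\<tau> - 0) * fourier_coeff w j)"
        using \<tau> by simp
    qed
  qed
  have b': "ell2 B (\<lambda>j. \<bar>real_of_int j\<bar> *\<^sub>R fourier_coeff w j)"
    by (rule ell2_mono[OF b order_refl]) (simp add: norm_mult)
  have "ell2 (B + B) (\<lambda>j. \<bar>real_of_int j\<bar> *\<^sub>R fourier_coeff w j + fourier_coeff w j)"
    by (rule ell2_add[OF b' a])
  then show ?thesis
  proof (rule ell2_mono)
    fix j
    have j: "japanese j \<le> \<bar>real_of_int j\<bar> + 1"
      unfolding japanese_def by (rule real_le_lsqrt) (auto simp: power2_sum)
    have "norm (\<bar>real_of_int j\<bar> *\<^sub>R fourier_coeff w j + fourier_coeff w j)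
        = norm ((\<bar>real_of_int j\<bar> + 1) *\<^sub>R fourier_coeff w j)" by (simp add: scaleR_add_left)
    then show "norm (japanese j *\<^sub>R fourier_coeff w j)
        \<le> norm (\<bar>real_of_int j\<bar> *\<^sub>R fourier_coeff w j + fourier_coeff w j)"
      using j by (simp add: mult_right_mono)
  qed simp
qed

text \<open>Each derivative contributes a weight |j|; the lower level, obtained from
  \<open>reg_Suc\<close>, supplies the missing 1 in <j> <= |j| + 1. Together with
  \<open>trig_reg\<close> this identifies \<open>reg k\<close> with H^(k+1) up to constants.\<close>

lemma reg_fourier: "\<exists>C. \<forall>w. reg k B w \<longrightarrow> sob (k + 1) C (fourier_coeff w)"
proof (induction k arbitrary: B)
  case 0
  then show ?case using reg_0_fourier by (auto simp del: reg.simps)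
next
  case (Suc k)
  obtain C1 where C1: "\<And>w. reg k B w \<Longrightarrow> sob (k + 1) C1 (fourier_coeff w)"
    using Suc.IH by blast
  obtain C2 where C2: "\<And>w. reg k (3 * B) w \<Longrightarrow> sob (k + 1) C2 (fourier_coeff w)"
    using Suc.IH by blast
  have "sob (Suc k + 1) (C1 + C2) (fourier_coeff w)" if w: "reg (Suc k) B w" for w
  proof -
    obtain w' where w': "\<And>x. (w has_real_derivative w' x) (at x)" "reg k B w'" using w by auto
    let ?s = "\<lambda>j. japanese j ^ (k + 1)"
    have 1: "ell2 C1 (\<lambda>j. (\<bar>real_of_int j\<bar> * ?s j) *\<^sub>R fourier_coeff w j)"
    proof (rule ell2_mono[OF C1[OF w'(2)] order_refl])
      show "norm ((\<bar>real_of_int j\<bar> * ?s j) *\<^sub>R fourier_coeff w j) \<le> norm (?s j *\<^sub>R fourier_coeff w' j)" for j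
        using fourier_coeff_deriv[OF w'(1) reg_continuous[OF w'(2)] reg_periodic[OF w], of j]
        by (simp add: norm_mult mult_ac)
    qed
    have 2: "ell2 C2 (\<lambda>j. ?s j *\<^sub>R fourier_coeff w j)" by (rule C2[OF reg_Suc[OF w]])
    show ?thesis
    proof (rule ell2_mono[OF ell2_add[OF 1 2] order_refl])
      fix j
      have j: "japanese j \<le> \<bar>real_of_int j\<bar> + 1"
        unfolding japanese_def by (rule real_le_lsqrt) (auto simp: power2_sum)
      have "norm ((\<bar>real_of_int j\<bar> * ?s j) *\<^sub>R fourier_coeff w j + ?s j *\<^sub>R fourier_coeff w j)
         = norm (((\<bar>real_of_int j\<bar> + 1) * ?s j) *\<^sub>R fourier_coeff w j)"
        by (simp add: distrib_right scaleR_add_left)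
      also have "\<dots> = (\<bar>real_of_int j\<bar> + 1) * ?s j * norm (fourier_coeff w j)"
        by (simp add: abs_mult)
      finally show "norm (japanese j ^ (Suc k + 1) *\<^sub>R fourier_coeff w j)
         \<le> norm ((\<bar>real_of_int j\<bar> * ?s j) *\<^sub>R fourier_coeff w j + ?s j *\<^sub>R fourier_coeff w j)"
        using mult_right_mono[OF j, of "?s j * norm (fourier_coeff w j)"] by (simp add: mult.assoc abs_mult)
    qed
  qed
  then show ?case by blast
qed

section \<open>Differentiated series and regularity of the nonlinearity\<close>

definition dcoef :: "(int \<Rightarrow> complex) \<Rightarrow> int \<Rightarrow> complex" where
  "dcoef c j = \<i> * of_int j * c j"

lemma ell2_weight_mono:
  fixes c :: "int \<Rightarrow> complex"
  assumes "sob m B c" "n \<le> m"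
  shows "sob n B c"
  by (rule ell2_mono[OF assms(1) order_refl])
     (use assms(2) in \<open>simp add: mult_right_mono power_increasing japanese_ge_1\<close>)

lemma ell2_dcoef:
  assumes "sob (Suc n) B c"
  shows "sob n B (dcoef c)"
proof (rule ell2_mono[OF assms order_refl])
  fix j
  have "\<bar>real_of_int j\<bar> * (japanese j ^ n * norm (c j)) \<le> japanese j * (japanese j ^ n * norm (c j))"
    by (intro mult_right_mono abs_le_japanese) simp
  then show "norm (japanese j ^ n *\<^sub>R dcoef c j) \<le> norm (japanese j ^ Suc n *\<^sub>R c j)"
    by (simp add: dcoef_def norm_mult mult_ac)
qed

lemma ell2_asum:
  fixes c :: "int \<Rightarrow> complex"
  assumes "sob (Suc n) B c"
  shows "asum c" and "\<bar>trig c x\<bar> \<le> 2 * B"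
proof -
  have *: "ell2 B (\<lambda>j. japanese j *\<^sub>R c j)" using ell2_weight_mono[OF assms, of 1] by simp
  show "asum c" by (rule ell2_imp_abs_summable[OF *])
  then show "\<bar>trig c x\<bar> \<le> 2 * B"
    using trig_bound[of c x] ell2_imp_abs_summable(2)[OF *] by linarith
qed

lemma trig_deriv_dcoef:
  assumes "sob (Suc (Suc n)) B c"
  shows "(trig c has_real_derivative trig (dcoef c) x) (at x)"
proof -
  have "asum c" "asum (dcoef c)"
    using ell2_asum(1)[OF assms] ell2_asum(1)[OF ell2_dcoef[OF assms]] by auto
  then show ?thesis unfolding dcoef_def[abs_def] by (rule trig_deriv)
qed

text \<open>Since |exp(ij\<open>\<tau>\<close>) - 1| <= |j|\<open>\<tau>\<close>, a weight <j> on
  the coefficients yields the L2 Lipschitz bound for translations; higher levels follow by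
  differentiating the series.\<close>

lemma trig_reg:
  "sob (k + 1) B c \<Longrightarrow> reg k (3 * B) (trig c)"
proof (induction k arbitrary: c)
  case 0
  then have c: "sob (Suc 0) B c" by simp
  have B: "0 \<le> B" using ell2_nonneg[OF c] .
  note as = ell2_asum(1)[OF c]
  have "integral {0..2 * pi} (\<lambda>x. (trig c (x + \<tau>) - trig c x)\<^sup>2) \<le> (3 * B * \<tau>)\<^sup>2" if \<tau>: "\<tau> \<in> {0..1}" for \<tau>
  proof -
    let ?d = "\<lambda>j. c j * cis (real_of_int j * \<tau>)"
    have as': "asum ?d" using as by (simp add: norm_mult)
    have eq: "trig c (x + \<tau>) - trig c x = trig (\<lambda>j. ?d j - c j) x" for x
      by (simp add: trig_shift trig_diff as as')
    have as2: "asum (\<lambda>j. ?d j - c j)"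
    proof (rule asum_cmul[OF as, of _ 2])
      show "norm (?d j - c j) \<le> 2 * norm (c j)" for j
        using norm_triangle_ineq4[of "?d j" "c j"] by (simp add: norm_mult)
    qed
    have e: "ell2 (\<tau> * B) (\<lambda>j. ?d j - c j)"
    proof (rule ell2_cmul[OF c])
      show "0 \<le> \<tau>" using \<tau> by simp
      fix j
      have "norm (cis (real_of_int j * \<tau>) - 1) \<le> \<bar>real_of_int j\<bar> * \<tau>"
      proof -
        have "norm (cis (real_of_int j * \<tau>) - cis (real_of_int j * 0)) \<le> \<bar>real_of_int j\<bar> * norm (\<tau> - 0)"
        proof (rule differentiable_bound[of UNIV "\<lambda>x. cis (real_of_int j * x)" "\<lambda>x h. h *\<^sub>R (\<i> * of_real (real_of_int j) * cis (real_of_int j * x))"])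
          show "((\<lambda>x. cis (real_of_int j * x)) has_derivative (\<lambda>h. h *\<^sub>R (\<i> * of_real (real_of_int j) * cis (real_of_int j * x))))
             (at x within UNIV)" for x
            using has_vector_derivative_cis_mult unfolding has_vector_derivative_def .
          show "onorm (\<lambda>h. h *\<^sub>R (\<i> * of_real (real_of_int j) * cis (real_of_int j * x))) \<le> \<bar>real_of_int j\<bar>" for x
            by (rule onorm_le) (simp add: norm_mult)
        qed auto
        then show ?thesis using \<tau> by simp
      qed
      also have "\<dots> \<le> japanese j * \<tau>" using \<tau> by (intro mult_right_mono abs_le_japanese) simp
      finally have "norm (c j) * norm (cis (real_of_int j * \<tau>) - 1) \<le> norm (c j) * (japanese j * \<tau>)"
        by (intro mult_left_mono) simp_all
      moreover have "?d j - c j = c j * (cis (real_of_int j * \<tau>) - 1)" by (simp add: algebra_simps)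
      ultimately show "norm (?d j - c j) \<le> \<tau> * norm (japanese j ^ Suc 0 *\<^sub>R c j)"
        by (simp add: norm_mult mult_ac)
    qed
    have "integral {0..2 * pi} (\<lambda>x. (trig c (x + \<tau>) - trig c x)\<^sup>2) \<le> 2 * pi * (\<tau> * B)\<^sup>2"
      unfolding eq by (rule integral_trig_sq[OF as2 e])
    also have "\<dots> \<le> 3\<^sup>2 * (\<tau> * B)\<^sup>2" by (intro mult_right_mono pi_sq_bound) simp
    finally show ?thesis by (simp add: power_mult_distrib mult_ac)
  qed
  moreover have "\<bar>trig c x\<bar> \<le> 3 * B" for x using ell2_asum(2)[OF c, of x] B by linarith
  ultimately show ?case using trig_continuous[OF as] trig_periodic by simp
next
  case (Suc k)
  have c: "sob (Suc (Suc k)) B c" using Suc.prems by simp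
  have B: "0 \<le> B" using ell2_nonneg[OF c] .
  have "reg k (3 * B) (trig (dcoef c))" using Suc.IH[of "dcoef c"] ell2_dcoef[OF c] by simp
  moreover have "\<bar>trig c x\<bar> \<le> 3 * B" for x using ell2_asum(2)[OF c, of x] B by linarith
  ultimately show ?case using trig_deriv_dcoef[OF c] trig_periodic by (intro reg_SucI) auto
qed

text \<open>The index 3 is two derivatives plus one weight for absolute summability of the second
  derivative.\<close>

lemma nonlin_trig:
  assumes "sob 3 B c"
  shows "nonlin a g (trig c) x = a (trig c x) * trig (dcoef (dcoef c)) x + g (trig c x, trig (dcoef c) x)"
proof -
  have c: "sob (Suc (Suc (Suc 0))) B c"
    using assms by (simp add: numeral_3_eq_3)
  have "deriv (trig c) = trig (dcoef c)"
    using trig_deriv_dcoef[OF c] by (auto intro!: DERIV_imp_deriv)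
  moreover have "deriv (trig (dcoef c)) = trig (dcoef (dcoef c))"
    using trig_deriv_dcoef[OF ell2_dcoef[OF c]] by (auto intro!: DERIV_imp_deriv)
  ultimately show ?thesis by (simp add: nonlin_def)
qed

text \<open>The nonlinearity costs exactly the two derivatives it contains, H^(k+3) to H^(k+1). The
  case k = 2 serves the exact solution in H^5, the case k = 0 the iterates in H^3.\<close>

lemma nonlin_reg:
  assumes a: "smooth a" and g: "smooth g"
  shows "\<exists>C. \<forall>c. sob (k + 3) B c \<longrightarrow> reg k C (nonlin a g (trig c))"
proof -
  obtain C1 where C1: "\<And>v w. reg k (3 * B) v \<Longrightarrow> reg k (3 * B) w \<Longrightarrow> reg k C1 (\<lambda>x. (\<lambda>z. a (fst z)) (v x, w x))"
    using reg_compose[OF smooth_fst[OF a], of k "3 * B"] by blast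
  obtain C2 where C2: "\<And>v w. reg k (3 * B) v \<Longrightarrow> reg k (3 * B) w \<Longrightarrow> reg k C2 (\<lambda>x. g (v x, w x))"
    using reg_compose[OF g, of k "3 * B"] by blast
  obtain C3 where C3: "\<And>v w. reg k C1 v \<Longrightarrow> reg k (3 * B) w \<Longrightarrow> reg k C3 (\<lambda>x. v x * w x)"
    using reg_mult[of k C1 "3 * B"] by blast
  have "reg k (2 * (C3 + C2)) (nonlin a g (trig c))" if c: "sob (k + 3) B c" for c
  proof -
    have c': "sob (Suc (Suc (Suc k))) B c"
      using c by (simp add: numeral_3_eq_3)
    have u: "reg k (3 * B) (trig c)" by (rule trig_reg) (rule ell2_weight_mono[OF c], simp)
    have q: "reg k (3 * B) (trig (dcoef c))"
      by (rule trig_reg) (rule ell2_weight_mono[OF ell2_dcoef[OF c']], simp)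
    have p: "reg k (3 * B) (trig (dcoef (dcoef c)))"
      by (rule trig_reg) (use ell2_dcoef[OF ell2_dcoef[OF c']] in simp)
    have "reg k (2 * (C3 + C2)) (\<lambda>x. a (trig c x) * trig (dcoef (dcoef c)) x + g (trig c x, trig (dcoef c) x))"
      using C1[OF u q] by (intro reg_add C3 C2 u q p) simp
    moreover have "nonlin a g (trig c) = (\<lambda>x. a (trig c x) * trig (dcoef (dcoef c)) x + g (trig c x, trig (dcoef c) x))"
      by (rule ext) (rule nonlin_trig[OF ell2_weight_mono[OF c]], simp)
    ultimately show ?thesis by simp
  qed
  then show ?thesis by blast
qed

text \<open>Tailored to differences of the nonlinearity: the top-order term is known only in L2, as
  a series with bounded factor \<open>A\<close>, while all lower-order terms are bounded uniformly
  by \<open>K\<close>.\<close>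

lemma fourier_coeff_dominated:
  assumes v: "continuous_on {0..2 * pi} v" and e: "ell2 E e" "asum e" and A: "0 \<le> A" and K: "0 \<le> K"
    and le: "\<And>x. \<bar>v x\<bar> \<le> A * \<bar>trig e x\<bar> + K"
  shows "ell2 (2 * A * E + 2 * K) (fourier_coeff v)"
proof (rule fourier_coeff_bessel[OF v])
  have E: "0 \<le> E" using ell2_nonneg[OF e(1)] .
  then show "0 \<le> 2 * A * E + 2 * K" using A K by simp
  have "(v x)\<^sup>2 \<le> 2 * A\<^sup>2 * (trig e x)\<^sup>2 + 2 * K\<^sup>2" for x
  proof -
    have "\<bar>v x\<bar>\<^sup>2 \<le> (A * \<bar>trig e x\<bar> + K)\<^sup>2" using le by (intro power_mono) auto
    also have "\<dots> \<le> 2 * (A * \<bar>trig e x\<bar>)\<^sup>2 + 2 * K\<^sup>2"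
      using zero_le_power2[of "A * \<bar>trig e x\<bar> - K"] unfolding power2_sum power2_diff by linarith
    finally show ?thesis by (simp add: power_mult_distrib mult.assoc)
  qed
  then have "integral {0..2 * pi} (\<lambda>x. (v x)\<^sup>2) \<le> integral {0..2 * pi} (\<lambda>x. 2 * A\<^sup>2 * (trig e x)\<^sup>2 + 2 * K\<^sup>2)"
    by (intro integral_le integrable_continuous_real continuous_intros v trig_continuous e) auto
  also have "\<dots> = 2 * A\<^sup>2 * integral {0..2 * pi} (\<lambda>x. (trig e x)\<^sup>2) + 2 * pi * (2 * K\<^sup>2)"
    by (subst Henstock_Kurzweil_Integration.integral_add)
       (auto intro!: integrable_continuous_real continuous_intros trig_continuous e)
  also have "\<dots> \<le> 2 * A\<^sup>2 * (2 * pi * E\<^sup>2) + 2 * pi * (2 * K\<^sup>2)"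
    by (intro add_mono mult_left_mono integral_trig_sq e) auto
  also have "\<dots> = 2 * pi * (2 * (A * E)\<^sup>2 + 2 * K\<^sup>2)" by (simp add: power_mult_distrib algebra_simps)
  also have "\<dots> \<le> 2 * pi * (2 * A * E + 2 * K)\<^sup>2"
    using A E K by (intro mult_left_mono) (auto simp: power2_sum power_mult_distrib)
  finally show "integral {0..2 * pi} (\<lambda>x. (v x)\<^sup>2) \<le> 2 * pi * (2 * A * E + 2 * K)\<^sup>2" .
qed

text \<open>In a(u)(p - p') + (a(u) - a(u'))p' the difference of \<open>a\<close> meets only p', so
  \<open>L\<close> is uniform in p. The unprimed second derivative later belongs to the numerical
  solution.\<close>

lemma nonlin_pointwise_lipschitz:
  fixes a :: "real \<Rightarrow> real" and g :: "real \<times> real \<Rightarrow> real"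
  assumes a: "smooth a" and g: "smooth g"
  obtains L where "L \<ge> 0" "\<And>u q p u' q' p'. \<bar>u\<bar> \<le> B \<Longrightarrow> \<bar>q\<bar> \<le> B \<Longrightarrow> \<bar>u'\<bar> \<le> B \<Longrightarrow> \<bar>q'\<bar> \<le> B \<Longrightarrow> \<bar>p'\<bar> \<le> B \<Longrightarrow>
    \<bar>(a u * p + g (u, q)) - (a u' * p' + g (u', q'))\<bar> \<le> L * (\<bar>u - u'\<bar> + \<bar>q - q'\<bar> + \<bar>p - p'\<bar>)"
proof -
  obtain A where A: "A \<ge> 0" "\<And>x. norm x \<le> B \<Longrightarrow> \<bar>a x\<bar> \<le> A" using smooth_bounded[OF a] by metis
  obtain La where La: "La \<ge> 0" "\<And>x y. norm x \<le> B \<Longrightarrow> norm y \<le> B \<Longrightarrow> \<bar>a x - a y\<bar> \<le> La * norm (x - y)"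
    using smooth_lipschitz[OF a] by metis
  obtain Lg where Lg: "Lg \<ge> 0" "\<And>x y. norm x \<le> B + B \<Longrightarrow> norm y \<le> B + B \<Longrightarrow> \<bar>g x - g y\<bar> \<le> Lg * norm (x - y)"
    using smooth_lipschitz[OF g] by metis
  let ?L = "A + La * \<bar>B\<bar> + Lg"
  have "\<bar>(a u * p + g (u, q)) - (a u' * p' + g (u', q'))\<bar> \<le> ?L * (\<bar>u - u'\<bar> + \<bar>q - q'\<bar> + \<bar>p - p'\<bar>)"
    if b: "\<bar>u\<bar> \<le> B" "\<bar>q\<bar> \<le> B" "\<bar>u'\<bar> \<le> B" "\<bar>q'\<bar> \<le> B" "\<bar>p'\<bar> \<le> B" for u q p u' q' p'
  proof -
    have n: "norm (u, q) \<le> B + B" "norm (u', q') \<le> B + B"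
      using norm_pair_le[of u q] norm_pair_le[of u' q'] b by linarith+
    have 1: "\<bar>g (u, q) - g (u', q')\<bar> \<le> Lg * (\<bar>u - u'\<bar> + \<bar>q - q'\<bar>)"
      using Lg(2)[OF n] mult_left_mono[OF norm_pair_le[of "u - u'" "q - q'"] Lg(1)] by simp
    have 2: "\<bar>a u * (p - p')\<bar> \<le> A * \<bar>p - p'\<bar>" unfolding abs_mult using A b by (intro mult_right_mono) auto
    have 3: "\<bar>(a u - a u') * p'\<bar> \<le> (La * \<bar>u - u'\<bar>) * \<bar>B\<bar>" unfolding abs_mult
      using La b by (intro mult_mono) auto
    have "(a u * p + g (u, q)) - (a u' * p' + g (u', q'))
        = a u * (p - p') + (a u - a u') * p' + (g (u, q) - g (u', q'))" by (simp add: algebra_simps)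
    then have "\<bar>(a u * p + g (u, q)) - (a u' * p' + g (u', q'))\<bar>
        \<le> A * \<bar>p - p'\<bar> + (La * \<bar>u - u'\<bar>) * \<bar>B\<bar> + Lg * (\<bar>u - u'\<bar> + \<bar>q - q'\<bar>)"
      using 1 2 3 by linarith
    also have "\<dots> \<le> ?L * (\<bar>u - u'\<bar> + \<bar>q - q'\<bar> + \<bar>p - p'\<bar>)"
    proof -
      have "?L * (\<bar>u - u'\<bar> + \<bar>q - q'\<bar> + \<bar>p - p'\<bar>) - (A * \<bar>p - p'\<bar> + (La * \<bar>u - u'\<bar>) * \<bar>B\<bar> + Lg * (\<bar>u - u'\<bar> + \<bar>q - q'\<bar>))
         = A * (\<bar>u - u'\<bar> + \<bar>q - q'\<bar>) + La * \<bar>B\<bar> * (\<bar>q - q'\<bar> + \<bar>p - p'\<bar>) + Lg * \<bar>p - p'\<bar>"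
        by (simp add: algebra_simps)
      moreover have "0 \<le> \<dots>" using A La Lg by (intro add_nonneg_nonneg mult_nonneg_nonneg) auto
      ultimately show ?thesis by linarith
    qed
    finally show ?thesis .
  qed
  then show ?thesis using that[of ?L] A La Lg by (simp add: add_nonneg_nonneg)
qed

text \<open>Taylor expansion of both outer values about the middle one: the linear parts combine to
  the derivative applied to the second difference of the arguments, and the remainders are
  quadratic.\<close>

lemma smooth_second_difference:
  fixes f :: "'a::euclidean_space \<Rightarrow> real"
  assumes f: "smooth f"
  obtains L where "L \<ge> 0" "\<And>x y z. norm x \<le> B \<Longrightarrow> norm y \<le> B \<Longrightarrow> norm z \<le> B \<Longrightarrow>
    \<bar>(f y - f x) - (f x - f z)\<bar> \<le> L * ((norm (y - x))\<^sup>2 + (norm (x - z))\<^sup>2 + norm ((y - x) - (x - z)))"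
proof -
  obtain L where L: "L \<ge> 0" "\<And>x y. norm x \<le> B \<Longrightarrow> norm y \<le> B \<Longrightarrow>
    \<bar>f y - f x - frechet_derivative f (at x) (y - x)\<bar> \<le> L * (norm (y - x))\<^sup>2"
    using smooth_taylor[OF f] by metis
  have "\<exists>D. \<forall>b. D b \<ge> 0 \<and> (\<forall>x. norm x \<le> B \<longrightarrow> \<bar>frechet_derivative f (at x) b\<bar> \<le> D b)"
  proof (rule choice, rule allI)
    fix b
    show "\<exists>D. D \<ge> 0 \<and> (\<forall>x. norm x \<le> B \<longrightarrow> \<bar>frechet_derivative f (at x) b\<bar> \<le> D)"
      using smooth_bounded[OF smooth_frechet[OF f]] by metis
  qed
  then obtain D where D: "\<And>b. D b \<ge> 0" "\<And>b x. norm x \<le> B \<Longrightarrow> \<bar>frechet_derivative f (at x) b\<bar> \<le> D b" by blast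
  let ?D = "\<Sum>b\<in>Basis. D b"
  have D0: "0 \<le> ?D" using D by (simp add: sum_nonneg)
  have "\<bar>(f y - f x) - (f x - f z)\<bar> \<le> (L + ?D) * ((norm (y - x))\<^sup>2 + (norm (x - z))\<^sup>2 + norm ((y - x) - (x - z)))"
    if b: "norm x \<le> B" "norm y \<le> B" "norm z \<le> B" for x y z
  proof -
    let ?T = "frechet_derivative f (at x)" and ?h = "(y - x) - (x - z)"
    have lT: "linear ?T" by (rule linear_frechet[OF f])
    have "?T ?h = ?T (y - x) + ?T (z - x)" by (simp add: linear_diff[OF lT])
    moreover have "\<bar>?T ?h\<bar> \<le> ?D * norm ?h"
    proof -
      have "\<bar>?T ?h\<bar> \<le> (\<Sum>b\<in>Basis. \<bar>?T b\<bar>) * norm ?h" by (rule abs_linear_le_Basis[OF lT])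
      also have "\<dots> \<le> ?D * norm ?h" using D b by (intro mult_right_mono sum_mono) auto
      finally show ?thesis .
    qed
    moreover have "\<bar>f y - f x - ?T (y - x)\<bar> \<le> L * (norm (y - x))\<^sup>2" by (rule L(2)[OF b(1,2)])
    moreover have "\<bar>f z - f x - ?T (z - x)\<bar> \<le> L * (norm (x - z))\<^sup>2"
      using L(2)[OF b(1,3)] by (simp add: norm_minus_commute)
    ultimately have "\<bar>(f y - f x) - (f x - f z)\<bar> \<le> L * (norm (y - x))\<^sup>2 + L * (norm (x - z))\<^sup>2 + ?D * norm ?h"
      by linarith
    also have "\<dots> \<le> (L + ?D) * ((norm (y - x))\<^sup>2 + (norm (x - z))\<^sup>2 + norm ?h)"
    proof -
      have "0 \<le> L * norm ?h + ?D * ((norm (y - x))\<^sup>2 + (norm (x - z))\<^sup>2)"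
        using L(1) D0 by (intro add_nonneg_nonneg mult_nonneg_nonneg) auto
      then show ?thesis by (simp add: algebra_simps)
    qed
    finally show ?thesis .
  qed
  then show ?thesis using that[of "L + ?D"] L D0 by simp
qed

section \<open>The nonlinearity on Fourier coefficients\<close>

definition nlc :: "(real \<Rightarrow> real) \<Rightarrow> (real \<times> real \<Rightarrow> real) \<Rightarrow> (int \<Rightarrow> complex) \<Rightarrow> int \<Rightarrow> complex" where
  "nlc a g c = fourier_coeff (nonlin a g (trig c))"

lemma dcoef_diff: "dcoef (\<lambda>j. c j - d j) = (\<lambda>j. dcoef c j - dcoef d j)"
  by (simp add: dcoef_def fun_eq_iff algebra_simps)

lemma nonlin_continuous:
  assumes "smooth a" "smooth g" "sob 3 B c"
  shows "continuous_on S (nonlin a g (trig c))"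
proof -
  obtain C where "reg 0 C (nonlin a g (trig c))"
    using nonlin_reg[OF assms(1,2), of B 0] assms(3) by (auto simp del: reg.simps)
  then show ?thesis by (rule reg_continuous)
qed

lemma trig_values_bound:
  assumes "sob 3 B c"
  shows "\<bar>trig c x\<bar> \<le> 2 * B" "\<bar>trig (dcoef c) x\<bar> \<le> 2 * B" "\<bar>trig (dcoef (dcoef c)) x\<bar> \<le> 2 * B"
    "asum c" "asum (dcoef c)" "asum (dcoef (dcoef c))"
proof -
  have c: "sob (Suc (Suc (Suc 0))) B c"
    using assms by (simp add: numeral_3_eq_3)
  note 1 = ell2_asum[OF c] and 2 = ell2_asum[OF ell2_dcoef[OF c]]
    and 3 = ell2_asum[OF ell2_dcoef[OF ell2_dcoef[OF c]]]
  show "\<bar>trig c x\<bar> \<le> 2 * B" by (rule 1(2))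
  show "\<bar>trig (dcoef c) x\<bar> \<le> 2 * B" by (rule 2(2))
  show "\<bar>trig (dcoef (dcoef c)) x\<bar> \<le> 2 * B" by (rule 3(2))
  show "asum c" by (rule 1(1))
  show "asum (dcoef c)" by (rule 2(1))
  show "asum (dcoef (dcoef c))" by (rule 3(1))
qed

lemma trig_values_bound':
  assumes "sob 2 B c"
  shows "\<bar>trig c x\<bar> \<le> 2 * B" "\<bar>trig (dcoef c) x\<bar> \<le> 2 * B" "ell2 B (dcoef (dcoef c))"
proof -
  have c: "sob (Suc (Suc 0)) B c"
    using assms by (simp add: numeral_2_eq_2)
  show "\<bar>trig c x\<bar> \<le> 2 * B" by (rule ell2_asum(2)[OF c])
  show "\<bar>trig (dcoef c) x\<bar> \<le> 2 * B" by (rule ell2_asum(2)[OF ell2_dcoef[OF c]])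
  show "ell2 B (dcoef (dcoef c))" using ell2_dcoef[OF ell2_dcoef[OF c]] by (simp add: ell2_def)
qed

text \<open>Asymmetric on purpose: \<open>c\<close> has the quantitative bound \<open>B\<close> only
  in H^2, and its H^3 bound \<open>C\<close> does not affect \<open>L\<close>; the undifferenced
  second derivative is that of \<open>d\<close>. This closes the stability estimate in H^2 x H^1 for
  a quasilinear nonlinearity.\<close>

definition nlc_lip :: "(real \<Rightarrow> real) \<Rightarrow> (real \<times> real \<Rightarrow> real) \<Rightarrow> real \<Rightarrow> real \<Rightarrow> bool" where
  "nlc_lip a g B L \<longleftrightarrow> 0 \<le> L \<and> (\<forall>c d E C. sob 2 B c \<longrightarrow> sob 3 C c \<longrightarrow>
     sob 3 B d \<longrightarrow> ell2 E (\<lambda>j. japanese j ^ 2 *\<^sub>R (c j - d j)) \<longrightarrow>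
     ell2 (L * E) (\<lambda>j. nlc a g c j - nlc a g d j))"

lemma nlc_lipD:
  assumes "nlc_lip a g B L" "sob 2 B c" "sob 3 C c"
    "sob 3 B d" "ell2 E (\<lambda>j. japanese j ^ 2 *\<^sub>R (c j - d j))"
  shows "ell2 (L * E) (\<lambda>j. nlc a g c j - nlc a g d j)"
  using assms unfolding nlc_lip_def by blast

text \<open>Function and first derivative differ by at most 2E each in the sup norm, the second
  derivatives by E in L2; \<open>fourier_coeff_dominated\<close> turns this into 2LE + 2L(4E) =
  10LE.\<close>

lemma nlc_lipschitz:
  assumes a: "smooth a" and g: "smooth g"
  obtains L where "nlc_lip a g B L"
proof -
  obtain L where L: "L \<ge> 0" "\<And>u q p u' q' p'. \<bar>u\<bar> \<le> 2 * B \<Longrightarrow> \<bar>q\<bar> \<le> 2 * B \<Longrightarrow> \<bar>u'\<bar> \<le> 2 * B \<Longrightarrow>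
      \<bar>q'\<bar> \<le> 2 * B \<Longrightarrow> \<bar>p'\<bar> \<le> 2 * B \<Longrightarrow>
      \<bar>(a u * p + g (u, q)) - (a u' * p' + g (u', q'))\<bar> \<le> L * (\<bar>u - u'\<bar> + \<bar>q - q'\<bar> + \<bar>p - p'\<bar>)"
    using nonlin_pointwise_lipschitz[OF a g, where B = "2 * B"] by blast
  have main: "ell2 (10 * L * E) (\<lambda>j. nlc a g c j - nlc a g d j)"
    if c2: "sob 2 B c" and c3: "sob 3 C c"
      and d: "sob 3 B d" and e: "ell2 E (\<lambda>j. japanese j ^ 2 *\<^sub>R (c j - d j))"
    for c d E C
  proof -
    let ?e = "dcoef (dcoef (\<lambda>j. c j - d j))"
    let ?v = "\<lambda>x. nonlin a g (trig c) x - nonlin a g (trig d) x"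
    have E: "0 \<le> E" using ell2_nonneg[OF e] .
    note as = trig_values_bound(4-6)[OF c3] trig_values_bound(4-6)[OF d]
    have "ell2 (C + B) (\<lambda>j. japanese j ^ 3 *\<^sub>R (c j - d j))"
      using ell2_diff[OF c3 d] by (simp add: scaleR_diff_right)
    then have ase: "asum ?e" by (rule trig_values_bound(6))
    have cont: "continuous_on S (nonlin a g (trig c))" "continuous_on S (nonlin a g (trig d))" for S
      by (rule nonlin_continuous[OF a g c3], rule nonlin_continuous[OF a g d])
    have "ell2 (2 * L * E + 2 * (L * (4 * E))) (fourier_coeff ?v)"
    proof (rule fourier_coeff_dominated[OF _ trig_values_bound'(3)[OF e] ase L(1)])
      show "continuous_on {0..2 * pi} ?v" by (intro continuous_intros cont)
      show "0 \<le> L * (4 * E)" using L E by simp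
      fix x
      have "\<bar>?v x\<bar> \<le> L * (\<bar>trig c x - trig d x\<bar> + \<bar>trig (dcoef c) x - trig (dcoef d) x\<bar>
          + \<bar>trig (dcoef (dcoef c)) x - trig (dcoef (dcoef d)) x\<bar>)"
        unfolding nonlin_trig[OF c3] nonlin_trig[OF d]
        by (intro L trig_values_bound'(1,2)[OF c2] trig_values_bound(1-3)[OF d])
      also have "\<dots> = L * (\<bar>trig (\<lambda>j. c j - d j) x\<bar> + \<bar>trig (dcoef (\<lambda>j. c j - d j)) x\<bar> + \<bar>trig ?e x\<bar>)"
        by (simp add: dcoef_diff trig_diff as)
      also have "\<dots> \<le> L * (2 * E + 2 * E + \<bar>trig ?e x\<bar>)"
        by (intro mult_left_mono add_mono trig_values_bound'[OF e] L) simp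
      also have "\<dots> = L * \<bar>trig ?e x\<bar> + L * (4 * E)" by (simp add: algebra_simps)
      finally show "\<bar>?v x\<bar> \<le> L * \<bar>trig ?e x\<bar> + L * (4 * E)" .
    qed
    moreover have "fourier_coeff ?v = (\<lambda>j. nlc a g c j - nlc a g d j)"
      unfolding nlc_def by (rule ext) (intro fourier_coeff_diff coeff_integrable_continuous cont)
    ultimately show ?thesis by (simp add: algebra_simps)
  qed
  show ?thesis
    by (rule that[of "10 * L"]) (use L main in \<open>auto simp: nlc_lip_def simp del: norm_scaleR\<close>)
qed

text \<open>A bound uniform in x, which needs the difference in H^3. It provides the Lipschitz
  continuity in time of \<open>utt\<close> on which the differentiation of the coefficients of
  \<open>ut\<close> rests.\<close>

lemma nonlin_sup_lipschitz:
  assumes a: "smooth a" and g: "smooth g"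
  obtains L where "L \<ge> 0" "\<And>c d E x. sob 3 B c \<Longrightarrow>
    sob 3 B d \<Longrightarrow> ell2 E (\<lambda>j. japanese j ^ 3 *\<^sub>R (c j - d j)) \<Longrightarrow>
    \<bar>nonlin a g (trig c) x - nonlin a g (trig d) x\<bar> \<le> L * E"
proof -
  obtain L where L: "L \<ge> 0" "\<And>u q p u' q' p'. \<bar>u\<bar> \<le> 2 * B \<Longrightarrow> \<bar>q\<bar> \<le> 2 * B \<Longrightarrow> \<bar>u'\<bar> \<le> 2 * B \<Longrightarrow>
      \<bar>q'\<bar> \<le> 2 * B \<Longrightarrow> \<bar>p'\<bar> \<le> 2 * B \<Longrightarrow>
      \<bar>(a u * p + g (u, q)) - (a u' * p' + g (u', q'))\<bar> \<le> L * (\<bar>u - u'\<bar> + \<bar>q - q'\<bar> + \<bar>p - p'\<bar>)"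
    using nonlin_pointwise_lipschitz[OF a g, where B = "2 * B"] by blast
  have main: "\<bar>nonlin a g (trig c) x - nonlin a g (trig d) x\<bar> \<le> 6 * L * E"
    if c: "sob 3 B c"
      and d: "sob 3 B d" and e: "ell2 E (\<lambda>j. japanese j ^ 3 *\<^sub>R (c j - d j))"
    for c d E x
  proof -
    note as = trig_values_bound(4-6)[OF c] trig_values_bound(4-6)[OF d]
    have "\<bar>nonlin a g (trig c) x - nonlin a g (trig d) x\<bar>
        \<le> L * (\<bar>trig c x - trig d x\<bar> + \<bar>trig (dcoef c) x - trig (dcoef d) x\<bar>
          + \<bar>trig (dcoef (dcoef c)) x - trig (dcoef (dcoef d)) x\<bar>)"
      unfolding nonlin_trig[OF c] nonlin_trig[OF d]
      by (intro L trig_values_bound(1,2)[OF c] trig_values_bound(1-3)[OF d])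
    also have "\<dots> = L * (\<bar>trig (\<lambda>j. c j - d j) x\<bar> + \<bar>trig (dcoef (\<lambda>j. c j - d j)) x\<bar>
          + \<bar>trig (dcoef (dcoef (\<lambda>j. c j - d j))) x\<bar>)"
      by (simp add: dcoef_diff trig_diff as)
    also have "\<dots> \<le> L * (2 * E + 2 * E + 2 * E)"
      by (intro mult_left_mono add_mono trig_values_bound[OF e] L)
    finally show ?thesis by (simp add: algebra_simps)
  qed
  show ?thesis
  proof (rule that[of "6 * L"])
    show "0 \<le> 6 * L" using L by simp
  qed (rule main)
qed

lemma asum_diff: "asum c \<Longrightarrow> asum d \<Longrightarrow> asum (\<lambda>j. c j - d j)"
  using asum_add[of c "\<lambda>j. - d j"] by simp

lemma trig_second_difference:
  assumes "asum c0" "asum c1" "asum c2"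
  shows "trig (\<lambda>j. (c1 j - c0 j) - (c0 j - c2 j)) x = (trig c1 x - trig c0 x) - (trig c0 x - trig c2 x)"
  by (subst trig_diff trig_diff[OF assms(2,1)] trig_diff[OF assms(1,3)], (intro asum_diff assms)+)+ (rule refl)

text \<open>Only the second difference of the second derivatives has to be taken in L2, with the
  bounded factor a(u); everything else is either a product of two first differences, of size E1^2 in
  the sup norm, or a lower-order second difference of size E2.\<close>

lemma nlc_second_difference:
  assumes a: "smooth a" and g: "smooth g"
  obtains L where "L \<ge> 0" "\<And>c0 c1 c2 E1 E2. sob 3 B c0 \<Longrightarrow>
    sob 3 B c1 \<Longrightarrow> sob 3 B c2 \<Longrightarrow>
    ell2 E1 (\<lambda>j. japanese j ^ 3 *\<^sub>R (c1 j - c0 j)) \<Longrightarrow> ell2 E1 (\<lambda>j. japanese j ^ 3 *\<^sub>R (c0 j - c2 j)) \<Longrightarrow>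
    ell2 E2 (\<lambda>j. japanese j ^ 2 *\<^sub>R ((c1 j - c0 j) - (c0 j - c2 j))) \<Longrightarrow>
    ell2 (L * (E1\<^sup>2 + E2)) (\<lambda>j. (nlc a g c1 j - nlc a g c0 j) - (nlc a g c0 j - nlc a g c2 j))"
proof -
  obtain A where A: "A \<ge> 0" "\<And>x. norm x \<le> 2 * B \<Longrightarrow> \<bar>a x\<bar> \<le> A" using smooth_bounded[OF a] by metis
  obtain LA where LA: "LA \<ge> 0" "\<And>x y. norm x \<le> 2 * B \<Longrightarrow> norm y \<le> 2 * B \<Longrightarrow> \<bar>a x - a y\<bar> \<le> LA * norm (x - y)"
    using smooth_lipschitz[OF a] by metis
  obtain La where La: "La \<ge> 0" "\<And>x y z. norm x \<le> 2 * B \<Longrightarrow> norm y \<le> 2 * B \<Longrightarrow> norm z \<le> 2 * B \<Longrightarrow>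
    \<bar>(a y - a x) - (a x - a z)\<bar> \<le> La * ((norm (y - x))\<^sup>2 + (norm (x - z))\<^sup>2 + norm ((y - x) - (x - z)))"
    using smooth_second_difference[OF a] by metis
  obtain Lg where Lg: "Lg \<ge> 0" "\<And>x y z. norm x \<le> 4 * B \<Longrightarrow> norm y \<le> 4 * B \<Longrightarrow> norm z \<le> 4 * B \<Longrightarrow>
    \<bar>(g y - g x) - (g x - g z)\<bar> \<le> Lg * ((norm (y - x))\<^sup>2 + (norm (x - z))\<^sup>2 + norm ((y - x) - (x - z)))"
    using smooth_second_difference[OF g] by metis
  \<comment> \<open>Chosen so that the coefficients of E1^2 match the sum of the bounds below
    exactly; the coefficients of E2 then have room to spare.\<close>
  define K1 where "K1 = 2 * \<bar>B\<bar> * La * 8 + 8 * LA + 32 * Lg"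
  have K1: "0 \<le> K1" using La LA Lg by (simp add: K1_def)
  have main: "ell2 ((2 * A + 2 * K1) * (E1\<^sup>2 + E2)) (\<lambda>j. (nlc a g c1 j - nlc a g c0 j) - (nlc a g c0 j - nlc a g c2 j))"
    if c0: "sob 3 B c0" and c1: "sob 3 B c1"
      and c2: "sob 3 B c2"
      and e1: "ell2 E1 (\<lambda>j. japanese j ^ 3 *\<^sub>R (c1 j - c0 j))" and e2: "ell2 E1 (\<lambda>j. japanese j ^ 3 *\<^sub>R (c0 j - c2 j))"
      and e: "ell2 E2 (\<lambda>j. japanese j ^ 2 *\<^sub>R ((c1 j - c0 j) - (c0 j - c2 j)))"
    for c0 c1 c2 E1 E2
  proof -
    let ?e = "dcoef (dcoef (\<lambda>j. (c1 j - c0 j) - (c0 j - c2 j)))"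
    let ?N = "\<lambda>c. nonlin a g (trig c)"
    let ?v = "\<lambda>x. (?N c1 x - ?N c0 x) - (?N c0 x - ?N c2 x)"
    have B: "0 \<le> B" and E1: "0 \<le> E1" and E2: "0 \<le> E2"
      using ell2_nonneg[OF c0] ell2_nonneg[OF e1] ell2_nonneg[OF e] by auto
    note as = trig_values_bound(4-6)[OF c0] trig_values_bound(4-6)[OF c1] trig_values_bound(4-6)[OF c2]
      trig_values_bound(4-6)[OF e1] trig_values_bound(4-6)[OF e2]
    have "ell2 (E1 + E1) (\<lambda>j. japanese j ^ 3 *\<^sub>R ((c1 j - c0 j) - (c0 j - c2 j)))"
      using ell2_diff[OF e1 e2] by (simp only: scaleR_diff_right)
    then have ase: "asum ?e" by (rule trig_values_bound(6))
    have cont: "continuous_on S (?N c0)" "continuous_on S (?N c1)" "continuous_on S (?N c2)" for S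
      by (rule nonlin_continuous[OF a g c0], rule nonlin_continuous[OF a g c1], rule nonlin_continuous[OF a g c2])
    have "ell2 (2 * A * E2 + 2 * (K1 * (E1\<^sup>2 + E2))) (fourier_coeff ?v)"
    proof (rule fourier_coeff_dominated[OF _ trig_values_bound'(3)[OF e] ase A(1)])
      show "continuous_on {0..2 * pi} ?v" by (intro continuous_intros cont)
      show "0 \<le> K1 * (E1\<^sup>2 + E2)" using K1 E2 by simp
      fix x
      define u where "u c = trig c x" for c
      define q where "q c = trig (dcoef c) x" for c
      define p where "p c = trig (dcoef (dcoef c)) x" for c
      have b: "\<bar>u c\<bar> \<le> 2 * B" "\<bar>q c\<bar> \<le> 2 * B" "\<bar>p c\<bar> \<le> 2 * B" "norm (u c, q c) \<le> 4 * B" if "c \<in> {c0, c1, c2}" for c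
      proof -
        have c: "sob 3 B c" using that c0 c1 c2 by auto
        show *: "\<bar>u c\<bar> \<le> 2 * B" "\<bar>q c\<bar> \<le> 2 * B" "\<bar>p c\<bar> \<le> 2 * B"
          using trig_values_bound(1-3)[OF c] by (simp_all add: u_def q_def p_def)
        show "norm (u c, q c) \<le> 4 * B" using norm_pair_le[of "u c" "q c"] * by linarith
      qed
      have d1: "\<bar>u c1 - u c0\<bar> \<le> 2 * E1" "\<bar>q c1 - q c0\<bar> \<le> 2 * E1" "\<bar>p c1 - p c0\<bar> \<le> 2 * E1"
        using trig_values_bound(1-3)[OF e1, of x] by (simp_all add: u_def q_def p_def dcoef_diff trig_diff as)
      have d2: "\<bar>u c0 - u c2\<bar> \<le> 2 * E1" "\<bar>q c0 - q c2\<bar> \<le> 2 * E1" "\<bar>p c0 - p c2\<bar> \<le> 2 * E1"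
        using trig_values_bound(1-3)[OF e2, of x] by (simp_all add: u_def q_def p_def dcoef_diff trig_diff as)
      have s: "\<bar>(u c1 - u c0) - (u c0 - u c2)\<bar> \<le> 2 * E2" "\<bar>(q c1 - q c0) - (q c0 - q c2)\<bar> \<le> 2 * E2"
         "trig ?e x = (p c1 - p c0) - (p c0 - p c2)"
        using trig_values_bound'(1,2)[OF e, of x] unfolding u_def q_def p_def dcoef_diff
        by (simp_all only: trig_second_difference as)
      have sq: "(norm z)\<^sup>2 \<le> 16 * E1\<^sup>2" if "norm z \<le> 4 * E1" for z :: "real \<times> real"
        using power_mono[OF that norm_ge_zero, of 2] by (simp add: power_mult_distrib)
      have sq': "(norm z)\<^sup>2 \<le> 4 * E1\<^sup>2" if "norm z \<le> 2 * E1" for z :: real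
        using power_mono[OF that norm_ge_zero, of 2] by (simp add: power_mult_distrib)
      have 1: "\<bar>(a (u c1) - a (u c0)) - (a (u c0) - a (u c2))\<bar> \<le> La * (4 * E1\<^sup>2 + 4 * E1\<^sup>2 + 2 * E2)"
      proof (rule order_trans[OF La(2)])
        show "La * ((norm (u c1 - u c0))\<^sup>2 + (norm (u c0 - u c2))\<^sup>2 + norm ((u c1 - u c0) - (u c0 - u c2)))
            \<le> La * (4 * E1\<^sup>2 + 4 * E1\<^sup>2 + 2 * E2)"
          by (intro mult_left_mono add_mono sq' La(1)) (simp_all only: real_norm_def d1 d2 s)
      qed (simp_all add: b)
      have 2: "\<bar>(g (u c1, q c1) - g (u c0, q c0)) - (g (u c0, q c0) - g (u c2, q c2))\<bar>
          \<le> Lg * (16 * E1\<^sup>2 + 16 * E1\<^sup>2 + 4 * E2)"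
      proof (rule order_trans[OF Lg(2)])
        have "norm ((u c1, q c1) - (u c0, q c0)) \<le> 4 * E1"
          using norm_pair_le[of "u c1 - u c0" "q c1 - q c0"] d1 by (simp del: norm_Pair)
        moreover have "norm ((u c0, q c0) - (u c2, q c2)) \<le> 4 * E1"
          using norm_pair_le[of "u c0 - u c2" "q c0 - q c2"] d2 by (simp del: norm_Pair)
        moreover have "norm ((u c1, q c1) - (u c0, q c0) - ((u c0, q c0) - (u c2, q c2))) \<le> 4 * E2"
          using norm_pair_le[of "(u c1 - u c0) - (u c0 - u c2)" "(q c1 - q c0) - (q c0 - q c2)"] s(1,2) by (simp del: norm_Pair)
        ultimately show "Lg * ((norm ((u c1, q c1) - (u c0, q c0)))\<^sup>2 + (norm ((u c0, q c0) - (u c2, q c2)))\<^sup>2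
            + norm ((u c1, q c1) - (u c0, q c0) - ((u c0, q c0) - (u c2, q c2)))) \<le> Lg * (16 * E1\<^sup>2 + 16 * E1\<^sup>2 + 4 * E2)"
          by (intro mult_left_mono add_mono sq Lg(1))
      qed (simp_all add: b)
      have 3: "\<bar>(a (u c1) - a (u c0)) * (p c1 - p c0)\<bar> \<le> (LA * (2 * E1)) * (2 * E1)"
        unfolding abs_mult
      proof (intro mult_mono d1)
        have "\<bar>a (u c1) - a (u c0)\<bar> \<le> LA * norm (u c1 - u c0)" by (rule LA(2)) (use b in auto)
        also have "\<dots> \<le> LA * (2 * E1)" using d1 LA(1) by (intro mult_left_mono) auto
        finally show "\<bar>a (u c1) - a (u c0)\<bar> \<le> LA * (2 * E1)" .
      qed (use LA E1 in auto)
      have 4: "\<bar>(a (u c0) - a (u c2)) * (p c0 - p c2)\<bar> \<le> (LA * (2 * E1)) * (2 * E1)"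
        unfolding abs_mult
      proof (intro mult_mono d2)
        have "\<bar>a (u c0) - a (u c2)\<bar> \<le> LA * norm (u c0 - u c2)" by (rule LA(2)) (use b in auto)
        also have "\<dots> \<le> LA * (2 * E1)" using d2 LA(1) by (intro mult_left_mono) auto
        finally show "\<bar>a (u c0) - a (u c2)\<bar> \<le> LA * (2 * E1)" .
      qed (use LA E1 in auto)
      have 5: "\<bar>a (u c0) * trig ?e x\<bar> \<le> A * \<bar>trig ?e x\<bar>"
        unfolding abs_mult using A(2)[of "u c0"] b(1)[of c0] by (intro mult_right_mono) auto
      have 6: "\<bar>p c0 * ((a (u c1) - a (u c0)) - (a (u c0) - a (u c2)))\<bar> \<le> (2 * B) * (La * (4 * E1\<^sup>2 + 4 * E1\<^sup>2 + 2 * E2))"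
        unfolding abs_mult using 1 b(3)[of c0] B by (intro mult_mono) auto
      \<comment> \<open>Discrete Leibniz rule for the second difference of a(u)p about the middle
        value: two terms with second differences and two products of one-sided first
        differences.\<close>
      have "?v x = a (u c0) * trig ?e x + p c0 * ((a (u c1) - a (u c0)) - (a (u c0) - a (u c2)))
          + (a (u c1) - a (u c0)) * (p c1 - p c0) + (a (u c0) - a (u c2)) * (p c0 - p c2)
          + ((g (u c1, q c1) - g (u c0, q c0)) - (g (u c0, q c0) - g (u c2, q c2)))"
        unfolding nonlin_trig[OF c0] nonlin_trig[OF c1] nonlin_trig[OF c2] s(3)
        unfolding u_def q_def p_def
        by (simp add: algebra_simps)
      then have "\<bar>?v x\<bar> \<le> A * \<bar>trig ?e x\<bar> + (2 * B) * (La * (4 * E1\<^sup>2 + 4 * E1\<^sup>2 + 2 * E2))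
          + (LA * (2 * E1)) * (2 * E1) + (LA * (2 * E1)) * (2 * E1) + Lg * (16 * E1\<^sup>2 + 16 * E1\<^sup>2 + 4 * E2)"
        using 2 3 4 5 6 by linarith
      also have "\<dots> \<le> A * \<bar>trig ?e x\<bar> + K1 * (E1\<^sup>2 + E2)"
      proof -
        have "K1 * (E1\<^sup>2 + E2) - ((2 * B) * (La * (4 * E1\<^sup>2 + 4 * E1\<^sup>2 + 2 * E2))
          + (LA * (2 * E1)) * (2 * E1) + (LA * (2 * E1)) * (2 * E1) + Lg * (16 * E1\<^sup>2 + 16 * E1\<^sup>2 + 4 * E2))
           = 12 * (B * La * E2) + 8 * (LA * E2) + 28 * (Lg * E2)"
          using B by (simp add: K1_def power2_eq_square algebra_simps)
        moreover have "0 \<le> \<dots>" using B La LA Lg E2 by simp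
        ultimately show ?thesis by linarith
      qed
      finally show "\<bar>?v x\<bar> \<le> A * \<bar>trig ?e x\<bar> + K1 * (E1\<^sup>2 + E2)" .
    qed
    moreover have "fourier_coeff ?v = (\<lambda>j. (nlc a g c1 j - nlc a g c0 j) - (nlc a g c0 j - nlc a g c2 j))"
      unfolding nlc_def
      by (rule ext, (subst fourier_coeff_diff fourier_coeff_diff[of "?N c1" "?N c0"] fourier_coeff_diff[of "?N c0" "?N c2"],
          (intro coeff_integrable_continuous continuous_intros cont)+)+, rule refl)
    ultimately have "ell2 (2 * A * E2 + 2 * (K1 * (E1\<^sup>2 + E2)))
       (\<lambda>j. (nlc a g c1 j - nlc a g c0 j) - (nlc a g c0 j - nlc a g c2 j))" by simp
    then show ?thesis
    proof (rule ell2_mono)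
      have "0 \<le> 2 * A * E1\<^sup>2" using A by simp
      then show "2 * A * E2 + 2 * (K1 * (E1\<^sup>2 + E2)) \<le> (2 * A + 2 * K1) * (E1\<^sup>2 + E2)"
        by (simp add: algebra_simps)
    qed simp
  qed
  show ?thesis
  proof (rule that[of "2 * A + 2 * K1"])
    show "0 \<le> 2 * A + 2 * K1" using A(1) K1 by simp
  qed (rule main)
qed

section \<open>Fourier coefficients of the exact solution\<close>

lemma japanese_powr: "japanese j powr (2 * real k) * (cmod z)\<^sup>2 = (norm (japanese j ^ k *\<^sub>R z))\<^sup>2"
proof -
  have "japanese j powr (2 * real k) = japanese j ^ (2 * k)"
    using powr_realpow[of "japanese j" "2 * k"] by simp
  also have "\<dots> = (japanese j ^ k)\<^sup>2" by (simp add: power_mult[symmetric] mult.commute)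
  finally show ?thesis by (simp add: power_mult_distrib)
qed

lemma sobolev_ell2:
  assumes "in_sobolev (real k) v" "sobolev_norm (real k) v \<le> M"
  shows "sob k M (fourier_coeff v)"
proof -
  let ?S = "\<Sum>\<^sub>\<infinity>j. (norm (japanese j ^ k *\<^sub>R fourier_coeff v j))\<^sup>2"
  have "0 \<le> ?S" by (rule infsum_nonneg) simp
  moreover have "sqrt ?S \<le> M"
    using assms(2) by (simp only: sobolev_norm_def japanese_powr)
  ultimately have "0 \<le> M" "?S \<le> M\<^sup>2" by (auto simp: sqrt_le_D intro: order_trans[OF real_sqrt_ge_zero])
  moreover have "(\<lambda>j. (norm (japanese j ^ k *\<^sub>R fourier_coeff v j))\<^sup>2) summable_on UNIV"
    using assms(1) by (simp only: in_sobolev_def japanese_powr)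
  ultimately show ?thesis by (simp only: ell2_iff_summable)
qed

lemma in_sobolev_ell2:
  assumes "periodic_L2 v" "sob k M (fourier_coeff v)"
  shows "in_sobolev (real k) v"
  using assms by (simp only: in_sobolev_def japanese_powr ell2_iff_summable)

lemma energy_ell2:
  assumes "in_energy_space (real k) u v" "energy_norm (real k) u v \<le> M"
  shows "sob (Suc k) M (fourier_coeff u)"
    "sob k M (fourier_coeff v)"
proof -
  have nn: "0 \<le> sobolev_norm s w" for s w
    unfolding sobolev_norm_def by (intro real_sqrt_ge_zero infsum_nonneg) simp
  have k: "real k + 1 = real (Suc k)" by simp
  have "sobolev_norm (real (Suc k)) u \<le> M"
    using assms(2) real_sqrt_ge_abs1[of "sobolev_norm (real (Suc k)) u" "sobolev_norm (real k) v"] nn[of "real (Suc k)" u]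
    unfolding energy_norm_def k by linarith
  moreover have "sobolev_norm (real k) v \<le> M"
    using assms(2) real_sqrt_ge_abs2[of "sobolev_norm (real k) v" "sobolev_norm (real (Suc k)) u"] nn[of "real k" v]
    unfolding energy_norm_def k by linarith
  ultimately show "sob (Suc k) M (fourier_coeff u)"
    "sob k M (fourier_coeff v)"
    using assms(1) unfolding in_energy_space_def k by (blast intro: sobolev_ell2)+
qed

lemma norm_fourier_coeff_le:
  assumes w: "coeff_integrable w" and K: "\<And>x. \<bar>w x\<bar> \<le> K"
  shows "norm (fourier_coeff w j) \<le> K"
proof -
  have "norm (integral {0..2 * pi} (\<lambda>x. complex_of_real (w x) * cis (- (real_of_int j * x))))
      \<le> integral {0..2 * pi} (\<lambda>x. K)"
    using w K by (intro integral_norm_bound_integral) (auto simp: coeff_integrable_def norm_mult)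
  then show ?thesis by (simp add: fourier_coeff_def field_simps)
qed

lemma coeff_integrable_diff:
  "coeff_integrable v \<Longrightarrow> coeff_integrable w \<Longrightarrow> coeff_integrable (\<lambda>x. v x - w x)"
  unfolding coeff_integrable_def by (auto simp: left_diff_distrib intro!: integrable_diff)

lemma coeff_integrable_scale:
  "coeff_integrable v \<Longrightarrow> coeff_integrable (\<lambda>x. r * v x)"
  unfolding coeff_integrable_def by (auto simp: mult.assoc intro!: integrable_on_mult_right)

text \<open>Replaces differentiation under the integral sign: a Taylor remainder O((s - t)^2)
  uniform in x passes to every Fourier coefficient and determines its derivative.\<close>

lemma has_vector_derivative_quadratic:
  fixes f :: "real \<Rightarrow> 'a::real_normed_vector"
  assumes "\<And>s. s \<in> S \<Longrightarrow> norm (f s - f t - (s - t) *\<^sub>R D) \<le> K * (s - t)\<^sup>2"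
  shows "(f has_vector_derivative D) (at t within S)"
  unfolding has_vector_derivative_def has_derivative_within
proof (intro conjI bounded_linear_scaleR_left)
  have "((\<lambda>y. K * \<bar>y - t\<bar>) \<longlongrightarrow> K * \<bar>t - t\<bar>) (at t within S)" by (intro tendsto_intros)
  then have "((\<lambda>y. K * \<bar>y - t\<bar>) \<longlongrightarrow> 0) (at t within S)" by simp
  then show "((\<lambda>y. (1 / norm (y - t)) *\<^sub>R (f y - (f t + (y - t) *\<^sub>R D))) \<longlongrightarrow> 0) (at t within S)"
  proof (rule Lim_null_comparison[rotated])
    show "\<forall>\<^sub>F y in at t within S. norm ((1 / norm (y - t)) *\<^sub>R (f y - (f t + (y - t) *\<^sub>R D))) \<le> K * \<bar>y - t\<bar>"
      unfolding eventually_at_filter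
    proof (rule always_eventually, intro allI impI)
      fix y assume y: "y \<noteq> t" "y \<in> S"
      have "norm (f y - (f t + (y - t) *\<^sub>R D)) \<le> K * \<bar>y - t\<bar> * \<bar>y - t\<bar>"
        using assms[OF y(2)] by (simp add: diff_diff_eq power2_eq_square mult.assoc abs_mult_self_eq)
      then show "norm ((1 / norm (y - t)) *\<^sub>R (f y - (f t + (y - t) *\<^sub>R D))) \<le> K * \<bar>y - t\<bar>"
        using y by (simp add: divide_simps)
    qed
  qed
qed

lemma vector_derivative_shift:
  fixes f :: "real \<Rightarrow> 'a::real_normed_vector"
  assumes "(f has_vector_derivative D) (at (m + r) within S)" "\<And>r. r \<in> R \<Longrightarrow> m + r \<in> S"
  shows "((\<lambda>r. f (m + r)) has_vector_derivative D) (at r within R)"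
proof -
  have "((\<lambda>r. m + r) has_vector_derivative 1) (at r within R)"
    by (auto intro!: derivative_eq_intros)
  moreover have "(f has_vector_derivative D) (at (m + r) within (\<lambda>r. m + r) ` R)"
    by (rule has_vector_derivative_within_subset[OF assms(1)]) (intro image_subsetI assms(2))
  ultimately show ?thesis by (auto dest!: vector_diff_chain_within simp: o_def)
qed

lemma vector_derivative_reflect:
  fixes f :: "real \<Rightarrow> 'a::real_normed_vector"
  assumes "(f has_vector_derivative D) (at (m - r) within S)" "\<And>r. r \<in> R \<Longrightarrow> m - r \<in> S"
  shows "((\<lambda>r. f (m - r)) has_vector_derivative - D) (at r within R)"
proof -
  have "((\<lambda>r. m - r) has_vector_derivative -1) (at r within R)"
    by (auto intro!: derivative_eq_intros)
  moreover have "(f has_vector_derivative D) (at (m - r) within (\<lambda>r. m - r) ` R)"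
    by (rule has_vector_derivative_within_subset[OF assms(1)]) (intro image_subsetI assms(2))
  ultimately show ?thesis by (auto dest!: vector_diff_chain_within simp: o_def)
qed

lemma taylor_remainder:
  fixes f :: "real \<Rightarrow> real"
  assumes f: "\<And>r. r \<in> {0..T} \<Longrightarrow> (f has_real_derivative f' r) (at r within {0..T})"
    and lip: "\<And>r. r \<in> {0..T} \<Longrightarrow> \<bar>f' r - f' t\<bar> \<le> K * \<bar>r - t\<bar>" and K: "0 \<le> K"
    and st: "s \<in> {0..T}" "t \<in> {0..T}"
  shows "\<bar>f s - f t - (s - t) * f' t\<bar> \<le> K * (s - t)\<^sup>2"
proof -
  have sub: "closed_segment t s \<subseteq> {0..T}" using st by (intro closed_segment_subset) auto
  have "norm ((f s - s * f' t) - (f t - t * f' t)) \<le> (K * \<bar>s - t\<bar>) * norm (s - t)"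
  proof (rule field_differentiable_bound[of "closed_segment t s" "\<lambda>r. f r - r * f' t" "\<lambda>r. f' r - f' t"])
    fix r assume r: "r \<in> closed_segment t s"
    show "((\<lambda>r. f r - r * f' t) has_field_derivative f' r - f' t) (at r within closed_segment t s)"
      using DERIV_subset[OF f sub] r sub by (auto intro!: derivative_eq_intros)
    have "\<bar>f' r - f' t\<bar> \<le> K * \<bar>r - t\<bar>" using lip r sub by blast
    also have "\<dots> \<le> K * \<bar>s - t\<bar>" 
      using segment_bound1[OF r] K by (intro mult_left_mono) (auto simp: abs_minus_commute)
    finally show "norm (f' r - f' t) \<le> K * \<bar>s - t\<bar>" by simp
  qed auto
  then show ?thesis by (simp add: power2_eq_square algebra_simps)
qed

lemma hermitian_dcoef: "hermitian c \<Longrightarrow> hermitian (dcoef c)"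
  by (simp add: hermitian_def dcoef_def)

text \<open>The bound \<open>\<kappa> \<le> 1\<close> keeps the estimates of the forcing term
  uniform in \<open>\<kappa>\<close>.\<close>

locale quasilinear_wave =
  fixes a :: "real \<Rightarrow> real" and g :: "real \<times> real \<Rightarrow> real" and \<kappa> T M :: real
    and u0 v0 :: "real \<Rightarrow> real" and u ut :: "real \<Rightarrow> real \<Rightarrow> real"
  assumes smooth_a: "smooth a" and smooth_g: "smooth g" and \<kappa>: "0 < \<kappa>" "\<kappa> \<le> 1"
    and sol: "wave_solution \<kappa> a g T u0 v0 u ut"
    and energy: "\<And>t. t \<in> {0..T} \<Longrightarrow> in_energy_space 4 (u t) (ut t) \<and> energy_norm 4 (u t) (ut t) \<le> M"
begin

abbreviation "U t \<equiv> fourier_coeff (u t)"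
abbreviation "V t \<equiv> fourier_coeff (ut t)"
abbreviation "N t \<equiv> nlc a g (U t)"

lemma U_ell2: "t \<in> {0..T} \<Longrightarrow> sob 5 M (U t)"
  and V_ell2: "t \<in> {0..T} \<Longrightarrow> sob 4 M (V t)"
  using energy_ell2[of 4 "u t" "ut t" M] energy[of t] by simp_all

lemma U3: "t \<in> {0..T} \<Longrightarrow> sob 3 M (U t)"
  by (rule ell2_weight_mono[OF U_ell2]) auto

text \<open>Equality holds at every point, not just almost everywhere, so the classical derivatives
  in \<open>wave_solution\<close> can be read off from the series.\<close>

lemma u_eq_trig: assumes t: "t \<in> {0..T}" shows "u t = trig (U t)"
proof (rule fourier_inversion)
  show "u t differentiable (at x)" for x using sol t by (simp add: wave_solution_def)
  show "asum (U t)" by (rule trig_values_bound(4)[OF U3[OF t]])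
  show "u t (x + 2 * pi) = u t x" for x using sol t by (simp add: wave_solution_def)
qed

lemma coeff_integrable_u: "t \<in> {0..T} \<Longrightarrow> coeff_integrable (u t)"
  using u_eq_trig trig_continuous[OF trig_values_bound(4)[OF U3]] coeff_integrable_continuous by metis

lemma periodic_L2_ut: "t \<in> {0..T} \<Longrightarrow> periodic_L2 (ut t)"
  using energy[of t] by (simp add: in_energy_space_def in_sobolev_def)

lemma coeff_integrable_ut: "t \<in> {0..T} \<Longrightarrow> coeff_integrable (ut t)"
  by (intro coeff_integrable_L2 periodic_L2_ut)

definition utt :: "real \<Rightarrow> real \<Rightarrow> real" where
  "utt t x = trig (dcoef (dcoef (U t))) x - trig (U t) x + \<kappa> * nonlin a g (trig (U t)) x"

lemma u_deriv: "t \<in> {0..T} \<Longrightarrow> ((\<lambda>s. u s x) has_real_derivative ut t x) (at t within {0..T})"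
  using sol by (simp add: wave_solution_def)

lemma ut_deriv: assumes t: "t \<in> {0..T}"
  shows "((\<lambda>s. ut s x) has_real_derivative utt t x) (at t within {0..T})"
proof -
  have c: "sob (Suc (Suc (Suc 0))) M (U t)"
    using U3[OF t] by (simp add: numeral_3_eq_3)
  have "deriv (trig (U t)) = trig (dcoef (U t))"
    using trig_deriv_dcoef[OF c] by (auto intro!: DERIV_imp_deriv)
  moreover have "deriv (trig (dcoef (U t))) = trig (dcoef (dcoef (U t)))"
    using trig_deriv_dcoef[OF ell2_dcoef[OF c]] by (auto intro!: DERIV_imp_deriv)
  ultimately have d: "deriv (deriv (u t)) = trig (dcoef (dcoef (U t)))"
    using u_eq_trig[OF t] by simp
  have "((\<lambda>s. ut s x) has_real_derivative
      deriv (deriv (u t)) x - u t x + \<kappa> * a (u t x) * deriv (deriv (u t)) x + \<kappa> * g (u t x, deriv (u t) x))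
      (at t within {0..T})"
    using sol t by (simp add: wave_solution_def)
  moreover have "deriv (deriv (u t)) x - u t x + \<kappa> * a (u t x) * deriv (deriv (u t)) x + \<kappa> * g (u t x, deriv (u t) x)
     = deriv (deriv (u t)) x - u t x + \<kappa> * nonlin a g (u t) x"
    by (simp add: nonlin_def algebra_simps)
  ultimately show ?thesis unfolding d by (simp add: utt_def u_eq_trig[OF t, symmetric])
qed

lemma utt_bound: obtains B where "0 \<le> B" "\<And>t x. t \<in> {0..T} \<Longrightarrow> \<bar>utt t x\<bar> \<le> B"
proof -
  obtain C where C: "\<And>c. sob 3 M c \<Longrightarrow> reg 0 C (nonlin a g (trig c))"
    using nonlin_reg[OF smooth_a smooth_g, of M 0] by (auto simp del: reg.simps)
  have "\<bar>utt t x\<bar> \<le> 4 * \<bar>M\<bar> + \<bar>C\<bar>" if t: "t \<in> {0..T}" for t x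
  proof -
    have 1: "\<bar>nonlin a g (trig (U t)) x\<bar> \<le> C" by (rule reg_bound[OF C[OF U3[OF t]]])
    have "\<bar>\<kappa> * nonlin a g (trig (U t)) x\<bar> \<le> 1 * \<bar>C\<bar>"
      unfolding abs_mult using \<kappa> 1 by (intro mult_mono) auto
    then show ?thesis
      using trig_values_bound(1,3)[OF U3[OF t], of x] unfolding utt_def by linarith
  qed
  then show ?thesis using that[of "4 * \<bar>M\<bar> + \<bar>C\<bar>"] by simp
qed

text \<open>The second time derivative \<open>utt\<close> is bounded uniformly in t and x, which
  makes the Taylor remainder of \<open>u\<close> quadratic uniformly in x.\<close>

lemma U_deriv: assumes t: "t \<in> {0..T}"
  shows "((\<lambda>s. U s j) has_vector_derivative V t j) (at t within {0..T})"
proof -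
  obtain B where B: "0 \<le> B" "\<And>t x. t \<in> {0..T} \<Longrightarrow> \<bar>utt t x\<bar> \<le> B" using utt_bound by blast
  show ?thesis
  proof (rule has_vector_derivative_quadratic)
    fix s assume s: "s \<in> {0..T}"
    have le: "\<bar>(u s x - u t x) - (s - t) * ut t x\<bar> \<le> B * (s - t)\<^sup>2" for x
    proof (rule taylor_remainder[OF u_deriv _ B(1) s t])
      fix r assume r: "r \<in> {0..T}"
      show "\<bar>ut r x - ut t x\<bar> \<le> B * \<bar>r - t\<bar>"
        using field_differentiable_bound[of "{0..T}" "\<lambda>s. ut s x" "\<lambda>s. utt s x" B r t] ut_deriv B r t by simp
    qed
    have eq: "fourier_coeff (\<lambda>x. (u s x - u t x) - (s - t) * ut t x) j = U s j - U t j - (s - t) *\<^sub>R V t j"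
      using s t by (simp add: fourier_coeff_diff fourier_coeff_scale coeff_integrable_u coeff_integrable_ut
          coeff_integrable_diff coeff_integrable_scale scaleR_conv_of_real)
    show "norm (U s j - U t j - (s - t) *\<^sub>R V t j) \<le> B * (s - t)\<^sup>2"
      unfolding eq[symmetric] using s t
      by (intro norm_fourier_coeff_le le coeff_integrable_diff coeff_integrable_scale coeff_integrable_u coeff_integrable_ut)
  qed
qed

text \<open>Mean value inequality with the velocity, which is bounded in H^4; hence the restriction
  on the index.\<close>

lemma U_diff_ell2:
  assumes "k \<le> 4" and st: "s \<in> {0..T}" "t \<in> {0..T}"
  shows "ell2 (M * \<bar>s - t\<bar>) (\<lambda>j. japanese j ^ k *\<^sub>R (U s j - U t j))"
proof -
  have *: "ell2 (M * (s - t)) (\<lambda>j. japanese j ^ k *\<^sub>R U s j - japanese j ^ k *\<^sub>R U t j)"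
    if st: "s \<in> {0..T}" "t \<in> {0..T}" "t \<le> s" for s t
  proof (rule ell2_mvt[OF st(3), of "\<lambda>s j. japanese j ^ k *\<^sub>R U s j" "\<lambda>s j. japanese j ^ k *\<^sub>R V s j"])
    fix r assume r: "r \<in> {t..s}"
    then have r': "r \<in> {0..T}" using st by auto
    have "((\<lambda>s. U s j) has_vector_derivative V r j) (at r within {t..s})" for j
      using has_vector_derivative_within_subset[OF U_deriv[OF r'], of "{t..s}"] st by auto
    then show "((\<lambda>s. japanese j ^ k *\<^sub>R U s j) has_vector_derivative japanese j ^ k *\<^sub>R V r j) (at r within {t..s})" for j
      by (rule bounded_linear.has_vector_derivative[OF bounded_linear_scaleR_right])
    show "sob k M (V r)" by (rule ell2_weight_mono[OF V_ell2[OF r']]) fact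
  qed
  show ?thesis
  proof (cases "t \<le> s")
    case True
    then show ?thesis using *[OF st True] by (simp add: scaleR_diff_right)
  next
    case False
    then have "ell2 (M * (t - s)) (\<lambda>j. japanese j ^ k *\<^sub>R U t j - japanese j ^ k *\<^sub>R U s j)"
      by (intro * st) auto
    then have "ell2 (M * \<bar>s - t\<bar>) (\<lambda>j. japanese j ^ k *\<^sub>R U t j - japanese j ^ k *\<^sub>R U s j)"
      using False by simp
    then show ?thesis
      by (rule ell2_mono[OF _ order_refl]) (simp add: scaleR_diff_right[symmetric] norm_minus_commute)
  qed
qed

text \<open>Bootstraps on \<open>U_diff_ell2\<close>: \<open>U\<close> is Lipschitz in time with
  values in H^3, so \<open>utt\<close> is Lipschitz in time uniformly in x and the quadratic
  remainder is available for \<open>ut\<close>. The symbol (ij)^2 - 1 is -<j>^2.\<close>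

lemma V_deriv: assumes t: "t \<in> {0..T}"
  shows "((\<lambda>s. V s j) has_vector_derivative (- ((japanese j)\<^sup>2 *\<^sub>R U t j) + \<kappa> *\<^sub>R N t j)) (at t within {0..T})"
proof -
  obtain L where L: "L \<ge> 0" "\<And>c d E x. sob 3 M c \<Longrightarrow>
    sob 3 M d \<Longrightarrow> ell2 E (\<lambda>j. japanese j ^ 3 *\<^sub>R (c j - d j)) \<Longrightarrow>
    \<bar>nonlin a g (trig c) x - nonlin a g (trig d) x\<bar> \<le> L * E"
    using nonlin_sup_lipschitz[OF smooth_a smooth_g, of M] by blast
  have M: "0 \<le> M" using ell2_nonneg[OF U3[OF t]] .
  define K where "K = 4 * M + L * M"
  have K: "0 \<le> K" using L M by (simp add: K_def)
  have lip: "\<bar>utt r x - utt t x\<bar> \<le> K * \<bar>r - t\<bar>" if r: "r \<in> {0..T}" for r x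
  proof -
    have e: "ell2 (M * \<bar>r - t\<bar>) (\<lambda>j. japanese j ^ 3 *\<^sub>R (U r j - U t j))"
      by (rule U_diff_ell2) (use r t in auto)
    note as = trig_values_bound(4-6)[OF U3[OF r]] trig_values_bound(4-6)[OF U3[OF t]]
    have 1: "\<bar>trig (U r) x - trig (U t) x\<bar> \<le> 2 * (M * \<bar>r - t\<bar>)"
      using trig_values_bound(1)[OF e, of x] by (simp add: trig_diff as)
    have 2: "\<bar>trig (dcoef (dcoef (U r))) x - trig (dcoef (dcoef (U t))) x\<bar> \<le> 2 * (M * \<bar>r - t\<bar>)"
      using trig_values_bound(3)[OF e, of x] by (simp add: dcoef_diff trig_diff as)
    have 3: "\<bar>\<kappa> * (nonlin a g (trig (U r)) x - nonlin a g (trig (U t)) x)\<bar> \<le> 1 * (L * (M * \<bar>r - t\<bar>))"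
      unfolding abs_mult using \<kappa> by (intro mult_mono L(2) U3 r t e) auto
    have "utt r x - utt t x = (trig (dcoef (dcoef (U r))) x - trig (dcoef (dcoef (U t))) x)
       - (trig (U r) x - trig (U t) x) + \<kappa> * (nonlin a g (trig (U r)) x - nonlin a g (trig (U t)) x)"
      by (simp add: utt_def algebra_simps)
    then have "\<bar>utt r x - utt t x\<bar> \<le> 2 * (M * \<bar>r - t\<bar>) + 2 * (M * \<bar>r - t\<bar>) + 1 * (L * (M * \<bar>r - t\<bar>))"
      using 1 2 3 by linarith
    then show ?thesis by (simp add: K_def algebra_simps)
  qed
  note as = trig_values_bound(4-6)[OF U3[OF t]]
  have cont: "continuous_on S (trig (U t))" "continuous_on S (trig (dcoef (dcoef (U t))))"
     "continuous_on S (nonlin a g (trig (U t)))" for S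
    by (intro trig_continuous as nonlin_continuous[OF smooth_a smooth_g U3[OF t]])+
  have ci: "coeff_integrable (utt t)"
    unfolding utt_def[abs_def] by (intro coeff_integrable_continuous continuous_intros cont)
  have fc: "fourier_coeff (utt t) j = - ((japanese j)\<^sup>2 *\<^sub>R U t j) + \<kappa> *\<^sub>R N t j"
  proof -
    have "utt t = (\<lambda>x. trig (dcoef (dcoef (U t))) x - (trig (U t) x - \<kappa> * nonlin a g (trig (U t)) x))"
      by (simp add: utt_def fun_eq_iff)
    then have "fourier_coeff (utt t) j = fourier_coeff (trig (dcoef (dcoef (U t)))) j
        - (fourier_coeff (trig (U t)) j - of_real \<kappa> * fourier_coeff (nonlin a g (trig (U t))) j)"
      by (simp add: fourier_coeff_diff fourier_coeff_scale coeff_integrable_continuous cont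
          coeff_integrable_diff coeff_integrable_scale)
    also have "\<dots> = dcoef (dcoef (U t)) j - (U t j - of_real \<kappa> * N t j)"
      by (simp add: fourier_coeff_trig as hermitian_dcoef hermitian_fourier_coeff nlc_def)
    also have "\<dots> = - ((japanese j)\<^sup>2 *\<^sub>R U t j) + \<kappa> *\<^sub>R N t j"
    proof -
      have "complex_of_real ((japanese j)\<^sup>2) = of_int j * of_int j + 1"
        unfolding japanese_sq by (simp add: power2_eq_square)
      then show ?thesis by (simp add: dcoef_def scaleR_conv_of_real algebra_simps del: of_real_power)
    qed
    finally show ?thesis .
  qed
  show ?thesis
  proof (rule has_vector_derivative_quadratic)
    fix s assume s: "s \<in> {0..T}"
    have le: "\<bar>(ut s x - ut t x) - (s - t) * utt t x\<bar> \<le> K * (s - t)\<^sup>2" for x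
      by (rule taylor_remainder[OF ut_deriv lip K s t])
    have eq: "fourier_coeff (\<lambda>x. (ut s x - ut t x) - (s - t) * utt t x) j
        = V s j - V t j - (s - t) *\<^sub>R (- ((japanese j)\<^sup>2 *\<^sub>R U t j) + \<kappa> *\<^sub>R N t j)"
      using s t by (simp add: fourier_coeff_diff fourier_coeff_scale ci coeff_integrable_ut
          coeff_integrable_diff coeff_integrable_scale fc scaleR_conv_of_real)
    show "norm (V s j - V t j - (s - t) *\<^sub>R (- ((japanese j)\<^sup>2 *\<^sub>R U t j) + \<kappa> *\<^sub>R N t j)) \<le> K * (s - t)\<^sup>2"
      unfolding eq[symmetric] using s t
      by (intro norm_fourier_coeff_le le coeff_integrable_diff coeff_integrable_scale ci coeff_integrable_ut)
  qed
qed

end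

text \<open>All that the error analysis uses of the exact solution, with \<open>F\<close> for the
  coefficients of the nonlinearity along it. The H^3 bound and the L2 bounds on first and second
  time differences of \<open>F\<close> are the two ends of the later interpolation.\<close>

definition trajectory :: "real \<Rightarrow> real \<Rightarrow> real \<Rightarrow> real \<Rightarrow> (real \<Rightarrow> int \<Rightarrow> complex) \<Rightarrow> (real \<Rightarrow> int \<Rightarrow> complex)
    \<Rightarrow> (real \<Rightarrow> int \<Rightarrow> complex) \<Rightarrow> bool" where
  "trajectory \<kappa> T M C U V F \<longleftrightarrow>
     (\<forall>t\<in>{0..T}. sob 5 M (U t) \<and> sob 4 M (V t) \<and>
        sob 3 C (F t) \<and>
        (\<forall>j. ((\<lambda>s. U s j) has_vector_derivative V t j) (at t within {0..T})) \<and>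
        (\<forall>j. ((\<lambda>s. V s j) has_vector_derivative (- ((japanese j)\<^sup>2 *\<^sub>R U t j) + \<kappa> *\<^sub>R F t j)) (at t within {0..T}))) \<and>
     (\<forall>s\<in>{0..T}. \<forall>t\<in>{0..T}. ell2 (C * \<bar>s - t\<bar>) (\<lambda>j. F s j - F t j)) \<and>
     (\<forall>m r. 0 \<le> r \<longrightarrow> 0 \<le> m - r \<longrightarrow> m + r \<le> T \<longrightarrow>
        ell2 (C * r\<^sup>2) (\<lambda>j. (F (m + r) j - F m j) - (F m j - F (m - r) j)))"

text \<open>For the second difference of \<open>U\<close> about m, the derivative in the half-width
  is V(m + r) - V(m - r), which is O(r) in H^2 because V' involves two powers of <j> on
  \<open>U\<close> in H^4. Integrating once more gives O(r^2), and
  \<open>nlc_second_difference\<close> transfers this to the nonlinearity. \<open>C\<close> is fixed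
  before \<open>\<kappa>\<close>, the final time and the solution.\<close>

lemma exact_trajectory:
  assumes a: "smooth a" and g: "smooth g"
  obtains C where "C \<ge> 0" "\<And>\<kappa> T u0 v0 u ut. quasilinear_wave a g \<kappa> T M u0 v0 u ut \<Longrightarrow>
    trajectory \<kappa> T M C (\<lambda>t. fourier_coeff (u t)) (\<lambda>t. fourier_coeff (ut t)) (\<lambda>t. nlc a g (fourier_coeff (u t)))"
proof -
  obtain R where R: "\<And>c. sob 5 M c \<Longrightarrow> reg 2 R (nonlin a g (trig c))"
    using nonlin_reg[OF a g, of M 2] by (auto simp del: reg.simps)
  obtain C1 where C1: "\<And>w. reg 2 R w \<Longrightarrow> sob 3 C1 (fourier_coeff w)"
    using reg_fourier[of 2 R] by (auto simp del: reg.simps)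
  obtain L where L: "nlc_lip a g M L" using nlc_lipschitz[OF a g] by blast
  then have L0: "0 \<le> L" by (simp add: nlc_lip_def)
  obtain L2 where L2: "L2 \<ge> 0" "\<And>c0 c1 c2 E1 E2. sob 3 M c0 \<Longrightarrow>
    sob 3 M c1 \<Longrightarrow> sob 3 M c2 \<Longrightarrow>
    ell2 E1 (\<lambda>j. japanese j ^ 3 *\<^sub>R (c1 j - c0 j)) \<Longrightarrow> ell2 E1 (\<lambda>j. japanese j ^ 3 *\<^sub>R (c0 j - c2 j)) \<Longrightarrow>
    ell2 E2 (\<lambda>j. japanese j ^ 2 *\<^sub>R ((c1 j - c0 j) - (c0 j - c2 j))) \<Longrightarrow>
    ell2 (L2 * (E1\<^sup>2 + E2)) (\<lambda>j. (nlc a g c1 j - nlc a g c0 j) - (nlc a g c0 j - nlc a g c2 j))"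
    using nlc_second_difference[OF a g, of M] by blast
  \<comment> \<open>\<open>D\<close> bounds V' in H^2 via the equation, using
    \<open>\<kappa> \<le> 1\<close>; \<open>C\<close> majorizes the H^3, first-difference and
    second-difference constants at once.\<close>
  define D where "D = \<bar>M\<bar> + \<bar>C1\<bar>"
  define C where "C = \<bar>C1\<bar> + L * \<bar>M\<bar> + L2 * (M\<^sup>2 + 2 * D)"
  have pos: "0 \<le> L * \<bar>M\<bar>" "0 \<le> L2 * (M\<^sup>2 + 2 * D)" "0 \<le> D" using L0 L2 by (auto simp: D_def)
  show ?thesis
  proof (rule that[of C])
    show "0 \<le> C" using pos by (simp add: C_def)
    fix \<kappa> T u0 v0 u ut
    assume "quasilinear_wave a g \<kappa> T M u0 v0 u ut"
    then interpret quasilinear_wave a g \<kappa> T M u0 v0 u ut .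
    have F3: "sob 3 C1 (N t)" if "t \<in> {0..T}" for t
      unfolding nlc_def by (intro C1 R U_ell2 that)
    have F1: "ell2 (C * \<bar>s - t\<bar>) (\<lambda>j. N s j - N t j)" if st: "s \<in> {0..T}" "t \<in> {0..T}" for s t
    proof -
      have "ell2 (L * (M * \<bar>s - t\<bar>)) (\<lambda>j. N s j - N t j)"
        by (rule nlc_lipD[OF L ell2_weight_mono[OF U3[OF st(1)]] U3[OF st(1)] U3[OF st(2)]])
           (simp, rule U_diff_ell2, use st in auto)
      then show ?thesis
      proof (rule ell2_mono)
        have "L * M \<le> L * \<bar>M\<bar>" using L0 by (intro mult_left_mono) auto
        then have "L * M \<le> C" using pos unfolding C_def by linarith
        then show "L * (M * \<bar>s - t\<bar>) \<le> C * \<bar>s - t\<bar>"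
          unfolding mult.assoc[symmetric] by (rule mult_right_mono) simp
      qed simp
    qed
    have F2: "ell2 (C * r\<^sup>2) (\<lambda>j. (N (m + r) j - N m j) - (N m j - N (m - r) j))"
      if r: "0 \<le> r" "0 \<le> m - r" "m + r \<le> T" for m r
    proof -
      have in_I: "m + \<rho> \<in> {0..T}" "m - \<rho> \<in> {0..T}" if "\<rho> \<in> {0..r}" for \<rho> using that r by auto
      have m: "m \<in> {0..T}" using r by auto
      have Vdiff: "ell2 (2 * D * r) (\<lambda>j. (japanese j)\<^sup>2 *\<^sub>R (V (m + \<rho>) j - V (m - \<rho>) j))" if \<rho>: "\<rho> \<in> {0..r}" for \<rho>
      proof -
        have "ell2 (D * (m + \<rho> - (m - \<rho>))) (\<lambda>j. (japanese j)\<^sup>2 *\<^sub>R V (m + \<rho>) j - (japanese j)\<^sup>2 *\<^sub>R V (m - \<rho>) j)"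
        proof (rule ell2_mvt[of _ _ "\<lambda>s j. (japanese j)\<^sup>2 *\<^sub>R V s j"
              "\<lambda>s j. (japanese j)\<^sup>2 *\<^sub>R (- ((japanese j)\<^sup>2 *\<^sub>R U s j) + \<kappa> *\<^sub>R N s j)"])
          show "m - \<rho> \<le> m + \<rho>" using \<rho> by simp
          fix s assume s: "s \<in> {m - \<rho>..m + \<rho>}"
          have sub: "{m - \<rho>..m + \<rho>} \<subseteq> {0..T}" using in_I[OF \<rho>] by auto
          then have s': "s \<in> {0..T}" using s by auto
          show "((\<lambda>s. (japanese j)\<^sup>2 *\<^sub>R V s j) has_vector_derivative
              (japanese j)\<^sup>2 *\<^sub>R (- ((japanese j)\<^sup>2 *\<^sub>R U s j) + \<kappa> *\<^sub>R N s j)) (at s within {m - \<rho>..m + \<rho>})" for j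
            by (intro bounded_linear.has_vector_derivative[OF bounded_linear_scaleR_right]
                has_vector_derivative_within_subset[OF V_deriv[OF s'] sub])
          have 1: "ell2 M (\<lambda>j. - (japanese j ^ 4 *\<^sub>R U s j))"
            by (rule ell2_mono[OF ell2_weight_mono[OF U_ell2[OF s'], of 4] order_refl]) auto
          have 2: "ell2 (\<kappa> * C1) (\<lambda>j. \<kappa> *\<^sub>R ((japanese j)\<^sup>2 *\<^sub>R N s j))"
            by (rule ell2_cmul[OF ell2_weight_mono[OF F3[OF s'], of 2]]) (use \<kappa> in auto)
          show "ell2 D (\<lambda>j. (japanese j)\<^sup>2 *\<^sub>R (- ((japanese j)\<^sup>2 *\<^sub>R U s j) + \<kappa> *\<^sub>R N s j))"
          proof (rule ell2_mono[OF ell2_add[OF 1 2]])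
            have "\<kappa> * C1 \<le> C1"
              using \<kappa> mult_right_mono[of \<kappa> 1 C1] ell2_nonneg[OF F3[OF s']] by simp
            then show "M + \<kappa> * C1 \<le> D" by (simp add: D_def)
            show "norm ((japanese j)\<^sup>2 *\<^sub>R (- ((japanese j)\<^sup>2 *\<^sub>R U s j) + \<kappa> *\<^sub>R N s j))
               \<le> norm (- (japanese j ^ 4 *\<^sub>R U s j) + \<kappa> *\<^sub>R (japanese j)\<^sup>2 *\<^sub>R N s j)" for j
            proof -
              have "(japanese j)\<^sup>2 *\<^sub>R (- ((japanese j)\<^sup>2 *\<^sub>R U s j) + \<kappa> *\<^sub>R N s j)
                 = - (japanese j ^ 4 *\<^sub>R U s j) + \<kappa> *\<^sub>R (japanese j)\<^sup>2 *\<^sub>R N s j"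
                by (simp add: scaleR_add_right scaleR_diff_right power_add[symmetric] mult.commute)
              then show ?thesis by simp
            qed
          qed
        qed
        then have "ell2 (D * (2 * \<rho>)) (\<lambda>j. (japanese j)\<^sup>2 *\<^sub>R (V (m + \<rho>) j - V (m - \<rho>) j))"
          by (simp add: scaleR_diff_right)
        then show ?thesis
        proof (rule ell2_mono)
          show "D * (2 * \<rho>) \<le> 2 * D * r" using pos \<rho> mult_left_mono[of \<rho> r "2 * D"] by (simp add: mult_ac)
        qed simp
      qed
      let ?x = "\<lambda>\<rho> j. (japanese j)\<^sup>2 *\<^sub>R ((U (m + \<rho>) j - U m j) - (U m j - U (m - \<rho>) j))"
      have "ell2 (2 * D * r * (r - 0)) (\<lambda>j. ?x r j - ?x 0 j)"
      proof (rule ell2_mvt[OF r(1), of ?x "\<lambda>\<rho> j. (japanese j)\<^sup>2 *\<^sub>R (V (m + \<rho>) j - V (m - \<rho>) j)", OF _ Vdiff])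
        fix \<rho> j assume \<rho>: "\<rho> \<in> {0..r}"
        have 1: "((\<lambda>\<rho>. U (m + \<rho>) j) has_vector_derivative V (m + \<rho>) j) (at \<rho> within {0..r})"
          by (rule vector_derivative_shift[OF U_deriv[OF in_I(1)[OF \<rho>]] in_I(1)])
        have 2: "((\<lambda>\<rho>. U (m - \<rho>) j) has_vector_derivative - V (m - \<rho>) j) (at \<rho> within {0..r})"
          by (rule vector_derivative_reflect[OF U_deriv[OF in_I(2)[OF \<rho>]] in_I(2)])
        have "((\<lambda>\<rho>. ?x \<rho> j) has_vector_derivative (japanese j)\<^sup>2 *\<^sub>R ((V (m + \<rho>) j - 0) - (0 - - V (m - \<rho>) j))) (at \<rho> within {0..r})"
          by (intro bounded_linear.has_vector_derivative[OF bounded_linear_scaleR_right]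
              has_vector_derivative_diff has_vector_derivative_const 1 2)
        then show "((\<lambda>\<rho>. ?x \<rho> j) has_vector_derivative (japanese j)\<^sup>2 *\<^sub>R (V (m + \<rho>) j - V (m - \<rho>) j)) (at \<rho> within {0..r})"
          by simp
      qed
      then have e: "ell2 (2 * D * r * r) (?x r)" by simp
      have "ell2 (L2 * ((M * r)\<^sup>2 + 2 * D * r * r)) (\<lambda>j. (N (m + r) j - N m j) - (N m j - N (m - r) j))"
      proof (rule L2(2)[OF U3[OF m] U3 U3 _ _ e])
        show "m + r \<in> {0..T}" "m - r \<in> {0..T}" using in_I[of r] r by auto
        then show "ell2 (M * r) (\<lambda>j. japanese j ^ 3 *\<^sub>R (U (m + r) j - U m j))"
          "ell2 (M * r) (\<lambda>j. japanese j ^ 3 *\<^sub>R (U m j - U (m - r) j))"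
          using U_diff_ell2[of 3 "m + r" m] U_diff_ell2[of 3 m "m - r"] m r by simp_all
      qed
      then show ?thesis
      proof (rule ell2_mono)
        have "L2 * ((M * r)\<^sup>2 + 2 * D * r * r) = (L2 * (M\<^sup>2 + 2 * D)) * r\<^sup>2"
          by (simp add: power2_eq_square algebra_simps)
        also have "\<dots> \<le> C * r\<^sup>2" using pos by (intro mult_right_mono) (auto simp: C_def)
        finally show "L2 * ((M * r)\<^sup>2 + 2 * D * r * r) \<le> C * r\<^sup>2" .
      qed simp
    qed
    have F3': "sob 3 C (N t)" if "t \<in> {0..T}" for t
      by (rule ell2_mono[OF F3[OF that]]) (use pos in \<open>auto simp: C_def\<close>)
    show "trajectory \<kappa> T M C U V N"
      unfolding trajectory_def using U_ell2 V_ell2 F3' U_deriv V_deriv F1 F2 by blast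
  qed
qed

section \<open>Local error\<close>

lemma coeff_assumption_nonneg: "coeff_assumption c b1 bb \<Longrightarrow> 0 \<le> c"
  unfolding coeff_assumption_def by (metis abs_ge_zero order_refl order_trans)

lemma coeff_assumption_bounds:
  assumes "coeff_assumption c b1 bb" "0 < h"
  shows "(h * japanese j)\<^sup>2 * \<bar>bb (h\<^sup>2 * (japanese j)\<^sup>2)\<bar> \<le> c"
    "h * japanese j * \<bar>b1 (h\<^sup>2 * (japanese j)\<^sup>2)\<bar> \<le> c"
proof -
  have "0 \<le> h * japanese j" using assms by simp
  then have "\<bar>(h * japanese j)\<^sup>2 * bb ((h * japanese j)\<^sup>2)\<bar> \<le> c" "\<bar>h * japanese j * b1 ((h * japanese j)\<^sup>2)\<bar> \<le> c"
    using assms(1) unfolding coeff_assumption_def by blast+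
  then show "(h * japanese j)\<^sup>2 * \<bar>bb (h\<^sup>2 * (japanese j)\<^sup>2)\<bar> \<le> c" "h * japanese j * \<bar>b1 (h\<^sup>2 * (japanese j)\<^sup>2)\<bar> \<le> c"
    using assms(2) by (simp_all add: abs_mult power_mult_distrib)
qed

text \<open>Seen from the midpoint, the update of the first component vanishes by symmetry; where
  \<open>cos (\<theta> / 2) = 0\<close> this needs the bound by \<open>sinc\<close>.\<close>

lemma coeff_assumption_symmetry:
  assumes ca: "coeff_assumption c b1 bb" and h: "0 < h"
  defines "\<theta> \<equiv> \<lambda>j. h * japanese j"
  shows "\<theta> j * cos (\<theta> j / 2) * bb (h\<^sup>2 * (japanese j)\<^sup>2) = sin (\<theta> j / 2) * b1 (h\<^sup>2 * (japanese j)\<^sup>2)"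
proof -
  let ?t = "\<theta> j" and ?b = "b1 (h\<^sup>2 * (japanese j)\<^sup>2)" and ?bb = "bb (h\<^sup>2 * (japanese j)\<^sup>2)"
  have t: "0 < ?t" using h by (simp add: \<theta>_def)
  have eq: "sin ?t / ?t * ?b = (1 + cos ?t) * ?bb"
    using ca h t unfolding coeff_assumption_def \<theta>_def by auto
  have s: "sin ?t = 2 * sin (?t / 2) * cos (?t / 2)" using sin_double[of "?t / 2"] by simp
  have c: "1 + cos ?t = 2 * (cos (?t / 2))\<^sup>2" using cos_double_cos[of "?t / 2"] by simp
  show ?thesis
  proof (cases "cos (?t / 2) = 0")
    case True
    have sq: "h\<^sup>2 * (japanese j)\<^sup>2 = ?t\<^sup>2" by (simp add: \<theta>_def power_mult_distrib)
    have "\<bar>?t * b1 (?t\<^sup>2)\<bar> \<le> c * \<bar>if ?t = 0 then 1 else sin ?t / ?t\<bar>"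
      using ca t unfolding coeff_assumption_def by (meson less_imp_le)
    then have "?b = 0" using t True s by (simp add: sq)
    then show ?thesis using True by simp
  next
    case False
    have "cos (?t / 2) * (sin (?t / 2) * ?b) = cos (?t / 2) * (?t * cos (?t / 2) * ?bb)"
      using eq t unfolding s c by (simp add: field_simps power2_eq_square)
    then show ?thesis using False by simp
  qed
qed

text \<open>Replacing the coefficients by sin(\<open>\<theta>\<close>/2)/\<open>\<theta>\<close> and
  cos(\<open>\<theta>\<close>/2) turns the expression into sin^2 + cos^2 - 1 = 0; each replacement
  costs c\<open>\<theta>\<close>^2. So the kick seen from the midpoint has weight 1 up to second
  order.\<close>

lemma coeff_assumption_consistency:
  assumes ca: "coeff_assumption c b1 bb" and h: "0 < h"
  defines "\<theta> \<equiv> \<lambda>j. h * japanese j"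
  shows "\<bar>\<theta> j * sin (\<theta> j / 2) * bb (h\<^sup>2 * (japanese j)\<^sup>2) + cos (\<theta> j / 2) * b1 (h\<^sup>2 * (japanese j)\<^sup>2) - 1\<bar> \<le> 2 * c * (\<theta> j)\<^sup>2"
proof -
  let ?t = "\<theta> j" and ?b = "b1 (h\<^sup>2 * (japanese j)\<^sup>2)" and ?bb = "bb (h\<^sup>2 * (japanese j)\<^sup>2)"
  have t: "0 < ?t" using h by (simp add: \<theta>_def)
  have sq: "h\<^sup>2 * (japanese j)\<^sup>2 = ?t\<^sup>2" by (simp add: \<theta>_def power_mult_distrib)
  have c: "0 \<le> c" by (rule coeff_assumption_nonneg[OF ca])
  have 1: "\<bar>?bb - sin (?t / 2) / ?t\<bar> \<le> c * ?t" "\<bar>?b - cos (?t / 2)\<bar> \<le> c * ?t\<^sup>2"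
  proof -
    have "\<bar>bb (?t\<^sup>2) - 1 / 2 * (if 1 / 2 * ?t = 0 then 1 else sin (1 / 2 * ?t) / (1 / 2 * ?t))\<bar> \<le> c * ?t"
      "\<bar>b1 (?t\<^sup>2) - cos (1 / 2 * ?t)\<bar> \<le> c * ?t\<^sup>2"
      using ca t unfolding coeff_assumption_def by (meson less_imp_le)+
    then show "\<bar>?bb - sin (?t / 2) / ?t\<bar> \<le> c * ?t" "\<bar>?b - cos (?t / 2)\<bar> \<le> c * ?t\<^sup>2"
      using t by (simp_all add: sq)
  qed
  have "?t * sin (?t / 2) * ?bb + cos (?t / 2) * ?b - 1
      = ?t * sin (?t / 2) * (?bb - sin (?t / 2) / ?t) + cos (?t / 2) * (?b - cos (?t / 2))"
    using t sin_cos_squared_add3[of "?t / 2"] by (simp add: algebra_simps)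
  moreover have "\<bar>?t * sin (?t / 2) * (?bb - sin (?t / 2) / ?t)\<bar> \<le> (?t * 1) * (c * ?t)"
    unfolding abs_mult using t c 1 by (intro mult_mono) auto
  moreover have "\<bar>cos (?t / 2) * (?b - cos (?t / 2))\<bar> \<le> 1 * (c * ?t\<^sup>2)"
    unfolding abs_mult using 1 by (intro mult_mono) auto
  moreover have "(?t * 1) * (c * ?t) + 1 * (c * ?t\<^sup>2) = 2 * c * ?t\<^sup>2"
    by (simp add: power2_eq_square algebra_simps)
  ultimately show ?thesis by linarith
qed

text \<open>Flow of the harmonic oscillator in the coordinates \<open>evec\<close>: over a time h
  the mode j turns by the angle h<j>.\<close>

definition rot :: "real \<Rightarrow> complex \<times> complex \<Rightarrow> complex \<times> complex" where
  "rot \<theta> z = (cos \<theta> *\<^sub>R fst z + sin \<theta> *\<^sub>R snd z, cos \<theta> *\<^sub>R snd z - sin \<theta> *\<^sub>R fst z)"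

lemma norm_rot [simp]: "norm (rot \<theta> z) = norm z"
proof -
  have *: "(norm (c *\<^sub>R p + s *\<^sub>R q))\<^sup>2 + (norm (c *\<^sub>R q - s *\<^sub>R p))\<^sup>2 = (c\<^sup>2 + s\<^sup>2) * ((norm p)\<^sup>2 + (norm q)\<^sup>2)"
    for c s :: real and p q :: complex
    unfolding cmod_power2 by (simp add: power2_eq_square algebra_simps)
  have "(norm (fst (rot \<theta> z)))\<^sup>2 + (norm (snd (rot \<theta> z)))\<^sup>2 = (norm (fst z))\<^sup>2 + (norm (snd z))\<^sup>2"
    unfolding rot_def fst_conv snd_conv * by simp
  then show ?thesis by (simp add: norm_prod_def)
qed

lemma rot_diff: "rot \<theta> (z - w) = rot \<theta> z - rot \<theta> w"
  by (simp add: rot_def algebra_simps)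

lemma rot_scale: "rot \<theta> (r *\<^sub>R z) = r *\<^sub>R rot \<theta> z"
  by (simp add: rot_def algebra_simps)

lemma rot_rot: "rot \<alpha> (rot \<beta> z) = rot (\<alpha> + \<beta>) z"
  by (simp add: rot_def cos_add sin_add algebra_simps)

lemma rot_0 [simp]: "rot 0 z = z"
  by (simp add: rot_def)

text \<open>The weights <j>^2 and <j> make the ell2 norm the energy norm with s = 1 and the linear
  flow an isometry in every mode.\<close>

definition evec :: "(int \<Rightarrow> complex) \<Rightarrow> (int \<Rightarrow> complex) \<Rightarrow> int \<Rightarrow> complex \<times> complex" where
  "evec U V j = ((japanese j)\<^sup>2 *\<^sub>R U j, japanese j *\<^sub>R V j)"

definition kick :: "(real \<Rightarrow> real) \<Rightarrow> (real \<Rightarrow> real) \<Rightarrow> real \<Rightarrow> (int \<Rightarrow> complex) \<Rightarrow> int \<Rightarrow> complex \<times> complex" where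
  "kick b1 bb h F j = (((japanese j)\<^sup>2 * h\<^sup>2 * bb (h\<^sup>2 * (japanese j)\<^sup>2)) *\<^sub>R F j, (japanese j * h * b1 (h\<^sup>2 * (japanese j)\<^sup>2)) *\<^sub>R F j)"

text \<open>Half a step back brings the kick to the midpoint: symmetry removes its first component,
  and \<open>coeff_assumption_consistency\<close> shows that the weight left in the second is close
  to 1.\<close>

lemma rot_kick:
  assumes ca: "coeff_assumption c b1 bb" and h: "0 < h"
  defines "\<theta> \<equiv> \<lambda>j. h * japanese j"
  shows "rot (- (\<theta> j / 2)) (kick b1 bb h F j) =
    (0, (japanese j * h * (\<theta> j * sin (\<theta> j / 2) * bb (h\<^sup>2 * (japanese j)\<^sup>2) + cos (\<theta> j / 2) * b1 (h\<^sup>2 * (japanese j)\<^sup>2))) *\<^sub>R F j)"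
proof -
  let ?t = "\<theta> j" and ?b = "b1 (h\<^sup>2 * (japanese j)\<^sup>2)" and ?bb = "bb (h\<^sup>2 * (japanese j)\<^sup>2)"
  have "cos (?t / 2) * ((japanese j)\<^sup>2 * h\<^sup>2 * ?bb) - sin (?t / 2) * (japanese j * h * ?b)
      = japanese j * h * (?t * cos (?t / 2) * ?bb - sin (?t / 2) * ?b)"
    by (simp add: \<theta>_def power2_eq_square algebra_simps)
  also have "\<dots> = 0" using coeff_assumption_symmetry[OF ca h, of j] by (simp add: \<theta>_def)
  finally have 1: "cos (?t / 2) * ((japanese j)\<^sup>2 * h\<^sup>2 * ?bb) - sin (?t / 2) * (japanese j * h * ?b) = 0" .
  have 2: "cos (?t / 2) * (japanese j * h * ?b) + sin (?t / 2) * ((japanese j)\<^sup>2 * h\<^sup>2 * ?bb)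
      = japanese j * h * (?t * sin (?t / 2) * ?bb + cos (?t / 2) * ?b)"
    by (simp add: \<theta>_def power2_eq_square algebra_simps)
  have "fst (rot (- (?t / 2)) (kick b1 bb h F j))
      = (cos (?t / 2) * ((japanese j)\<^sup>2 * h\<^sup>2 * ?bb) - sin (?t / 2) * (japanese j * h * ?b)) *\<^sub>R F j"
    unfolding scaleR_diff_left by (simp add: rot_def kick_def)
  moreover have "snd (rot (- (?t / 2)) (kick b1 bb h F j))
      = (cos (?t / 2) * (japanese j * h * ?b) + sin (?t / 2) * ((japanese j)\<^sup>2 * h\<^sup>2 * ?bb)) *\<^sub>R F j"
    unfolding scaleR_add_left by (simp add: rot_def kick_def)
  ultimately show ?thesis unfolding 1 2 by (simp add: prod_eq_iff)
qed

text \<open>Each component contributes \<open>c\<close>: the filters compensate the weights <j>^2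
  and <j> together with the powers of h. No derivative is lost, but no factor h remains either,
  hence the growth 1 + O(\<open>\<kappa>\<close>) per step.\<close>

lemma norm_kick:
  assumes "coeff_assumption c b1 bb" "0 < h"
  shows "norm (kick b1 bb h F j) \<le> 2 * c * norm (F j)"
proof -
  let ?w = "japanese j"
  have 1: "norm (fst (kick b1 bb h F j)) \<le> c * norm (F j)"
    using mult_right_mono[OF coeff_assumption_bounds(1)[OF assms, of j], of "norm (F j)"]
    by (simp add: kick_def abs_mult power_mult_distrib mult_ac)
  have 2: "norm (snd (kick b1 bb h F j)) \<le> c * norm (F j)"
    using mult_right_mono[OF coeff_assumption_bounds(2)[OF assms, of j], of "norm (F j)"] assms(2)
    by (simp add: kick_def abs_mult mult_ac)
  have "norm (kick b1 bb h F j) \<le> norm (fst (kick b1 bb h F j)) + norm (snd (kick b1 bb h F j))"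
    by (metis norm_Pair_le prod.collapse)
  then show ?thesis using 1 2 by linarith
qed

lemma kick_diff: "kick b1 bb h F j - kick b1 bb h G j = kick b1 bb h (\<lambda>j. F j - G j) j"
  by (simp add: kick_def scaleR_diff_right)

text \<open>Split at frequency \<open>\<mu>\<close>: below it the weight is at most
  \<open>\<mu> ^ k\<close>, above it the excess of the weight <j>^3 is at least
  \<open>\<mu> ^ (3 - k)\<close>. The free cut-off is optimized by the caller.\<close>

lemma ell2_interpolate:
  fixes x :: "int \<Rightarrow> complex"
  assumes x0: "ell2 A x" and x3: "sob 3 B x" and \<mu>: "0 < \<mu>" and k: "k \<le> 3"
  shows "sob k (\<mu> ^ k * A + B / \<mu> ^ (3 - k)) x"
proof -
  have 1: "ell2 (\<mu> ^ k * A) (\<lambda>j. \<mu> ^ k * norm (x j))"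
    by (rule ell2_cmul[OF x0]) (use \<mu> in \<open>simp_all add: abs_mult\<close>)
  have 2: "ell2 (1 / \<mu> ^ (3 - k) * B) (\<lambda>j. 1 / \<mu> ^ (3 - k) * norm (japanese j ^ 3 *\<^sub>R x j))"
    by (rule ell2_cmul[OF x3]) (use \<mu> in \<open>simp_all add: abs_mult\<close>)
  show ?thesis
  proof (rule ell2_mono[OF ell2_add[OF 1 2]])
    fix j
    have "japanese j ^ k \<le> \<mu> ^ k + japanese j ^ 3 / \<mu> ^ (3 - k)"
    proof (cases "japanese j \<le> \<mu>")
      case True
      then have "japanese j ^ k \<le> \<mu> ^ k" by (intro power_mono) auto
      moreover have "0 \<le> japanese j ^ 3 / \<mu> ^ (3 - k)" using \<mu> by simp
      ultimately show ?thesis by linarith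
    next
      case False
      then have "japanese j ^ k * \<mu> ^ (3 - k) \<le> japanese j ^ k * japanese j ^ (3 - k)"
        using \<mu> by (intro mult_left_mono power_mono) auto
      also have "\<dots> = japanese j ^ 3" using k by (simp add: power_add[symmetric])
      finally have "japanese j ^ k \<le> japanese j ^ 3 / \<mu> ^ (3 - k)" using \<mu> by (simp add: field_simps)
      moreover have "0 \<le> \<mu> ^ k" using \<mu> by simp
      ultimately show ?thesis by linarith
    qed
    from mult_right_mono[OF this, of "norm (x j)"]
    have "japanese j ^ k * norm (x j) \<le> \<mu> ^ k * norm (x j) + 1 / \<mu> ^ (3 - k) * norm (japanese j ^ 3 *\<^sub>R x j)"
      by (simp add: distrib_right)
    then show "norm (japanese j ^ k *\<^sub>R x j) \<le> norm (\<mu> ^ k * norm (x j) + 1 / \<mu> ^ (3 - k) * norm (japanese j ^ 3 *\<^sub>R x j))"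
      by simp
  qed simp
qed

lemma abs_cos_minus_1: "\<bar>cos x - 1\<bar> \<le> x\<^sup>2" for x :: real
proof -
  have "cos x - 1 = - 2 * (sin (x / 2))\<^sup>2" using cos_double_sin[of "x / 2"] by simp
  moreover have "(sin (x / 2))\<^sup>2 \<le> (x / 2)\<^sup>2"
    using power_mono[OF abs_sin_x_le_abs_x abs_ge_zero, of "x / 2" 2] by (simp only: power2_abs)
  moreover have "2 * (x / 2)\<^sup>2 \<le> x\<^sup>2" by (simp add: power_divide)
  ultimately show ?thesis by (simp add: abs_mult)
qed

text \<open>Variation of constants: the rotating frame cancels the linear part of the equation, and
  only the rotated forcing \<open>\<kappa> *\<^sub>R F\<close> remains.\<close>

lemma rotated_deriv:
  assumes U: "((\<lambda>s. U s) has_vector_derivative V r) (at r within S)"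
    and V: "((\<lambda>s. V s) has_vector_derivative (- ((\<omega>\<^sup>2 :: real) *\<^sub>R (U r :: complex)) + \<kappa> *\<^sub>R F)) (at r within S)"
  shows "((\<lambda>s. rot (- ((s - m) * \<omega>)) (\<omega>\<^sup>2 *\<^sub>R U s, \<omega> *\<^sub>R V s)) has_vector_derivative
     ((- sin ((r - m) * \<omega>) * \<omega> * \<kappa>) *\<^sub>R F, (cos ((r - m) * \<omega>) * \<omega> * \<kappa>) *\<^sub>R F)) (at r within S)"
proof -
  have c: "((\<lambda>s. cos ((s - m) * \<omega>)) has_real_derivative - sin ((r - m) * \<omega>) * \<omega>) (at r within S)"
    and s: "((\<lambda>s. sin ((s - m) * \<omega>)) has_real_derivative cos ((r - m) * \<omega>) * \<omega>) (at r within S)"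
    by (auto intro!: derivative_eq_intros)
  let ?V' = "- (\<omega>\<^sup>2 *\<^sub>R U r) + \<kappa> *\<^sub>R F"
  have U': "((\<lambda>s. \<omega>\<^sup>2 *\<^sub>R U s) has_vector_derivative \<omega>\<^sup>2 *\<^sub>R V r) (at r within S)"
    and V': "((\<lambda>s. \<omega> *\<^sub>R V s) has_vector_derivative \<omega> *\<^sub>R ?V') (at r within S)"
    by (intro bounded_linear.has_vector_derivative[OF bounded_linear_scaleR_right] U V)+
  have "((\<lambda>s. cos ((s - m) * \<omega>) *\<^sub>R (\<omega>\<^sup>2 *\<^sub>R U s) - sin ((s - m) * \<omega>) *\<^sub>R (\<omega> *\<^sub>R V s)) has_vector_derivative
      (cos ((r - m) * \<omega>) *\<^sub>R (\<omega>\<^sup>2 *\<^sub>R V r) + (- sin ((r - m) * \<omega>) * \<omega>) *\<^sub>R (\<omega>\<^sup>2 *\<^sub>R U r))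
      - (sin ((r - m) * \<omega>) *\<^sub>R (\<omega> *\<^sub>R ?V') + (cos ((r - m) * \<omega>) * \<omega>) *\<^sub>R (\<omega> *\<^sub>R V r))) (at r within S)"
    by (intro has_vector_derivative_diff has_vector_derivative_scaleR c s U' V')
  moreover have "((\<lambda>s. cos ((s - m) * \<omega>) *\<^sub>R (\<omega> *\<^sub>R V s) + sin ((s - m) * \<omega>) *\<^sub>R (\<omega>\<^sup>2 *\<^sub>R U s)) has_vector_derivative
      (cos ((r - m) * \<omega>) *\<^sub>R (\<omega> *\<^sub>R ?V') + (- sin ((r - m) * \<omega>) * \<omega>) *\<^sub>R (\<omega> *\<^sub>R V r))
      + (sin ((r - m) * \<omega>) *\<^sub>R (\<omega>\<^sup>2 *\<^sub>R V r) + (cos ((r - m) * \<omega>) * \<omega>) *\<^sub>R (\<omega>\<^sup>2 *\<^sub>R U r))) (at r within S)"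
    by (intro has_vector_derivative_add has_vector_derivative_scaleR c s U' V')
  ultimately have "((\<lambda>s. (cos ((s - m) * \<omega>) *\<^sub>R (\<omega>\<^sup>2 *\<^sub>R U s) - sin ((s - m) * \<omega>) *\<^sub>R (\<omega> *\<^sub>R V s),
        cos ((s - m) * \<omega>) *\<^sub>R (\<omega> *\<^sub>R V s) + sin ((s - m) * \<omega>) *\<^sub>R (\<omega>\<^sup>2 *\<^sub>R U s))) has_vector_derivative
      ((cos ((r - m) * \<omega>) *\<^sub>R (\<omega>\<^sup>2 *\<^sub>R V r) + (- sin ((r - m) * \<omega>) * \<omega>) *\<^sub>R (\<omega>\<^sup>2 *\<^sub>R U r))
      - (sin ((r - m) * \<omega>) *\<^sub>R (\<omega> *\<^sub>R ?V') + (cos ((r - m) * \<omega>) * \<omega>) *\<^sub>R (\<omega> *\<^sub>R V r)),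
      (cos ((r - m) * \<omega>) *\<^sub>R (\<omega> *\<^sub>R ?V') + (- sin ((r - m) * \<omega>) * \<omega>) *\<^sub>R (\<omega> *\<^sub>R V r))
      + (sin ((r - m) * \<omega>) *\<^sub>R (\<omega>\<^sup>2 *\<^sub>R V r) + (cos ((r - m) * \<omega>) * \<omega>) *\<^sub>R (\<omega>\<^sup>2 *\<^sub>R U r)))) (at r within S)"
    by (rule has_vector_derivative_Pair)
  moreover have "rot (- x) (p, q) = (cos x *\<^sub>R p - sin x *\<^sub>R q, cos x *\<^sub>R q + sin x *\<^sub>R p)" for x p q
    by (simp add: rot_def)
  ultimately show ?thesis
    by (simp only:) (erule has_vector_derivative_eq_rhs, simp add: power2_eq_square algebra_simps)
qed

text \<open>\<open>Z\<close> compares the rotated solution at m + r and m - r with r times twice the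
  midpoint kick. It vanishes at r = 0 and is the rotated local defect at r = h/2. Pairing the two
  times in its derivative leaves sin times a first difference of \<open>F\<close> in one component,
  and a second difference plus (cos - s) times \<open>F m\<close> in the other.\<close>

lemma local_error:
  assumes traj: "trajectory \<kappa> T M C U V F" and ca: "coeff_assumption c b1 bb" and \<kappa>: "0 \<le> \<kappa>"
    and \<eta>: "0 < \<eta>" "\<eta> \<le> 1" and h: "h = \<eta> ^ 3" and \<tau>: "0 \<le> \<tau>" "\<tau> + h \<le> T"
  shows "ell2 (\<kappa> * ((10 + 4 * c) * C * \<eta> ^ 4) * (h / 2))
    (\<lambda>j. evec (U (\<tau> + h)) (V (\<tau> + h)) j - rot (h * japanese j) (evec (U \<tau>) (V \<tau>) j)
       - \<kappa> *\<^sub>R kick b1 bb h (F (\<tau> + h / 2)) j)"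
proof -
  define m where "m = \<tau> + h / 2"
  have hpos: "0 < h" using h \<eta> by simp
  have c: "0 \<le> c" by (rule coeff_assumption_nonneg[OF ca])
  have m: "m \<in> {0..T}" using \<tau> hpos by (auto simp: m_def)
  have in_I: "m + r \<in> {0..T}" "m - r \<in> {0..T}" if "r \<in> {0..h / 2}" for r using that \<tau> by (auto simp: m_def)
  have F3: "sob 3 C (F t)" if "t \<in> {0..T}" for t
    using traj that by (simp add: trajectory_def)
  have C: "0 \<le> C" using ell2_nonneg[OF F3[OF m]] .
  define s where "s j = h * japanese j * sin (h * japanese j / 2) * bb (h\<^sup>2 * (japanese j)\<^sup>2)
      + cos (h * japanese j / 2) * b1 (h\<^sup>2 * (japanese j)\<^sup>2)" for j
  have s1: "\<bar>s j - 1\<bar> \<le> 2 * c * (h * japanese j)\<^sup>2" for j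
    unfolding s_def by (rule coeff_assumption_consistency[OF ca hpos])
  define Y where "Y r j = rot (- ((r - m) * japanese j)) (evec (U r) (V r) j)" for r j
  define Y' where "Y' r j = ((- sin ((r - m) * japanese j) * japanese j * \<kappa>) *\<^sub>R F r j,
      (cos ((r - m) * japanese j) * japanese j * \<kappa>) *\<^sub>R F r j)" for r j
  have Yd: "((\<lambda>s. Y s j) has_vector_derivative Y' r j) (at r within {0..T})" if "r \<in> {0..T}" for r j
    unfolding Y_def Y'_def evec_def
    by (rule rotated_deriv) (use traj that in \<open>simp_all add: trajectory_def\<close>)
  define Z where "Z r j = Y (m + r) j - Y (m - r) j - r *\<^sub>R (2 * \<kappa>) *\<^sub>R (0, (japanese j * s j) *\<^sub>R F m j)" for r j
  define Z' where "Z' r j = Y' (m + r) j + Y' (m - r) j - (2 * \<kappa>) *\<^sub>R (0, (japanese j * s j) *\<^sub>R F m j)" for r j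
  have Zd: "((\<lambda>r. Z r j) has_vector_derivative Z' r j) (at r within {0..h / 2})" if r: "r \<in> {0..h / 2}" for r j
  proof -
    have 1: "((\<lambda>r. Y (m + r) j) has_vector_derivative Y' (m + r) j) (at r within {0..h / 2})"
      by (rule vector_derivative_shift[OF Yd[OF in_I(1)[OF r]] in_I(1)])
    have 2: "((\<lambda>r. Y (m - r) j) has_vector_derivative - Y' (m - r) j) (at r within {0..h / 2})"
      by (rule vector_derivative_reflect[OF Yd[OF in_I(2)[OF r]] in_I(2)])
    have 3: "((\<lambda>r. r *\<^sub>R w) has_vector_derivative w) (at r within {0..h / 2})" for w :: "complex \<times> complex"
      unfolding has_vector_derivative_def
      by (rule has_derivative_eq_rhs, (rule derivative_intros)+) simp
    have "((\<lambda>r. Z r j) has_vector_derivative Y' (m + r) j - - Y' (m - r) j - (2 * \<kappa>) *\<^sub>R (0, (japanese j * s j) *\<^sub>R F m j))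
       (at r within {0..h / 2})"
      unfolding Z_def by (intro has_vector_derivative_diff 1 2 3)
    then show ?thesis by (simp add: Z'_def)
  qed
  have Z'_bound: "ell2 (\<kappa> * ((10 + 4 * c) * C * \<eta> ^ 4)) (Z' r)" if r: "r \<in> {0..h / 2}" for r
  proof -
    define D1 where "D1 j = F (m + r) j - F (m - r) j" for j
    define D2 where "D2 j = (F (m + r) j - F m j) - (F m j - F (m - r) j)" for j
    have \<eta>h: "\<eta> ^ 6 \<le> \<eta> ^ 4" using \<eta> by (intro power_decreasing) auto
    have F3r: "ell2 C (\<lambda>j. japanese j ^ 3 *\<^sub>R F (m + r) j)" "ell2 C (\<lambda>j. japanese j ^ 3 *\<^sub>R F (m - r) j)"
      "sob 3 C (F m)"
      by (intro F3 in_I r m)+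
    have D1a: "ell2 (C * h) D1"
    proof -
      have "ell2 (C * \<bar>(m + r) - (m - r)\<bar>) D1"
        unfolding D1_def using traj in_I[OF r] unfolding trajectory_def by blast
      then show ?thesis by (rule ell2_mono) (use r C in \<open>auto intro: mult_left_mono\<close>)
    qed
    have D1b: "sob 3 (C + C) D1"
      using ell2_diff[OF F3r(1,2)] by (simp add: D1_def scaleR_diff_right)
    \<comment> \<open>The cut-off h^(-1/3) balances the two terms, which become
      \<open>C * \<eta>\<close> and \<open>2 * C * \<eta>\<close>.\<close>
    have "sob 2 ((1 / \<eta>) ^ 2 * (C * h) + (C + C) / (1 / \<eta>) ^ (3 - 2)) D1"
      by (rule ell2_interpolate[OF D1a D1b]) (use \<eta> in auto)
    moreover have "(1 / \<eta>) ^ 2 * (C * h) + (C + C) / (1 / \<eta>) ^ (3 - 2) = 3 * C * \<eta>"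
      using \<eta> by (simp add: h field_simps power2_eq_square power3_eq_cube)
    ultimately have D1: "sob 2 (3 * C * \<eta>) D1" by (simp only:)
    have D2a: "ell2 (C * h\<^sup>2) D2"
    proof -
      have "ell2 (C * r\<^sup>2) D2"
        unfolding D2_def using traj in_I[OF r] r unfolding trajectory_def by auto
      then show ?thesis by (rule ell2_mono) (use r C in \<open>auto intro!: mult_left_mono power_mono\<close>)
    qed
    have D2b: "sob 3 ((C + C) + (C + C)) D2"
      using ell2_diff[OF ell2_diff[OF F3r(1,3)] ell2_diff[OF F3r(3,2)]]
      unfolding D2_def by (simp only: scaleR_diff_right)
    \<comment> \<open>Here the cut-off h^(-2/3) balances: the terms become
      \<open>C * \<eta> ^ 4\<close> and \<open>4 * C * \<eta> ^ 4\<close>.\<close>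
    have "sob 1 ((1 / \<eta>\<^sup>2) ^ 1 * (C * h\<^sup>2) + ((C + C) + (C + C)) / (1 / \<eta>\<^sup>2) ^ (3 - 1)) D2"
      by (rule ell2_interpolate[OF D2a D2b]) (use \<eta> in auto)
    moreover have "(1 / \<eta>\<^sup>2) ^ 1 * (C * h\<^sup>2) + ((C + C) + (C + C)) / (1 / \<eta>\<^sup>2) ^ (3 - 1) = 5 * C * \<eta> ^ 4"
      using \<eta> by (simp add: h field_simps power_mult[symmetric] power_add[symmetric])
    ultimately have D2: "ell2 (5 * C * \<eta> ^ 4) (\<lambda>j. japanese j *\<^sub>R D2 j)" by (simp only: power_one_right)
    have 1: "ell2 (h * (3 * C * \<eta>)) (\<lambda>j. h * ((japanese j)\<^sup>2 * norm (D1 j)))"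
      by (rule ell2_cmul[OF D1]) (use hpos in \<open>auto simp: abs_mult\<close>)
    have 2: "ell2 (5 * C * \<eta> ^ 4) (\<lambda>j. japanese j * norm (D2 j))"
      by (rule ell2_mono[OF D2]) auto
    have 3: "ell2 (2 * (1 + 2 * c) * h\<^sup>2 * C) (\<lambda>j. 2 * (1 + 2 * c) * h\<^sup>2 * (japanese j ^ 3 * norm (F m j)))"
      by (rule ell2_cmul[OF F3r(3)]) (use c in \<open>auto simp: abs_mult\<close>)
    have 4: "norm (Z' r j) \<le> \<kappa> * norm (h * ((japanese j)\<^sup>2 * norm (D1 j)) + japanese j * norm (D2 j)
        + 2 * (1 + 2 * c) * h\<^sup>2 * (japanese j ^ 3 * norm (F m j)))" for j
    proof -
      let ?w = "japanese j"
      have r0: "0 \<le> r" "r \<le> h" using r hpos by auto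
      have "fst (Z' r j) = (- sin (r * ?w) * ?w * \<kappa>) *\<^sub>R D1 j"
        by (simp add: Z'_def Y'_def D1_def scaleR_diff_right)
      then have "norm (fst (Z' r j)) = \<kappa> * (\<bar>sin (r * ?w)\<bar> * ?w * norm (D1 j))"
        using \<kappa> by (simp add: abs_mult mult_ac)
      also have "\<dots> \<le> \<kappa> * ((h * ?w) * ?w * norm (D1 j))"
      proof (intro mult_left_mono mult_right_mono \<kappa>)
        have "\<bar>sin (r * ?w)\<bar> \<le> \<bar>r * ?w\<bar>" by (rule abs_sin_x_le_abs_x)
        also have "\<dots> \<le> h * ?w" using r0 by (simp add: abs_mult mult_right_mono)
        finally show "\<bar>sin (r * ?w)\<bar> \<le> h * ?w" .
      qed auto
      finally have f: "norm (fst (Z' r j)) \<le> \<kappa> * (h * (?w\<^sup>2 * norm (D1 j)))"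
        by (simp add: power2_eq_square mult_ac)
      \<comment> \<open>The difference is quadratic in h<j>; with the weight <j> of the second
        component this becomes h^2 <j>^3 and uses up the H^3 bound on \<open>F\<close>.\<close>
      have cs: "\<bar>cos (r * ?w) - s j\<bar> \<le> (1 + 2 * c) * (h * ?w)\<^sup>2"
      proof -
        have "\<bar>cos (r * ?w) - 1\<bar> \<le> (r * ?w)\<^sup>2" by (rule abs_cos_minus_1)
        also have "\<dots> \<le> (h * ?w)\<^sup>2" using r0 by (intro power_mono mult_right_mono) auto
        finally have "\<bar>cos (r * ?w) - s j\<bar> \<le> (h * ?w)\<^sup>2 + 2 * c * (h * ?w)\<^sup>2"
          using s1[of j] by linarith
        then show ?thesis by (simp add: distrib_right)
      qed
      have "snd (Z' r j) = (\<kappa> * ?w) *\<^sub>R (cos (r * ?w) *\<^sub>R D2 j + (2 * (cos (r * ?w) - s j)) *\<^sub>R F m j)"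
        by (simp add: Z'_def Y'_def D2_def scaleR_conv_of_real algebra_simps)
      also have "norm \<dots> \<le> (\<kappa> * ?w) * (1 * norm (D2 j) + (2 * ((1 + 2 * c) * (h * ?w)\<^sup>2)) * norm (F m j))"
      proof -
        have "norm (cos (r * ?w) *\<^sub>R D2 j + (2 * (cos (r * ?w) - s j)) *\<^sub>R F m j)
            \<le> \<bar>cos (r * ?w)\<bar> * norm (D2 j) + (2 * \<bar>cos (r * ?w) - s j\<bar>) * norm (F m j)"
          by (rule order_trans[OF norm_triangle_ineq]) (simp only: norm_scaleR abs_mult abs_numeral order_refl)
        also have "\<dots> \<le> 1 * norm (D2 j) + (2 * ((1 + 2 * c) * (h * ?w)\<^sup>2)) * norm (F m j)"
          by (intro add_mono mult_right_mono mult_left_mono cs) auto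
        finally show ?thesis using \<kappa> by (simp add: abs_mult mult_left_mono)
      qed
      finally have g: "norm (snd (Z' r j)) \<le> \<kappa> * (?w * norm (D2 j) + 2 * (1 + 2 * c) * h\<^sup>2 * (?w ^ 3 * norm (F m j)))"
        by (simp add: power2_eq_square power3_eq_cube algebra_simps)
      have "norm (Z' r j) \<le> norm (fst (Z' r j)) + norm (snd (Z' r j))"
        by (metis norm_Pair_le prod.collapse)
      also have "\<dots> \<le> \<kappa> * (h * (?w\<^sup>2 * norm (D1 j)) + ?w * norm (D2 j) + 2 * (1 + 2 * c) * h\<^sup>2 * (?w ^ 3 * norm (F m j)))"
        using f g by (simp add: algebra_simps)
      also have "\<dots> \<le> \<kappa> * norm (h * (?w\<^sup>2 * norm (D1 j)) + ?w * norm (D2 j) + 2 * (1 + 2 * c) * h\<^sup>2 * (?w ^ 3 * norm (F m j)))"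
        using \<kappa> by (intro mult_left_mono) auto
      finally show ?thesis .
    qed
    have "ell2 (\<kappa> * (h * (3 * C * \<eta>) + 5 * C * \<eta> ^ 4 + 2 * (1 + 2 * c) * h\<^sup>2 * C)) (Z' r)"
      by (rule ell2_cmul[OF ell2_add[OF ell2_add[OF 1 2] 3] \<kappa> 4])
    then show ?thesis
    proof (rule ell2_mono)
      \<comment> \<open>The contributions 3 and 5 come from the interpolated first and second
        differences, 2 + 4c from the weight cos - s, where \<open>\<eta> ^ 6\<close> is weakened to
        \<open>\<eta> ^ 4\<close>.\<close>
      have "h * (3 * C * \<eta>) + 5 * C * \<eta> ^ 4 + 2 * (1 + 2 * c) * h\<^sup>2 * C = 8 * C * \<eta> ^ 4 + 2 * (1 + 2 * c) * C * \<eta> ^ 6"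
        by (simp add: h power_mult[symmetric] algebra_simps power_numeral_reduce)
      also have "\<dots> \<le> 8 * C * \<eta> ^ 4 + 2 * (1 + 2 * c) * C * \<eta> ^ 4"
        using C c \<eta>h by (intro add_left_mono mult_left_mono) auto
      also have "\<dots> = (10 + 4 * c) * C * \<eta> ^ 4" by (simp add: algebra_simps)
      finally show "\<kappa> * (h * (3 * C * \<eta>) + 5 * C * \<eta> ^ 4 + 2 * (1 + 2 * c) * h\<^sup>2 * C) \<le> \<kappa> * ((10 + 4 * c) * C * \<eta> ^ 4)"
        using \<kappa> by (intro mult_left_mono)
    qed simp
  qed
  have "ell2 (\<kappa> * ((10 + 4 * c) * C * \<eta> ^ 4) * (h / 2 - 0)) (\<lambda>j. Z (h / 2) j - Z 0 j)"
    by (rule ell2_mvt[where x' = Z', OF _ Zd Z'_bound]) (use hpos in auto)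
  moreover have "Z 0 j = 0" for j by (simp add: Z_def zero_prod_def)
  ultimately have "ell2 (\<kappa> * ((10 + 4 * c) * C * \<eta> ^ 4) * (h / 2)) (Z (h / 2))" by simp
  then show ?thesis
  proof (rule ell2_mono)
    fix j
    let ?w = "japanese j"
    have mh: "m + h / 2 = \<tau> + h" "m - h / 2 = \<tau>" by (simp_all add: m_def)
    have 1: "Y (m + h / 2) j = rot (- (h * ?w / 2)) (evec (U (\<tau> + h)) (V (\<tau> + h)) j)"
      unfolding mh Y_def by (simp add: m_def)
    have 2: "Y (m - h / 2) j = rot (- (h * ?w / 2)) (rot (h * ?w) (evec (U \<tau>) (V \<tau>) j))"
      unfolding mh Y_def rot_rot by (simp add: m_def)
    have 3: "(h / 2) *\<^sub>R (2 * \<kappa>) *\<^sub>R (0, (?w * s j) *\<^sub>R F m j) = rot (- (h * ?w / 2)) (\<kappa> *\<^sub>R kick b1 bb h (F m) j)"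
      unfolding rot_scale rot_kick[OF ca hpos] s_def by simp
    have "Z (h / 2) j = rot (- (h * ?w / 2)) (evec (U (\<tau> + h)) (V (\<tau> + h)) j - rot (h * ?w) (evec (U \<tau>) (V \<tau>) j)
       - \<kappa> *\<^sub>R kick b1 bb h (F m) j)"
      unfolding Z_def 1 2 3 rot_diff ..
    then show "norm (evec (U (\<tau> + h)) (V (\<tau> + h)) j - rot (h * ?w) (evec (U \<tau>) (V \<tau>) j)
       - \<kappa> *\<^sub>R kick b1 bb h (F (\<tau> + h / 2)) j) \<le> norm (Z (h / 2) j)"
      by (simp add: m_def)
  qed simp
qed

section \<open>The midpoint value\<close>

definition midc :: "real \<Rightarrow> (int \<Rightarrow> complex) \<Rightarrow> (int \<Rightarrow> complex) \<Rightarrow> int \<Rightarrow> complex" where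
  "midc h U V j = cos (h / 2 * japanese j) *\<^sub>R U j + (sin (h / 2 * japanese j) / japanese j) *\<^sub>R V j"

text \<open>The midpoint value follows the linear flow for half a step, so its H^2 norm inherits the
  isometry of \<open>rot\<close>.\<close>

lemma midc_rot: "(japanese j)\<^sup>2 *\<^sub>R midc h U V j = fst (rot (h / 2 * japanese j) (evec U V j))"
  by (simp add: midc_def rot_def evec_def scaleR_add_right power2_eq_square mult_ac)

lemma midc_diff: "midc h U V j - midc h U' V' j = midc h (\<lambda>j. U j - U' j) (\<lambda>j. V j - V' j) j"
  by (simp add: midc_def scaleR_diff_right)

lemma norm_midc: "norm ((japanese j)\<^sup>2 *\<^sub>R midc h U V j) \<le> norm (evec U V j)"
  unfolding midc_rot using norm_fst_le[of "fst (rot (h / 2 * japanese j) (evec U V j))" "snd (rot (h / 2 * japanese j) (evec U V j))"]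
  by simp

lemma norm_scaleR_le: "\<bar>r\<bar> \<le> 1 \<Longrightarrow> norm (r *\<^sub>R z) \<le> norm z"
  by (simp add: mult_left_le_one_le)

text \<open>The division by <j> lifts the velocity by one index, so the midpoint is as regular as
  the position.\<close>

lemma ell2_midc:
  assumes U: "sob (Suc k) A U" and V: "sob k B V"
  shows "sob (Suc k) (A + B) (midc h U V)"
proof -
  have 1: "ell2 A (\<lambda>j. cos (h / 2 * japanese j) *\<^sub>R (japanese j ^ Suc k *\<^sub>R U j))"
    by (rule ell2_mono[OF U order_refl]) (rule norm_scaleR_le, simp)
  have 2: "ell2 B (\<lambda>j. sin (h / 2 * japanese j) *\<^sub>R (japanese j ^ k *\<^sub>R V j))"
    by (rule ell2_mono[OF V order_refl]) (rule norm_scaleR_le, simp)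
  show ?thesis
    using ell2_add[OF 1 2] by (simp add: midc_def scaleR_add_right mult_ac)
qed

text \<open>In the frame rotated to m, the first component is forced only through sin((r - m)<j>),
  at most h<j> in modulus. This gains a factor h for one derivative of \<open>F\<close>, and
  integration over half a step gives O(\<open>\<kappa>\<close> h^2) in H^2.\<close>

lemma midpoint_error:
  assumes traj: "trajectory \<kappa> T M C U V F" and \<kappa>: "0 \<le> \<kappa>"
    and h: "0 < h" and \<tau>: "0 \<le> \<tau>" "\<tau> + h \<le> T"
  shows "ell2 (\<kappa> * h * C * (h / 2)) (\<lambda>j. (japanese j)\<^sup>2 *\<^sub>R (midc h (U \<tau>) (V \<tau>) j - U (\<tau> + h / 2) j))"
proof -
  define m where "m = \<tau> + h / 2"
  define Y where "Y r j = rot (- ((r - m) * japanese j)) (evec (U r) (V r) j)" for r j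
  define Y' where "Y' r j = ((- sin ((r - m) * japanese j) * japanese j * \<kappa>) *\<^sub>R F r j,
      (cos ((r - m) * japanese j) * japanese j * \<kappa>) *\<^sub>R F r j)" for r j
  have sub: "{\<tau>..m} \<subseteq> {0..T}" using h \<tau> by (auto simp: m_def)
  have "ell2 (\<kappa> * h * C * (m - \<tau>)) (\<lambda>j. fst (Y m j) - fst (Y \<tau> j))"
  proof (rule ell2_mvt[of _ _ _ "\<lambda>r j. fst (Y' r j)"])
    show "\<tau> \<le> m" using h by (simp add: m_def)
    fix r assume r: "r \<in> {\<tau>..m}"
    then have r': "r \<in> {0..T}" using sub by auto
    have "((\<lambda>s. Y s j) has_vector_derivative Y' r j) (at r within {0..T})" for j
      unfolding Y_def Y'_def evec_def
      by (rule rotated_deriv) (use traj r' in \<open>simp_all add: trajectory_def\<close>)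
    then show "((\<lambda>s. fst (Y s j)) has_vector_derivative fst (Y' r j)) (at r within {\<tau>..m})" for j
      by (intro bounded_linear.has_vector_derivative[OF bounded_linear_fst] has_vector_derivative_within_subset[OF _ sub])
    have F: "sob 2 C (F r)"
      by (rule ell2_weight_mono[of _ 3]) (use traj r' in \<open>simp_all add: trajectory_def\<close>)
    show "ell2 (\<kappa> * h * C) (\<lambda>j. fst (Y' r j))"
    proof (rule ell2_cmul[OF F])
      show "0 \<le> \<kappa> * h" using \<kappa> h by simp
      fix j
      let ?w = "japanese j"
      have "\<bar>sin ((r - m) * ?w)\<bar> \<le> \<bar>(r - m) * ?w\<bar>" by (rule abs_sin_x_le_abs_x)
      also have "\<dots> \<le> h * ?w" using r h by (auto simp: abs_mult m_def intro!: mult_right_mono)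
      finally have "\<bar>sin ((r - m) * ?w)\<bar> * (?w * \<kappa> * norm (F r j)) \<le> (h * ?w) * (?w * \<kappa> * norm (F r j))"
        using \<kappa> by (intro mult_right_mono) auto
      then show "norm (fst (Y' r j)) \<le> \<kappa> * h * norm ((japanese j)\<^sup>2 *\<^sub>R F r j)"
        using \<kappa> by (simp add: Y'_def abs_mult power2_eq_square mult_ac)
    qed
  qed
  then have "ell2 (\<kappa> * h * C * (h / 2)) (\<lambda>j. fst (Y m j) - fst (Y \<tau> j))" by (simp add: m_def)
  then show ?thesis
  proof (rule ell2_mono)
    fix j
    have "fst (Y \<tau> j) = (japanese j)\<^sup>2 *\<^sub>R midc h (U \<tau>) (V \<tau>) j" by (simp add: midc_rot Y_def m_def)
    moreover have "fst (Y m j) = (japanese j)\<^sup>2 *\<^sub>R U m j" by (simp add: Y_def evec_def)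
    ultimately have "fst (Y m j) - fst (Y \<tau> j) = - ((japanese j)\<^sup>2 *\<^sub>R (midc h (U \<tau>) (V \<tau>) j - U m j))"
      by (simp add: scaleR_diff_right)
    then show "norm ((japanese j)\<^sup>2 *\<^sub>R (midc h (U \<tau>) (V \<tau>) j - U (\<tau> + h / 2) j)) \<le> norm (fst (Y m j) - fst (Y \<tau> j))"
      by (simp add: m_def)
  qed simp
qed

section \<open>Error propagation\<close>

text \<open>\<open>H\<^sup>3 \<times> H\<^sup>2\<close> is the lowest regularity at which the second derivative of the midpoint value is
  classical; it is propagated without uniform bounds.\<close>

definition good_state :: "(real \<Rightarrow> real) \<Rightarrow> (real \<Rightarrow> real) \<Rightarrow> bool" where
  "good_state u v \<longleftrightarrow> periodic_L2 u \<and> periodic_L2 v \<and>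
     (\<exists>B. sob 3 B (fourier_coeff u)) \<and> (\<exists>B. sob 2 B (fourier_coeff v))"

lemma fun_Omega_trig: "fun_Omega \<phi> v = trig (\<lambda>j. of_real (\<phi> (japanese j)) * fourier_coeff v j)"
  by (simp add: fun_Omega_def trig_def fun_eq_iff)

lemma hermitian_multiplier: "hermitian c \<Longrightarrow> hermitian (\<lambda>j. of_real (\<phi> (japanese j)) * c j)"
  by (simp add: hermitian_def)

lemma hermitian_add: "hermitian c \<Longrightarrow> hermitian d \<Longrightarrow> hermitian (\<lambda>j. c j + d j)"
  by (simp add: hermitian_def)

lemma trig_facts:
  assumes "asum c" "hermitian c"
  shows "fourier_coeff (trig c) = c" "periodic_L2 (trig c)"
proof -
  show "fourier_coeff (trig c) = c" by (rule ext) (rule fourier_coeff_trig[OF assms])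
  show "periodic_L2 (trig c)" by (rule periodic_L2_continuous[OF trig_continuous[OF assms(1)] trig_periodic])
qed

lemma asum_scale: "asum w \<Longrightarrow> asum (\<lambda>j. of_real r * w j)"
  by (rule asum_cmul[of w _ "\<bar>r\<bar>"]) (simp_all add: norm_mult)

lemma midpoint_value_trig:
  assumes U: "asum (fourier_coeff u)" and V: "asum (fourier_coeff v)" and h: "0 < h"
  shows "midpoint_value h u v = trig (midc h (fourier_coeff u) (fourier_coeff v))"
proof
  fix x
  let ?A = "\<lambda>j. of_real (cos (h / 2 * japanese j)) * fourier_coeff u j"
  let ?B = "\<lambda>j. of_real (sinc (h / 2 * japanese j)) * fourier_coeff v j"
  have nz: "h / 2 * japanese j \<noteq> 0" for j using h by simp
  have A: "asum ?A"
    by (rule asum_cmul[OF U, of _ 1]) (simp add: norm_mult mult_left_le_one_le)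
  have s: "\<bar>sinc y\<bar> \<le> 1" for y :: real
    using abs_sin_x_le_abs_x[of y] by (auto simp: field_simps)
  have B: "asum ?B"
    by (rule asum_cmul[OF V, of _ 1]) (unfold norm_mult norm_of_real, intro mult_right_mono s norm_ge_zero)
  have B': "asum (\<lambda>j. of_real (h / 2) * ?B j)"
    by (rule asum_scale[OF B])
  have "midpoint_value h u v x = trig ?A x + h / 2 * trig ?B x"
    by (simp only: midpoint_value_def fun_Omega_trig)
  also have "\<dots> = trig (\<lambda>j. ?A j + of_real (h / 2) * ?B j) x"
    by (simp only: trig_add[OF A B'] trig_scale[OF B])
  also have "(\<lambda>j. ?A j + of_real (h / 2) * ?B j) = midc h (fourier_coeff u) (fourier_coeff v)"
    using h nz by (auto simp: midc_def fun_eq_iff scaleR_conv_of_real)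
  finally show "midpoint_value h u v x = trig (midc h (fourier_coeff u) (fourier_coeff v)) x" .
qed

text \<open>The nonlinearity at an H^3 midpoint is only in H^1, but the filters at fixed h regain
  two derivatives in the first component and one in the second, so H^3 x H^2 is preserved. Hermitian
  symmetry guarantees that the new functions have the computed coefficients.\<close>

lemma trig_step_state:
  assumes a: "smooth a" and g: "smooth g" and ca: "coeff_assumption c b1 bb" and h: "0 < h"
    and st: "good_state u v" and step: "trig_step b1 bb a g \<kappa> h (u, v) = (u', v')"
  defines "\<Phi> \<equiv> nlc a g (midc h (fourier_coeff u) (fourier_coeff v))"
  shows "good_state u' v'"
    "evec (fourier_coeff u') (fourier_coeff v') j = rot (h * japanese j) (evec (fourier_coeff u) (fourier_coeff v) j)
      + \<kappa> *\<^sub>R kick b1 bb h \<Phi> j"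
proof -
  let ?U = "fourier_coeff u" and ?V = "fourier_coeff v"
  obtain A where A: "sob 3 A ?U" using st by (auto simp: good_state_def)
  obtain B where B: "sob 2 B ?V" using st by (auto simp: good_state_def)
  have A': "sob (Suc 2) A ?U" using A by (simp add: numeral_3_eq_3)
  have B': "sob (Suc 1) B ?V" using B by (simp add: numeral_2_eq_2)
  have mid: "sob 3 (A + B) (midc h ?U ?V)"
    using ell2_midc[OF A' B] by (simp add: numeral_3_eq_3)
  define F where "F = nonlin a g (midpoint_value h u v)"
  have F_eq: "F = nonlin a g (trig (midc h ?U ?V))"
    unfolding F_def by (subst midpoint_value_trig[OF ell2_asum(1)[OF A'] ell2_asum(1)[OF B'] h]) (rule refl)
  have fcF: "fourier_coeff F = \<Phi>" by (simp add: F_eq \<Phi>_def nlc_def)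
  obtain R where "reg 0 R F"
    using nonlin_reg[OF a g, of "A + B" 0] mid by (auto simp del: reg.simps simp: F_eq)
  from reg_0_fourier[OF this] have \<Phi>1: "ell2 (2 * R) (\<lambda>j. japanese j *\<^sub>R \<Phi> j)" by (simp add: fcF)
  have as\<Phi>: "asum \<Phi>" by (rule ell2_imp_abs_summable(1)[OF \<Phi>1])
  have c: "0 \<le> c" by (rule coeff_assumption_nonneg[OF ca])
  let ?bb = "\<lambda>j. bb (h\<^sup>2 * (japanese j)\<^sup>2)" and ?b1 = "\<lambda>j. b1 (h\<^sup>2 * (japanese j)\<^sup>2)"
  have bbb: "(japanese j)\<^sup>2 * \<bar>?bb j\<bar> \<le> c / h\<^sup>2" for j
    using coeff_assumption_bounds(1)[OF ca h, of j] h by (simp add: field_simps power_mult_distrib)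
  have b1b: "japanese j * \<bar>?b1 j\<bar> \<le> c / h" for j
    using coeff_assumption_bounds(2)[OF ca h, of j] h by (simp add: field_simps)
  have bb0: "\<bar>?bb j\<bar> \<le> c / h\<^sup>2" for j
    using order_trans[OF mult_right_mono[of 1 "(japanese j)\<^sup>2" "\<bar>?bb j\<bar>"] bbb[of j]] japanese_ge_1[of j] by simp
  have b10: "\<bar>?b1 j\<bar> \<le> c / h" for j
    using order_trans[OF mult_right_mono[of 1 "japanese j" "\<bar>?b1 j\<bar>"] b1b[of j]] japanese_ge_1[of j] by simp
  define p1 p2 p3 q1 q2 q3 where
    "p1 = (\<lambda>j. of_real (cos (h * japanese j)) * ?U j)" and
    "p2 = (\<lambda>j. of_real (sinc (h * japanese j)) * ?V j)" and
    "p3 = (\<lambda>j. of_real (?bb j) * \<Phi> j)" and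
    "q1 = (\<lambda>j. of_real (japanese j * sin (h * japanese j)) * ?U j)" and
    "q2 = (\<lambda>j. of_real (cos (h * japanese j)) * ?V j)" and
    "q3 = (\<lambda>j. of_real (?b1 j) * \<Phi> j)"
  have nz: "h * japanese j \<noteq> 0" for j using h by simp
  have s: "\<bar>sinc y\<bar> \<le> 1" for y :: real
    using abs_sin_x_le_abs_x[of y] by (auto simp: field_simps)
  have p1: "asum p1" unfolding p1_def
    by (rule asum_cmul[OF ell2_asum(1)[OF A'], of _ 1]) (simp add: norm_mult mult_left_le_one_le)
  have p2: "asum p2" unfolding p2_def
    by (rule asum_cmul[OF ell2_asum(1)[OF B'], of _ 1]) (unfold norm_mult norm_of_real, intro mult_right_mono s norm_ge_zero)
  have p3: "asum p3" unfolding p3_def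
    by (rule asum_cmul[OF as\<Phi>, of _ "c / h\<^sup>2"]) (unfold norm_mult norm_of_real, intro mult_right_mono bb0 norm_ge_zero)
  have q1: "asum q1"
  proof -
    have "ell2 A (\<lambda>j. japanese j *\<^sub>R q1 j)"
    proof (rule ell2_mono[OF ell2_weight_mono[OF A, of 2] order_refl])
      fix j
      have "japanese j *\<^sub>R q1 j = sin (h * japanese j) *\<^sub>R ((japanese j)\<^sup>2 *\<^sub>R ?U j)"
        by (simp add: q1_def scaleR_conv_of_real power2_eq_square mult_ac)
      then show "norm (japanese j *\<^sub>R q1 j) \<le> norm ((japanese j)\<^sup>2 *\<^sub>R ?U j)"
        using norm_scaleR_le[of "sin (h * japanese j)" "(japanese j)\<^sup>2 *\<^sub>R ?U j"] by (simp del: norm_scaleR)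
    qed simp
    then show ?thesis by (rule ell2_imp_abs_summable(1))
  qed
  have q2: "asum q2" unfolding q2_def
    by (rule asum_cmul[OF ell2_asum(1)[OF B'], of _ 1]) (simp add: norm_mult mult_left_le_one_le)
  have q3: "asum q3" unfolding q3_def
    by (rule asum_cmul[OF as\<Phi>, of _ "c / h"]) (unfold norm_mult norm_of_real, intro mult_right_mono b10 norm_ge_zero)
  define u1 v1 where
    "u1 = (\<lambda>j. p1 j + of_real h * p2 j + of_real (\<kappa> * h\<^sup>2) * p3 j)" and
    "v1 = (\<lambda>j. of_real (-1) * q1 j + q2 j + of_real (\<kappa> * h) * q3 j)"
  have as1: "asum u1" unfolding u1_def by (intro asum_add asum_scale p1 p2 p3)
  have as2: "asum v1" unfolding v1_def by (intro asum_add asum_scale q1 q2 q3)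
  have eqs: "u' = (\<lambda>x. trig p1 x + h * trig p2 x + \<kappa> * h\<^sup>2 * trig p3 x)"
    "v' = (\<lambda>x. - trig q1 x + trig q2 x + \<kappa> * h * trig q3 x)"
    using step unfolding trig_step_def Let_def F_def[symmetric] prod.case prod.inject fun_Omega_trig fcF
      p1_def p2_def p3_def q1_def q2_def q3_def by auto
  have u1: "u' = trig u1"
    unfolding eqs u1_def by (rule ext) (simp only: trig_add asum_add asum_scale p1 p2 p3 trig_scale)
  have v1: "v' = trig v1"
    unfolding eqs v1_def by (rule ext) (simp add: trig_add asum_add asum_scale q1 q2 q3 trig_scale del: of_real_minus of_real_mult)
  have herm\<Phi>: "hermitian \<Phi>" unfolding \<Phi>_def nlc_def by (rule hermitian_fourier_coeff)
  have hermsc: "hermitian (\<lambda>j. of_real r * w j)" if "hermitian w" for r w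
    using that by (simp add: hermitian_def)
  have h1: "hermitian u1" unfolding u1_def p1_def p2_def p3_def
    by (intro hermitian_add hermsc hermitian_multiplier[of _ "\<lambda>w. cos (h * w)"] hermitian_multiplier[of _ "\<lambda>w. sinc (h * w)"]
        hermitian_multiplier[of _ "\<lambda>w. bb (h\<^sup>2 * w\<^sup>2)"] hermitian_fourier_coeff herm\<Phi>)
  have h2: "hermitian v1" unfolding v1_def q1_def q2_def q3_def
    by (intro hermitian_add hermsc hermitian_multiplier[of _ "\<lambda>w. cos (h * w)"] hermitian_multiplier[of _ "\<lambda>w. w * sin (h * w)"]
        hermitian_multiplier[of _ "\<lambda>w. b1 (h\<^sup>2 * w\<^sup>2)"] hermitian_fourier_coeff herm\<Phi>)
  note fu = trig_facts[OF as1 h1, folded u1] and fv = trig_facts[OF as2 h2, folded v1]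
  have hs: "h * sinc (h * japanese j) = sin (h * japanese j) / japanese j" for j
    using nz[of j] h by auto
  show ev: "evec (fourier_coeff u') (fourier_coeff v') j = rot (h * japanese j) (evec ?U ?V j) + \<kappa> *\<^sub>R kick b1 bb h \<Phi> j" for j
  proof -
    have "(japanese j)\<^sup>2 *\<^sub>R u1 j = cos (h * japanese j) *\<^sub>R ((japanese j)\<^sup>2 *\<^sub>R ?U j)
        + ((japanese j)\<^sup>2 * (h * sinc (h * japanese j))) *\<^sub>R ?V j
        + \<kappa> *\<^sub>R (((japanese j)\<^sup>2 * h\<^sup>2 * ?bb j) *\<^sub>R \<Phi> j)"
      unfolding u1_def p1_def p2_def p3_def by (simp only: scaleR_conv_of_real of_real_mult of_real_power algebra_simps)
    also have "(japanese j)\<^sup>2 * (h * sinc (h * japanese j)) = sin (h * japanese j) * japanese j"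
      unfolding hs by (simp add: power2_eq_square)
    finally have 1: "(japanese j)\<^sup>2 *\<^sub>R u1 j = cos (h * japanese j) *\<^sub>R ((japanese j)\<^sup>2 *\<^sub>R ?U j)
        + sin (h * japanese j) *\<^sub>R (japanese j *\<^sub>R ?V j) + \<kappa> *\<^sub>R (((japanese j)\<^sup>2 * h\<^sup>2 * ?bb j) *\<^sub>R \<Phi> j)" by simp
    have 2: "japanese j *\<^sub>R v1 j = cos (h * japanese j) *\<^sub>R (japanese j *\<^sub>R ?V j)
        - sin (h * japanese j) *\<^sub>R ((japanese j)\<^sup>2 *\<^sub>R ?U j) + \<kappa> *\<^sub>R ((japanese j * h * ?b1 j) *\<^sub>R \<Phi> j)"
      unfolding v1_def q1_def q2_def q3_def by (simp add: scaleR_conv_of_real power2_eq_square algebra_simps)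
    show ?thesis unfolding fu(1) fv(1)
      by (simp add: evec_def rot_def kick_def 1 2)
  qed
  have g1: "sob 3 (A + B + \<bar>\<kappa>\<bar> * c * (2 * R)) u1"
  proof -
    have 1: "ell2 A (\<lambda>j. cos (h * japanese j) *\<^sub>R (japanese j ^ 3 *\<^sub>R ?U j))"
      by (rule ell2_mono[OF A order_refl]) (rule norm_scaleR_le, simp)
    have 2: "ell2 B (\<lambda>j. sin (h * japanese j) *\<^sub>R ((japanese j)\<^sup>2 *\<^sub>R ?V j))"
      by (rule ell2_mono[OF B order_refl]) (rule norm_scaleR_le, simp)
    have 3: "ell2 (\<bar>\<kappa>\<bar> * c * (2 * R)) (\<lambda>j. \<kappa> *\<^sub>R ((japanese j ^ 3 * h\<^sup>2 * ?bb j) *\<^sub>R \<Phi> j))"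
    proof (rule ell2_cmul[OF \<Phi>1])
      show "0 \<le> \<bar>\<kappa>\<bar> * c" using c by simp
      fix j
      have "(japanese j)\<^sup>2 * h\<^sup>2 * \<bar>?bb j\<bar> \<le> c"
        using coeff_assumption_bounds(1)[OF ca h, of j] by (simp add: power_mult_distrib mult_ac)
      then have "\<bar>\<kappa>\<bar> * (((japanese j)\<^sup>2 * h\<^sup>2 * \<bar>?bb j\<bar>) * (japanese j * norm (\<Phi> j))) \<le> \<bar>\<kappa>\<bar> * (c * (japanese j * norm (\<Phi> j)))"
        by (intro mult_left_mono mult_right_mono) auto
      then show "norm (\<kappa> *\<^sub>R ((japanese j ^ 3 * h\<^sup>2 * ?bb j) *\<^sub>R \<Phi> j)) \<le> \<bar>\<kappa>\<bar> * c * norm (japanese j *\<^sub>R \<Phi> j)"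
        using h by (simp add: abs_mult power2_eq_square power3_eq_cube mult_ac)
    qed
    have "japanese j ^ 3 *\<^sub>R u1 j = cos (h * japanese j) *\<^sub>R (japanese j ^ 3 *\<^sub>R ?U j)
        + sin (h * japanese j) *\<^sub>R ((japanese j)\<^sup>2 *\<^sub>R ?V j) + \<kappa> *\<^sub>R ((japanese j ^ 3 * h\<^sup>2 * ?bb j) *\<^sub>R \<Phi> j)" for j
    proof -
      have "japanese j ^ 3 *\<^sub>R u1 j = cos (h * japanese j) *\<^sub>R (japanese j ^ 3 *\<^sub>R ?U j)
          + (japanese j ^ 3 * (h * sinc (h * japanese j))) *\<^sub>R ?V j + \<kappa> *\<^sub>R ((japanese j ^ 3 * h\<^sup>2 * ?bb j) *\<^sub>R \<Phi> j)"
        unfolding u1_def p1_def p2_def p3_def by (simp only: scaleR_conv_of_real of_real_mult of_real_power algebra_simps)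
      also have "japanese j ^ 3 * (h * sinc (h * japanese j)) = sin (h * japanese j) * (japanese j)\<^sup>2"
        unfolding hs by (simp add: power2_eq_square power3_eq_cube)
      finally show ?thesis by simp
    qed
    then show ?thesis using ell2_add[OF ell2_add[OF 1 2] 3] by simp
  qed
  have g2: "sob 2 (A + B + \<bar>\<kappa>\<bar> * c * (2 * R)) v1"
  proof -
    have 1: "ell2 A (\<lambda>j. (- sin (h * japanese j)) *\<^sub>R (japanese j ^ 3 *\<^sub>R ?U j))"
      by (rule ell2_mono[OF A order_refl]) (rule norm_scaleR_le, simp)
    have 2: "ell2 B (\<lambda>j. cos (h * japanese j) *\<^sub>R ((japanese j)\<^sup>2 *\<^sub>R ?V j))"
      by (rule ell2_mono[OF B order_refl]) (rule norm_scaleR_le, simp)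
    have 3: "ell2 (\<bar>\<kappa>\<bar> * c * (2 * R)) (\<lambda>j. \<kappa> *\<^sub>R (((japanese j)\<^sup>2 * h * ?b1 j) *\<^sub>R \<Phi> j))"
    proof (rule ell2_cmul[OF \<Phi>1])
      show "0 \<le> \<bar>\<kappa>\<bar> * c" using c by simp
      fix j
      have "\<bar>\<kappa>\<bar> * ((h * japanese j * \<bar>?b1 j\<bar>) * (japanese j * norm (\<Phi> j))) \<le> \<bar>\<kappa>\<bar> * (c * (japanese j * norm (\<Phi> j)))"
        using coeff_assumption_bounds(2)[OF ca h, of j] by (intro mult_left_mono mult_right_mono) auto
      then show "norm (\<kappa> *\<^sub>R (((japanese j)\<^sup>2 * h * ?b1 j) *\<^sub>R \<Phi> j)) \<le> \<bar>\<kappa>\<bar> * c * norm (japanese j *\<^sub>R \<Phi> j)"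
        using h by (simp add: abs_mult power2_eq_square mult_ac)
    qed
    have "(japanese j)\<^sup>2 *\<^sub>R v1 j = (- sin (h * japanese j)) *\<^sub>R (japanese j ^ 3 *\<^sub>R ?U j)
        + cos (h * japanese j) *\<^sub>R ((japanese j)\<^sup>2 *\<^sub>R ?V j) + \<kappa> *\<^sub>R (((japanese j)\<^sup>2 * h * ?b1 j) *\<^sub>R \<Phi> j)" for j
      unfolding v1_def q1_def q2_def q3_def
      by (simp add: scaleR_conv_of_real power2_eq_square power3_eq_cube algebra_simps)
    then show ?thesis using ell2_add[OF ell2_add[OF 1 2] 3] by simp
  qed
  show "good_state u' v'"
    unfolding good_state_def fu(1) fv(1) using fu(2) fv(2) g1 g2 by blast
qed

lemma energy_norm_1_le:
  assumes "ell2 E (evec (fourier_coeff u) (fourier_coeff v))"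
  shows "energy_norm 1 u v \<le> E"
proof -
  let ?p = "\<lambda>j. (norm (japanese j ^ 2 *\<^sub>R fourier_coeff u j))\<^sup>2"
  let ?q = "\<lambda>j. (norm (japanese j ^ 1 *\<^sub>R fourier_coeff v j))\<^sup>2"
  have eq: "(norm (evec (fourier_coeff u) (fourier_coeff v) j))\<^sup>2 = ?p j + ?q j" for j
    by (simp add: evec_def norm_Pair add_nonneg_nonneg)
  have S: "0 \<le> E" "(\<lambda>j. ?p j + ?q j) summable_on UNIV" "(\<Sum>\<^sub>\<infinity>j. ?p j + ?q j) \<le> E\<^sup>2"
    using assms unfolding ell2_iff_summable eq by auto
  have p: "?p summable_on UNIV" and q: "?q summable_on UNIV"
    by (rule summable_on_comparison_test[OF S(2)]; simp)+
  have nn: "0 \<le> (\<Sum>\<^sub>\<infinity>j. ?p j)" "0 \<le> (\<Sum>\<^sub>\<infinity>j. ?q j)" by (intro infsum_nonneg; simp)+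
  have "sobolev_norm (real 2) u = sqrt (\<Sum>\<^sub>\<infinity>j. ?p j)" "sobolev_norm (real 1) v = sqrt (\<Sum>\<^sub>\<infinity>j. ?q j)"
    unfolding sobolev_norm_def japanese_powr by simp_all
  then have "energy_norm 1 u v = sqrt ((\<Sum>\<^sub>\<infinity>j. ?p j) + (\<Sum>\<^sub>\<infinity>j. ?q j))"
    unfolding energy_norm_def using nn by simp
  also have "\<dots> = sqrt (\<Sum>\<^sub>\<infinity>j. ?p j + ?q j)" using infsum_add[OF p q] by simp
  also have "\<dots> \<le> E" using S by (simp add: real_le_lsqrt real_sqrt_le_iff sqrt_le_D)
  finally show ?thesis .
qed

text \<open>The new error is the rotated old error, plus \<open>\<kappa>\<close> times a difference
  of kicks, minus the local defect. The kicks differ by the effect of the old error on the midpoint,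
  at most LE, and by the deviation of the linear midpoint from the exact value at m.\<close>

lemma error_step:
  assumes traj: "trajectory \<kappa> T M C U V (\<lambda>t. nlc a g (U t))" and ca: "coeff_assumption c b1 bb"
    and \<kappa>: "0 \<le> \<kappa>" "\<kappa> \<le> 1"
    and \<eta>: "0 < \<eta>" "\<eta> \<le> 1" and h: "h = \<eta> ^ 3" and \<tau>: "0 \<le> \<tau>" "\<tau> + h \<le> T"
    and L: "nlc_lip a g (2 * \<bar>M\<bar> + 1) L"
    and E: "ell2 E (\<lambda>j. evec P Q j - evec (U \<tau>) (V \<tau>) j)" "E \<le> 1"
    and PQ: "sob 3 A P" "sob 2 B Q"
    and PQ': "\<And>j. evec P' Q' j = rot (h * japanese j) (evec P Q j) + \<kappa> *\<^sub>R kick b1 bb h (nlc a g (midc h P Q)) j"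
  shows "ell2 ((1 + \<kappa> * (2 * c * L)) * E + \<kappa> * h * ((c * L * C + (5 + 2 * c) * C) * (\<kappa> * h + \<eta> ^ 4)))
     (\<lambda>j. evec P' Q' j - evec (U (\<tau> + h)) (V (\<tau> + h)) j)"
proof -
  have hpos: "0 < h" using h \<eta> by simp
  have c: "0 \<le> c" by (rule coeff_assumption_nonneg[OF ca])
  define m where "m = \<tau> + h / 2"
  have \<tau>I: "\<tau> \<in> {0..T}" and m: "m \<in> {0..T}" using \<tau> hpos by (auto simp: m_def)
  have UV: "sob 5 M (U t)" "sob 4 M (V t)"
    "ell2 C (\<lambda>j. japanese j ^ 3 *\<^sub>R nlc a g (U t) j)" if "t \<in> {0..T}" for t
    using traj that by (auto simp: trajectory_def)
  have M: "0 \<le> M" and C: "0 \<le> C" using ell2_nonneg[OF UV(1)[OF m]] ell2_nonneg[OF UV(3)[OF m]] by auto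
  let ?w = "midc h (U \<tau>) (V \<tau>)" and ?n = "midc h P Q"
  have w5: "sob (Suc 2) (M + M) ?w"
    by (rule ell2_midc; rule ell2_weight_mono[OF UV(1)[OF \<tau>I]] ell2_weight_mono[OF UV(2)[OF \<tau>I]]) auto
  have w3: "sob 3 (2 * \<bar>M\<bar> + 1) ?w"
    by (rule ell2_mono[OF w5]) (use M in \<open>simp_all add: numeral_3_eq_3\<close>)
  have w2: "sob 2 (2 * \<bar>M\<bar>) ?w"
    by (rule ell2_mono[OF ell2_weight_mono[OF w5, of 2]]) (use M in auto)
  have U3: "sob 3 (2 * \<bar>M\<bar> + 1) (U m)"
    by (rule ell2_mono[OF ell2_weight_mono[OF UV(1)[OF m], of 3]]) (use M in auto)
  have n3: "sob 3 (A + B) ?n"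
    using ell2_midc[of A 2 P B Q h] PQ by (simp add: numeral_3_eq_3)
  have nw: "ell2 E (\<lambda>j. japanese j ^ 2 *\<^sub>R (?n j - ?w j))"
  proof (rule ell2_mono[OF E(1) order_refl])
    fix j
    have "evec P Q j - evec (U \<tau>) (V \<tau>) j = evec (\<lambda>j. P j - U \<tau> j) (\<lambda>j. Q j - V \<tau> j) j"
      by (simp add: evec_def scaleR_diff_right)
    then show "norm (japanese j ^ 2 *\<^sub>R (?n j - ?w j)) \<le> norm (evec P Q j - evec (U \<tau>) (V \<tau>) j)"
      using norm_midc[of j h "\<lambda>j. P j - U \<tau> j" "\<lambda>j. Q j - V \<tau> j"] by (simp add: midc_diff del: norm_scaleR)
  qed
  \<comment> \<open>Here \<open>E \<le> 1\<close> enters: the midpoint of the exact data has H^2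
    bound 2M, so the numerical midpoint stays in the ball of radius
    \<open>2 * \<bar>M\<bar> + 1\<close> for which \<open>L\<close> was chosen.\<close>
  have n2: "sob 2 (2 * \<bar>M\<bar> + 1) ?n"
    by (rule ell2_mono[OF ell2_add[OF w2 nw]]) (use E in \<open>simp_all add: scaleR_diff_right del: norm_scaleR\<close>)
  have w2': "sob 2 (2 * \<bar>M\<bar> + 1) ?w" by (rule ell2_mono[OF w2]) auto
  have d1: "ell2 (L * E) (\<lambda>j. nlc a g ?n j - nlc a g ?w j)" by (rule nlc_lipD[OF L n2 n3 w3 nw])
  have d2: "ell2 (L * (\<kappa> * h * C * (h / 2))) (\<lambda>j. nlc a g ?w j - nlc a g (U m) j)"
    by (rule nlc_lipD[OF L w2' w3 U3]) (unfold m_def, rule midpoint_error[OF traj \<kappa>(1) hpos \<tau>])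
  have d: "ell2 (L * E + L * (\<kappa> * h * C * (h / 2))) (\<lambda>j. nlc a g ?n j - nlc a g (U m) j)"
    using ell2_add[OF d1 d2] by simp
  have k: "ell2 (\<kappa> * (2 * c) * (L * E + L * (\<kappa> * h * C * (h / 2))))
      (\<lambda>j. \<kappa> *\<^sub>R (kick b1 bb h (nlc a g ?n) j - kick b1 bb h (nlc a g (U m)) j))"
  proof (rule ell2_cmul[OF d])
    show "0 \<le> \<kappa> * (2 * c)" using \<kappa> c by simp
    show "norm (\<kappa> *\<^sub>R (kick b1 bb h (nlc a g ?n) j - kick b1 bb h (nlc a g (U m)) j))
        \<le> \<kappa> * (2 * c) * norm (nlc a g ?n j - nlc a g (U m) j)" for j
      unfolding kick_diff using mult_left_mono[OF norm_kick[OF ca hpos] \<kappa>(1)] \<kappa>(1) by (simp add: mult.assoc)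
  qed
  have r: "ell2 E (\<lambda>j. rot (h * japanese j) (evec P Q j - evec (U \<tau>) (V \<tau>) j))"
    by (rule ell2_mono[OF E(1) order_refl]) simp
  note le = local_error[OF traj ca \<kappa>(1) \<eta> h \<tau>]
  have "ell2 (E + \<kappa> * (2 * c) * (L * E + L * (\<kappa> * h * C * (h / 2))) + \<kappa> * ((10 + 4 * c) * C * \<eta> ^ 4) * (h / 2))
    (\<lambda>j. evec P' Q' j - evec (U (\<tau> + h)) (V (\<tau> + h)) j)"
  proof (rule ell2_mono[OF ell2_diff[OF ell2_add[OF r k] le] order_refl])
    show "norm (evec P' Q' j - evec (U (\<tau> + h)) (V (\<tau> + h)) j)
      \<le> norm (rot (h * japanese j) (evec P Q j - evec (U \<tau>) (V \<tau>) j)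
        + \<kappa> *\<^sub>R (kick b1 bb h (nlc a g ?n) j - kick b1 bb h (nlc a g (U m)) j)
        - (evec (U (\<tau> + h)) (V (\<tau> + h)) j - rot (h * japanese j) (evec (U \<tau>) (V \<tau>) j)
          - \<kappa> *\<^sub>R kick b1 bb h (nlc a g (U (\<tau> + h / 2))) j))" for j
      unfolding PQ' by (simp add: rot_diff m_def algebra_simps)
  qed
  then show ?thesis
  proof (rule ell2_mono)
    \<comment> \<open>These are the two mixed terms produced by multiplying out the right-hand side;
      they are exactly the slack in the inequality.\<close>
    have "0 \<le> \<kappa> * h * (c * L * C * \<eta> ^ 4 + (5 + 2 * c) * C * (\<kappa> * h))"
      using \<kappa> hpos c L C \<eta> unfolding nlc_lip_def by (intro mult_nonneg_nonneg add_nonneg_nonneg) auto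
    then show "E + \<kappa> * (2 * c) * (L * E + L * (\<kappa> * h * C * (h / 2))) + \<kappa> * ((10 + 4 * c) * C * \<eta> ^ 4) * (h / 2)
       \<le> (1 + \<kappa> * (2 * c * L)) * E + \<kappa> * h * ((c * L * C + (5 + 2 * c) * C) * (\<kappa> * h + \<eta> ^ 4))"
      by (simp add: algebra_simps)
  qed simp
qed

text \<open>Since \<open>\<kappa> \<le> K h\<close>, the remainder \<open>\<kappa> h\<^sup>4\<^sup>/\<^sup>3\<close> left over by the local errors is a small multiple of \<open>h\<^sup>2\<close>
  once \<open>\<kappa>\<close> is small; here \<open>h = \<eta>\<^sup>3\<close>.\<close>

lemma remainder_small:
  fixes P K \<kappa> \<eta> h :: real
  assumes P: "1 \<le> P" and K: "0 < K" and \<kappa>: "0 < \<kappa>" "\<kappa> \<le> 1 / (2 * P * K)" "\<kappa> \<le> 1 / (8 * P ^ 3 * K\<^sup>2)"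
    and \<eta>: "0 < \<eta>" and h: "h = \<eta> ^ 3" and \<kappa>h: "\<kappa> \<le> K * h"
  shows "\<kappa> * P * (\<kappa> * h + \<eta> ^ 4) \<le> h\<^sup>2"
proof -
  have hpos: "0 < h" unfolding h using \<eta> by simp
  have 1: "\<kappa> * P * (\<kappa> * h) \<le> h\<^sup>2 / 2"
  proof -
    have "\<kappa> * P * K \<le> 1 / 2" using \<kappa>(2) P K by (simp add: field_simps)
    then have "\<kappa> * P * K * h\<^sup>2 \<le> 1 / 2 * h\<^sup>2" by (intro mult_right_mono) auto
    moreover have "\<kappa> * P * (\<kappa> * h) \<le> \<kappa> * P * ((K * h) * h)"
      using \<kappa> P \<kappa>h hpos by (intro mult_left_mono mult_right_mono) auto
    ultimately show ?thesis by (simp add: power2_eq_square mult_ac)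
  qed
  \<comment> \<open>Cubing avoids fractional powers, as the cube of \<open>\<eta>\<^sup>2\<close> is
    h^2. One factor \<open>\<kappa>\<close> is absorbed by the smallness condition with P^3 K^2, the
    other two by \<open>\<kappa> \<le> K * h\<close>.\<close>
  have "(2 * \<kappa> * P) ^ 3 \<le> (\<eta>\<^sup>2) ^ 3"
  proof -
    have "(2 * \<kappa> * P) ^ 3 * K\<^sup>2 = \<kappa> * (8 * P ^ 3 * K\<^sup>2) * \<kappa>\<^sup>2"
      by (simp add: power_mult_distrib power2_eq_square power3_eq_cube)
    also have "\<dots> \<le> 1 * \<kappa>\<^sup>2"
      using \<kappa>(3) P K by (intro mult_right_mono) (simp_all add: field_simps)
    also have "\<dots> \<le> (K * h)\<^sup>2" unfolding mult_1 using \<kappa> \<kappa>h by (intro power_mono) auto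
    finally have "(2 * \<kappa> * P) ^ 3 * K\<^sup>2 \<le> h\<^sup>2 * K\<^sup>2" by (simp add: power_mult_distrib mult.commute)
    then have "(2 * \<kappa> * P) ^ 3 \<le> h\<^sup>2" using K by simp
    then show ?thesis by (simp add: h power_mult[symmetric])
  qed
  then have "2 * \<kappa> * P \<le> \<eta>\<^sup>2" using power_le_imp_le_base[of "2 * \<kappa> * P" 2 "\<eta>\<^sup>2"] by (simp add: numeral_3_eq_3)
  then have "2 * \<kappa> * P * \<eta> ^ 4 \<le> \<eta>\<^sup>2 * \<eta> ^ 4" by (intro mult_right_mono) auto
  then have 2: "\<kappa> * P * \<eta> ^ 4 \<le> h\<^sup>2 / 2" by (simp add: h power_mult[symmetric] power_add[symmetric])
  show ?thesis using 1 2 by (simp add: distrib_left)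
qed

theorem theorem3p3:
  fixes a :: "real \<Rightarrow> real" and g :: "real \<times> real \<Rightarrow> real" and c M :: real
  assumes "smooth a" and "smooth g" and "a 0 = 0" and "g (0, 0) = 0" and "M > 0"
  shows "\<exists>C h0. h0 > 0 \<and>
    (\<forall>T \<delta> A0 K :: real. T > 0 \<longrightarrow> 0 < \<delta> \<longrightarrow> \<delta> < 1 \<longrightarrow> A0 \<ge> 0 \<longrightarrow> K > 0 \<longrightarrow>
      (\<exists>\<kappa>0>0. \<forall>\<kappa> h b1 bbar1 u0 v0 u ut.
        0 < \<kappa> \<longrightarrow> \<kappa> \<le> \<kappa>0 \<longrightarrow> \<kappa> \<le> K * h \<longrightarrow> h < h0 \<longrightarrow>
        coeff_assumption c b1 bbar1 \<longrightarrow>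
        wave_solution \<kappa> a g T u0 v0 u ut \<longrightarrow>
        (\<forall>t\<in>{0..T}. in_energy_space 4 (u t) (ut t) \<and> energy_norm 4 (u t) (ut t) \<le> M) \<longrightarrow>
        (\<forall>t\<in>{0..T}. \<forall>x. \<delta> \<le> 1 + \<kappa> * a (u t x) \<and> \<kappa> * a (u t x) \<le> A0) \<longrightarrow>
        (\<forall>n un vn. trig_integrator b1 bbar1 a g \<kappa> h u0 v0 n = (un, vn) \<longrightarrow> real n * h \<le> T \<longrightarrow>
           in_energy_space 1 un vn \<and>
           energy_norm 1 (\<lambda>x. un x - u (real n * h) x) (\<lambda>x. vn x - ut (real n * h) x)
             \<le> C * h\<^sup>2)))"
proof -
  note a = assms(1) and g = assms(2)
  obtain C where C: "C \<ge> 0" "\<And>\<kappa> T u0 v0 u ut. quasilinear_wave a g \<kappa> T M u0 v0 u ut \<Longrightarrow>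
    trajectory \<kappa> T M C (\<lambda>t. fourier_coeff (u t)) (\<lambda>t. fourier_coeff (ut t)) (\<lambda>t. nlc a g (fourier_coeff (u t)))"
    using exact_trajectory[OF a g, of M] by blast
  obtain L where L: "nlc_lip a g (2 * \<bar>M\<bar> + 1) L" using nlc_lipschitz[OF a g] by blast
  then have L0: "0 \<le> L" by (simp add: nlc_lip_def)
  define A where "A = 2 * c * L"
  define D where "D = c * L * C + (5 + 2 * c) * C"
  show ?thesis
  \<comment> \<open>Both constants can be 1: they are fixed before T and K, and everything depending
    on T and K goes into \<open>\<kappa>0\<close>. The condition h < 1 gives
    \<open>\<eta> \<le> 1\<close> and h^2 <= 1.\<close>
  proof (rule exI[of _ 1], rule exI[of _ 1], intro conjI allI impI)
    fix T \<delta> A0 K :: real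
    assume T: "0 < T" and K: "0 < K"
    \<comment> \<open>Number of steps times h, local error constant and amplification factor; the
      summand 1 secures P >= 1. The minimum with 1 in \<open>\<kappa>0\<close> serves the locale,
      the other two entries serve \<open>remainder_small\<close>.\<close>
    define P where "P = T * \<bar>D\<bar> * exp (K * T * A) + 1"
    have P: "1 \<le> P" using T by (simp add: P_def)
    define \<kappa>0 where "\<kappa>0 = min 1 (min (1 / (2 * P * K)) (1 / (8 * P ^ 3 * K\<^sup>2)))"
    have "0 < \<kappa>0" using P K by (simp add: \<kappa>0_def)
    moreover have "in_energy_space 1 un vn \<and>
           energy_norm 1 (\<lambda>x. un x - u (real n * h) x) (\<lambda>x. vn x - ut (real n * h) x) \<le> 1 * h\<^sup>2"
      if \<kappa>: "0 < \<kappa>" "\<kappa> \<le> \<kappa>0" and \<kappa>h: "\<kappa> \<le> K * h" and h1: "h < 1" and ca: "coeff_assumption c b1 bbar1"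
        and sol: "wave_solution \<kappa> a g T u0 v0 u ut"
        and en: "\<forall>t\<in>{0..T}. in_energy_space 4 (u t) (ut t) \<and> energy_norm 4 (u t) (ut t) \<le> M"
        and n: "trig_integrator b1 bbar1 a g \<kappa> h u0 v0 n = (un, vn)" "real n * h \<le> T"
      for \<kappa> h b1 bbar1 u0 v0 u ut n un vn
    proof -
      have \<kappa>1: "\<kappa> \<le> 1" and \<kappa>2: "\<kappa> \<le> 1 / (2 * P * K)" "\<kappa> \<le> 1 / (8 * P ^ 3 * K\<^sup>2)"
        using \<kappa>(2) by (auto simp: \<kappa>0_def)
      interpret quasilinear_wave a g \<kappa> T M u0 v0 u ut
        by unfold_locales (use a g \<kappa>(1) \<kappa>1 sol en in auto)
      have traj: "trajectory \<kappa> T M C U V (\<lambda>t. nlc a g (U t))"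
        by (rule C(2)) unfold_locales
      have h: "0 < h" using \<kappa>(1) \<kappa>h K by (metis less_le_trans zero_less_mult_pos)
      \<comment> \<open>With the cube root of h as parameter, the cut-offs and error orders are
        integer powers.\<close>
      define \<eta> where "\<eta> = root 3 h"
      have \<eta>: "0 < \<eta>" "\<eta> \<le> 1" "h = \<eta> ^ 3" using h h1 by (simp_all add: \<eta>_def)
      have c: "0 \<le> c" by (rule coeff_assumption_nonneg[OF ca])
      have A: "0 \<le> A" and D: "0 \<le> D" using c L0 C by (simp_all add: A_def D_def)
      define \<beta> where "\<beta> = \<kappa> * h * (D * (\<kappa> * h + \<eta> ^ 4))"
      have \<beta>: "0 \<le> \<beta>" using \<kappa> h D \<eta> by (simp add: \<beta>_def)
      \<comment> \<open>The amplification is bounded because n \<open>\<kappa>\<close> <= K n h <= K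
        T, and the n local errors contribute n h <= T; the remaining factor is the quantity in
        \<open>remainder_small\<close>.\<close>
      have small: "real n * \<beta> * (1 + \<kappa> * A) ^ n \<le> h\<^sup>2" if n: "real n * h \<le> T" for n
      proof -
        have "(1 + \<kappa> * A) ^ n \<le> exp (\<kappa> * A) ^ n"
          using \<kappa> A by (intro power_mono exp_ge_add_one_self) auto
        also have "\<dots> = exp (real n * \<kappa> * A)" by (simp add: exp_of_nat_mult[symmetric] mult.assoc)
        also have "\<dots> \<le> exp (K * T * A)"
        proof -
          have "real n * \<kappa> \<le> real n * (K * h)" using \<kappa>h by (intro mult_left_mono) auto
          also have "\<dots> = K * (real n * h)" by simp
          also have "\<dots> \<le> K * T" using n K by (intro mult_left_mono) auto
          finally show ?thesis using A by (simp add: mult_right_mono)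
        qed
        finally have "real n * \<beta> * (1 + \<kappa> * A) ^ n \<le> real n * \<beta> * exp (K * T * A)"
          using \<beta> by (intro mult_left_mono) auto
        also have "\<dots> = (real n * h) * (\<kappa> * D * (\<kappa> * h + \<eta> ^ 4) * exp (K * T * A))"
          by (simp add: \<beta>_def)
        also have "\<dots> \<le> T * (\<kappa> * D * (\<kappa> * h + \<eta> ^ 4) * exp (K * T * A))"
          using n \<kappa> D h \<eta> by (intro mult_right_mono) auto
        also have "\<dots> = \<kappa> * (T * \<bar>D\<bar> * exp (K * T * A)) * (\<kappa> * h + \<eta> ^ 4)"
          using D by simp
        also have "\<dots> \<le> \<kappa> * P * (\<kappa> * h + \<eta> ^ 4)"
          using \<kappa> h \<eta> by (intro mult_right_mono mult_left_mono) (auto simp: P_def)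
        also have "\<dots> \<le> h\<^sup>2"
          by (rule remainder_small[OF P K \<kappa>(1) \<kappa>2 \<eta>(1) \<eta>(3) \<kappa>h])
        finally show ?thesis .
      qed
      \<comment> \<open>A closed form of the accumulated error is carried through the induction, so
        that \<open>small\<close> applies at every earlier step. It starts from zero, since the
        integrator begins with the exact data.\<close>
      have main: "good_state un vn \<and>
          ell2 (real n * \<beta> * (1 + \<kappa> * A) ^ n) (\<lambda>j. evec (fourier_coeff un) (fourier_coeff vn) j - evec (U (real n * h)) (V (real n * h)) j)"
        if "trig_integrator b1 bbar1 a g \<kappa> h u0 v0 n = (un, vn)" "real n * h \<le> T" for n un vn
        using that
      proof (induction n arbitrary: un vn)
        case 0
        have z: "(0::real) \<in> {0..T}" using T by simp
        have init: "un = u 0" "vn = ut 0" using 0 sol by (auto simp: trig_integrator_def wave_solution_def)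
        have "continuous_on UNIV (u 0)" using u_eq_trig[OF z] trig_continuous[OF trig_values_bound(4)[OF U3[OF z]]] by metis
        moreover have "u 0 (x + 2 * pi) = u 0 x" for x using sol z unfolding wave_solution_def by blast
        ultimately have "periodic_L2 (u 0)" by (rule periodic_L2_continuous)
        moreover have "sob 2 M (V 0)" by (rule ell2_weight_mono[OF V_ell2[OF z]]) simp
        ultimately have "good_state un vn"
          unfolding good_state_def init using periodic_L2_ut[OF z] U3[OF z] by blast
        moreover have "ell2 0 (\<lambda>j::int. 0 :: complex \<times> complex)" by (simp add: ell2_iff_sum)
        ultimately show ?case by (simp add: init)
      next
        case (Suc n)
        obtain p q where pq: "trig_integrator b1 bbar1 a g \<kappa> h u0 v0 n = (p, q)" by fastforce
        have step: "trig_step b1 bbar1 a g \<kappa> h (p, q) = (un, vn)"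
          using Suc.prems(1) pq by (simp add: trig_integrator_def)
        have nh: "real n * h + h \<le> T" using Suc.prems(2) by (simp add: algebra_simps)
        then have nT: "real n * h \<le> T" using h by linarith
        have IH: "good_state p q"
          "ell2 (real n * \<beta> * (1 + \<kappa> * A) ^ n) (\<lambda>j. evec (fourier_coeff p) (fourier_coeff q) j - evec (U (real n * h)) (V (real n * h)) j)"
          using Suc.IH[OF pq nT] by auto
        obtain B1 B2 where B: "sob 3 B1 (fourier_coeff p)" "sob 2 B2 (fourier_coeff q)"
          using IH(1) by (auto simp: good_state_def)
        \<comment> \<open>Closes the bootstrap: the accumulated error is at most h^2 <= 1, which is
          the smallness that \<open>error_step\<close> requires for the next step.\<close>
        have le1: "real n * \<beta> * (1 + \<kappa> * A) ^ n \<le> 1"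
          using small[OF nT] power_le_one[of h 2] h h1 by linarith
        note ts = trig_step_state[OF a g ca h IH(1) step]
        have S: "ell2 ((1 + \<kappa> * (2 * c * L)) * (real n * \<beta> * (1 + \<kappa> * A) ^ n)
            + \<kappa> * h * ((c * L * C + (5 + 2 * c) * C) * (\<kappa> * h + \<eta> ^ 4)))
          (\<lambda>j. evec (fourier_coeff un) (fourier_coeff vn) j - evec (U (real n * h + h)) (V (real n * h + h)) j)"
          by (rule error_step[OF traj ca _ \<kappa>1 \<eta>(1,2,3) _ nh L IH(2) le1 B ts(2)]) (use \<kappa> h in auto)
        have le: "(1 + \<kappa> * (2 * c * L)) * (real n * \<beta> * (1 + \<kappa> * A) ^ n)
            + \<kappa> * h * ((c * L * C + (5 + 2 * c) * C) * (\<kappa> * h + \<eta> ^ 4)) \<le> real (Suc n) * \<beta> * (1 + \<kappa> * A) ^ Suc n"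
        proof -
          have "1 \<le> (1 + \<kappa> * A) ^ Suc n" using \<kappa> A by (intro one_le_power) auto
          then have "\<beta> * 1 \<le> \<beta> * (1 + \<kappa> * A) ^ Suc n" using \<beta> by (intro mult_left_mono)
          then show ?thesis unfolding A_def[symmetric] D_def[symmetric] \<beta>_def[symmetric] by (simp add: algebra_simps)
        qed
        have tn: "real n * h + h = real (Suc n) * h" by (simp add: algebra_simps)
        have "ell2 (real (Suc n) * \<beta> * (1 + \<kappa> * A) ^ Suc n)
           (\<lambda>j. evec (fourier_coeff un) (fourier_coeff vn) j - evec (U (real (Suc n) * h)) (V (real (Suc n) * h)) j)"
          by (rule ell2_mono[OF S[unfolded tn] le]) (rule order_refl)
        then show ?case using ts(1) by blast
      qed
      let ?t = "real n * h"
      have t: "?t \<in> {0..T}" using n(2) h by simp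
      have st: "good_state un vn" using main[OF n] by blast
      have e: "ell2 (h\<^sup>2) (\<lambda>j. evec (fourier_coeff un) (fourier_coeff vn) j - evec (U ?t) (V ?t) j)"
        using main[OF n] by (intro ell2_mono[OF _ small[OF n(2)]]) auto
      obtain B1 B2 where B: "sob 3 B1 (fourier_coeff un)" "sob 2 B2 (fourier_coeff vn)"
        and L2: "periodic_L2 un" "periodic_L2 vn"
        using st by (auto simp: good_state_def)
      have "in_sobolev (real 2) un" by (rule in_sobolev_ell2[OF L2(1) ell2_weight_mono[OF B(1)]]) simp
      moreover have "in_sobolev (real 1) vn" by (rule in_sobolev_ell2[OF L2(2) ell2_weight_mono[OF B(2)]]) simp
      ultimately have "in_energy_space 1 un vn" by (simp add: in_energy_space_def)
      moreover have "energy_norm 1 (\<lambda>x. un x - u ?t x) (\<lambda>x. vn x - ut ?t x) \<le> h\<^sup>2"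
      proof (rule energy_norm_1_le)
        have "evec (fourier_coeff (\<lambda>x. un x - u ?t x)) (fourier_coeff (\<lambda>x. vn x - ut ?t x))
            = (\<lambda>j. evec (fourier_coeff un) (fourier_coeff vn) j - evec (U ?t) (V ?t) j)"
          by (simp add: fun_eq_iff evec_def fourier_coeff_diff coeff_integrable_L2 L2 coeff_integrable_u[OF t]
              coeff_integrable_ut[OF t] scaleR_diff_right)
        then show "ell2 (h\<^sup>2) (evec (fourier_coeff (\<lambda>x. un x - u ?t x)) (fourier_coeff (\<lambda>x. vn x - ut ?t x)))"
          using e by simp
      qed
      ultimately show ?thesis by simp
    qed
    ultimately show "\<exists>\<kappa>0>0. \<forall>\<kappa> h b1 bbar1 u0 v0 u ut.
        0 < \<kappa> \<longrightarrow> \<kappa> \<le> \<kappa>0 \<longrightarrow> \<kappa> \<le> K * h \<longrightarrow> h < 1 \<longrightarrow>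
        coeff_assumption c b1 bbar1 \<longrightarrow>
        wave_solution \<kappa> a g T u0 v0 u ut \<longrightarrow>
        (\<forall>t\<in>{0..T}. in_energy_space 4 (u t) (ut t) \<and> energy_norm 4 (u t) (ut t) \<le> M) \<longrightarrow>
        (\<forall>t\<in>{0..T}. \<forall>x. \<delta> \<le> 1 + \<kappa> * a (u t x) \<and> \<kappa> * a (u t x) \<le> A0) \<longrightarrow>
        (\<forall>n un vn. trig_integrator b1 bbar1 a g \<kappa> h u0 v0 n = (un, vn) \<longrightarrow> real n * h \<le> T \<longrightarrow>
           in_energy_space 1 un vn \<and>
           energy_norm 1 (\<lambda>x. un x - u (real n * h) x) (\<lambda>x. vn x - ut (real n * h) x)
             \<le> 1 * h\<^sup>2)"
      by (intro exI[of _ \<kappa>0] conjI allI impI) blast+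
  qed simp
qed

end
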